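(* Let $k$ be a field, let $V$ be a finite dimensional $k$-vector space and let $A=T(V)/(R)$ be a quadratic algebra, with $R\subseteq V\otimes V$. Let $A^!=T(V^{\ast})/(R^{\perp})$ be the Koszul dual of $A$. There is an isomorphism of $\mathbb{N}\times\mathbb{N}$-graded unital associative algebras $$(HK^{\bullet}(A),\smile_K)\;\cong\;(\widetilde{HK}^{\bullet}(A^!),\widetilde{\smile}_K),$$ where the left-hand side is graded by the biweight (homological weight, coefficient weight) and the right-hand side is graded by the inverse biweight (coefficient weight, homological weight). In particular, for any $p\geq 0$ and $m\geq 0$, there is a $k$-linear isomorphism $$HK^p(A)_m\cong \widetilde{HK}^m(A^!)_p .$$
   Context: $\otimes=\otimes_k$, $Hom=Hom_k$. For a quadratic algebra $A=T(V)/(R)$ ($V$ a vector space, $R$ a subspace of $V\otimes V$), $A_m$ is the component of weight $m$ (weight inherited from the tensor degree of $T(V)$). Put $W_0=k$, $W_1=V$, and $W_p=\bigcap_{i+2+j=p}V^{\otimes i}\otimes R\otimes V^{\otimes j}\subseteq V^{\otimes p}$ for $p\ge 2$. An element of $W_p$ is written $x_1\ldots x_p$, meaning a sum of such tensors with $x_i\in V$; the same notation is used when $W_p$ is viewed inside $V^{\otimes q}\otimes W_r\otimes V^{\otimes s}$, $q+r+s=p$. Koszul cochains: a linear map $f:W_p\to A_m$ has homological weight $p$ and coefficient weight $m$ (biweight $(p,m)$); $Hom(W_\bullet,A)=\bigoplus_p Hom(W_p,A)$. Koszul cohomology: for $f:W_p\to A$, $b_K(f)(x_1\ldots x_{p+1})=f(x_1\ldots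 x_p)x_{p+1}-(-1)^p x_1f(x_2\ldots x_{p+1})$; $HK^\bullet(A)$ is the cohomology of $(Hom(W_\bullet,A),b_K)$. The Koszul cup product of $f:W_p\to A$ and $g:W_q\to A$ is $(f\smile_K g)(x_1\ldots x_{p+q})=(-1)^{pq}f(x_1\ldots x_p)g(x_{p+1}\ldots x_{p+q})$; it induces a product on $HK^\bullet(A)$. $HK^p(A)_m$ is the component of biweight $(p,m)$ (classes of cocycles $W_p\to A_m$). Modified Koszul cohomology: for $f:W_p\to A_m$ and $g:W_q\to A_n$, $\tilde b_K(f)(x_1\ldots x_{p+1})=f(x_1\ldots x_p)x_{p+1}-(-1)^m x_1f(x_2\ldots x_{p+1})$ and $(f\,\widetilde\smile_K\, g)(x_1\ldots x_{p+q})=(-1)^{mn}f(x_1\ldots x_p)g(x_{p+1}\ldots x_{p+q})$. $\widetilde{HK}^\bullet(A)$ is the cohomology of $(Hom(W_\bullet,A),\tilde b_K)$ with the induced product; $\widetilde{HK}^p(A)_m$ denotes the classes of $\tilde b_K$-cocycles $W_p\to A_m$, and this component is given the degree $(m,p)$ (inverse biweight). Koszul dual: $V^{\ast}=Hom(V,k)$ and $R^\perp\subseteq V^{\ast}\otimes V^{\ast}\cong (V\otimes V)^{\ast}$ (natural identification without sign) is the space of forms vanishing on $R$. The constructions above for $A^!$ are those of the quadratic algebra $T(V^{\ast})/(R^\perp)$. *)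

theory Defs
  imports
    Complex_Main
    "HOL-Algebra.QuotRing"
    "HOL-Algebra.Module"
    "HOL-Library.FuncSet"
    "HOL-Library.Function_Algebras"
begin

section \<open>The tensor algebra of a vector space\<close>

text \<open>
  A vector space is a subspace \<open>V\<close> of an ambient type with scalar multiplication \<open>scale\<close>. The
  carrier is needed because a dual space is a proper subspace of the type of all functions.

  Tensors are realised without choosing a basis. A function \<open>\<phi>\<close> on lists is multilinear if, for
  every \<open>n\<close>, it restricts to an \<open>n\<close>-linear map on \<open>V\<^sup>n\<close> (the lists of length \<open>n\<close> over \<open>V\<close>). The tensor
  of \<open>x\<^sub>1, \<dots>, x\<^sub>n\<close> is the functional that evaluates multilinear forms at the list
  \<open>[x\<^sub>1, \<dots>, x\<^sub>n]\<close>, and \<open>T(V)\<close> is the span of these functionals. As \<open>k\<close> is a field, linear forms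
  separate points, so this span has the universal property of the tensor algebra: see
  \<open>pure_tensor_multilinear\<close> and \<open>pure_tensor_universal\<close> below.
\<close>

type_synonym ('k, 'v) tensor = "('v list \<Rightarrow> 'k) \<Rightarrow> 'k"

definition fscale :: "'k::field \<Rightarrow> ('x \<Rightarrow> 'k) \<Rightarrow> 'x \<Rightarrow> 'k" where
  "fscale c f = (\<lambda>x. c * f x)"

definition multilinear_on ::
    "('k::field \<Rightarrow> 'v::ab_group_add \<Rightarrow> 'v) \<Rightarrow> 'v set \<Rightarrow> ('k \<Rightarrow> 'e::ab_group_add \<Rightarrow> 'e) \<Rightarrow>
     ('v list \<Rightarrow> 'e) \<Rightarrow> bool" where
  "multilinear_on scale V scale' \<phi> \<longleftrightarrow>
     (\<forall>xs ys. set xs \<subseteq> V \<and> set ys \<subseteq> V \<longrightarrow>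
        (\<forall>u\<in>V. \<forall>v\<in>V. \<phi> (xs @ (u + v) # ys) = \<phi> (xs @ u # ys) + \<phi> (xs @ v # ys)) \<and>
        (\<forall>c. \<forall>u\<in>V. \<phi> (xs @ scale c u # ys) = scale' c (\<phi> (xs @ u # ys))))"

definition pure_tensor ::
    "('k::field \<Rightarrow> 'v::ab_group_add \<Rightarrow> 'v) \<Rightarrow> 'v set \<Rightarrow> 'v list \<Rightarrow> ('k, 'v) tensor" where
  "pure_tensor scale V xs = (\<lambda>\<phi>. if multilinear_on scale V (*) \<phi> then \<phi> xs else 0)"

definition tensors ::
    "('k::field \<Rightarrow> 'v::ab_group_add \<Rightarrow> 'v) \<Rightarrow> 'v set \<Rightarrow> ('k, 'v) tensor set" where
  "tensors scale V = Modules.module.span fscale {pure_tensor scale V xs |xs. set xs \<subseteq> V}"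

definition tensor_power ::
    "('k::field \<Rightarrow> 'v::ab_group_add \<Rightarrow> 'v) \<Rightarrow> 'v set \<Rightarrow> nat \<Rightarrow> ('k, 'v) tensor set" where
  "tensor_power scale V p =
     Modules.module.span fscale {pure_tensor scale V xs |xs. set xs \<subseteq> V \<and> length xs = p}"

text \<open>The concatenation product of \<open>T(V)\<close>; see \<open>tensor_mult_pure\<close> for its effect on pure tensors.\<close>

definition tensor_mult ::
    "('k::field \<Rightarrow> 'v::ab_group_add \<Rightarrow> 'v) \<Rightarrow> 'v set \<Rightarrow>
     ('k, 'v) tensor \<Rightarrow> ('k, 'v) tensor \<Rightarrow> ('k, 'v) tensor" where
  "tensor_mult scale V s t =
     (\<lambda>\<phi>. if multilinear_on scale V (*) \<phi> then s (\<lambda>xs. t (\<lambda>ys. \<phi> (xs @ ys))) else 0)"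

definition tensor_algebra ::
    "('k::field \<Rightarrow> 'v::ab_group_add \<Rightarrow> 'v) \<Rightarrow> 'v set \<Rightarrow> ('k, ('k, 'v) tensor) module" where
  "tensor_algebra scale V =
     \<lparr>carrier = tensors scale V, mult = tensor_mult scale V, one = pure_tensor scale V [],
      zero = 0, add = (+), smult = fscale\<rparr>"

lemma pure_tensor_multilinear: "multilinear_on scale V fscale (pure_tensor scale V)"
  by (auto simp: multilinear_on_def[of _ _ fscale] pure_tensor_def fscale_def fun_eq_iff)
     (auto simp: multilinear_on_def)

lemma pure_tensor_universal:
  fixes scale' :: "'k::field \<Rightarrow> 'e::ab_group_add \<Rightarrow> 'e"
  assumes "vector_space scale'" and \<psi>: "multilinear_on scale V scale' \<psi>"
    and rel: "(\<Sum>xs\<in>S. fscale (c xs) (pure_tensor scale V xs)) = 0"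
  shows "(\<Sum>xs\<in>S. scale' (c xs) (\<psi> xs)) = 0"
proof (rule ccontr)
  assume nz: "(\<Sum>xs\<in>S. scale' (c xs) (\<psi> xs)) \<noteq> 0" (is "?e \<noteq> 0")
  interpret E: vector_space scale' by fact
  interpret vector_space_pair scale' "(*) :: 'k \<Rightarrow> 'k \<Rightarrow> 'k"
    by unfold_locales (auto simp: algebra_simps)
  obtain g where g: "Vector_Spaces.linear scale' (*) g" "g ?e = 1"
    using linear_independent_extend[of "{?e}" "\<lambda>_. 1"] nz by auto
  have \<phi>: "multilinear_on scale V (*) (g \<circ> \<psi>)"
    using \<psi> by (simp add: multilinear_on_def linear_add[OF g(1)] linear_scale[OF g(1)])
  have "(\<Sum>xs\<in>S. fscale (c xs) (pure_tensor scale V xs)) \<phi> =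
        (\<Sum>xs\<in>S. fscale (c xs) (pure_tensor scale V xs) \<phi>)" for \<phi>
    by (induction S rule: infinite_finite_induct) auto
  from this[of "g \<circ> \<psi>"] rel have "(\<Sum>xs\<in>S. c xs * g (\<psi> xs)) = 0"
    by (simp add: fscale_def pure_tensor_def \<phi>)
  also have "(\<Sum>xs\<in>S. c xs * g (\<psi> xs)) = g ?e"
    by (simp add: linear_sum[OF g(1)] linear_scale[OF g(1)])
  finally show False using g(2) by simp
qed

lemma tensor_mult_pure:
  assumes "vector_space scale" "Modules.module.subspace scale V" "set xs \<subseteq> V" "set ys \<subseteq> V"
  shows "tensor_mult scale V (pure_tensor scale V xs) (pure_tensor scale V ys) =
         pure_tensor scale V (xs @ ys)"
proof
  fix \<phi>
  interpret vector_space scale by fact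
  have "pure_tensor scale V xs (\<lambda>xs. pure_tensor scale V ys (\<lambda>ys. \<phi> (xs @ ys))) = \<phi> (xs @ ys)"
    if \<phi>: "multilinear_on scale V (*) \<phi>"
  proof -
    note mult = \<phi>[unfolded multilinear_on_def, rule_format]
    have left: "multilinear_on scale V (*) (\<lambda>ys. \<phi> (zs @ ys))" if "set zs \<subseteq> V" for zs
      unfolding multilinear_on_def using mult[of "zs @ _"] that by simp
    have eq: "pure_tensor scale V ys (\<lambda>ys. \<phi> (zs @ ys)) = \<phi> (zs @ ys)" if "set zs \<subseteq> V" for zs
      using left[OF that] by (simp add: pure_tensor_def)
    have "multilinear_on scale V (*) (\<lambda>xs. pure_tensor scale V ys (\<lambda>ys. \<phi> (xs @ ys)))"
    proof -
      have "pure_tensor scale V ys (\<lambda>ys. \<phi> (as @ u # bs @ ys)) = \<phi> (as @ u # bs @ ys)"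
        if "set as \<subseteq> V" "set bs \<subseteq> V" "u \<in> V" for as bs u
        using eq[of "as @ u # bs"] that by simp
      then show ?thesis
        unfolding multilinear_on_def using assms(2,4) mult[of _ "_ @ ys"]
        by (simp add: subspace_add subspace_scale)
    qed
    then show ?thesis
      using eq[OF assms(3)] by (simp add: pure_tensor_def[of _ _ xs])
  qed
  then show "tensor_mult scale V (pure_tensor scale V xs) (pure_tensor scale V ys) \<phi> =
             pure_tensor scale V (xs @ ys) \<phi>"
    by (simp add: tensor_mult_def pure_tensor_def[of _ _ "xs @ ys"])
qed


section \<open>Graded algebras and their quotients\<close>

text \<open>Algebras over \<open>k\<close> are records of type \<open>('k, 'a) module\<close>, which carry a multiplication; the
  locale \<open>algebra\<close> of the library is not used because it requires commutativity.\<close>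

definition scalars :: "'k::field ring" where
  "scalars = \<lparr>carrier = UNIV, mult = (*), one = 1, zero = 0, add = (+)\<rparr>"

definition quotient_algebra :: "('k, 'a) module \<Rightarrow> 'a set \<Rightarrow> ('k, 'a set) module" where
  "quotient_algebra M I =
     \<lparr>carrier = carrier (M Quot I), mult = mult (M Quot I), one = one (M Quot I),
      zero = zero (M Quot I), add = add (M Quot I),
      smult = (\<lambda>c X. \<Union>x\<in>X. I +>\<^bsub>M\<^esub> (c \<odot>\<^bsub>M\<^esub> x))\<rparr>"

definition bigraded_algebra :: "('k::field, 'a) module \<Rightarrow> (nat \<times> nat \<Rightarrow> 'a set) \<Rightarrow> bool" where
  "bigraded_algebra M G \<longleftrightarrow>
     ring M \<and> Module.module scalars M \<and>
     (\<forall>c. \<forall>x\<in>carrier M. \<forall>y\<in>carrier M.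
        (c \<odot>\<^bsub>M\<^esub> x) \<otimes>\<^bsub>M\<^esub> y = c \<odot>\<^bsub>M\<^esub> (x \<otimes>\<^bsub>M\<^esub> y) \<and> x \<otimes>\<^bsub>M\<^esub> (c \<odot>\<^bsub>M\<^esub> y) = c \<odot>\<^bsub>M\<^esub> (x \<otimes>\<^bsub>M\<^esub> y)) \<and>
     (\<forall>i. submodule (G i) scalars M) \<and>
     (\<forall>x\<in>carrier M. \<exists>!f. (\<forall>i. f i \<in> G i) \<and> finite {i. f i \<noteq> \<zero>\<^bsub>M\<^esub>} \<and>
        x = (\<Oplus>\<^bsub>M\<^esub> i \<in> {i. f i \<noteq> \<zero>\<^bsub>M\<^esub>}. f i)) \<and>
     \<one>\<^bsub>M\<^esub> \<in> G (0, 0) \<and>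
     (\<forall>p m q n. \<forall>x\<in>G (p, m). \<forall>y\<in>G (q, n). x \<otimes>\<^bsub>M\<^esub> y \<in> G (p + q, m + n))"

definition bigraded_algebra_iso ::
    "('a \<Rightarrow> 'b) \<Rightarrow> ('k, 'a) module \<Rightarrow> (nat \<times> nat \<Rightarrow> 'a set) \<Rightarrow>
     ('k, 'b) module \<Rightarrow> (nat \<times> nat \<Rightarrow> 'b set) \<Rightarrow> bool" where
  "bigraded_algebra_iso h M G N H \<longleftrightarrow>
     h \<in> ring_iso M N \<and>
     (\<forall>c. \<forall>x\<in>carrier M. h (c \<odot>\<^bsub>M\<^esub> x) = c \<odot>\<^bsub>N\<^esub> h x) \<and>
     (\<forall>i. h ` G i = H i)"

definition linear_iso ::
    "('a \<Rightarrow> 'b) \<Rightarrow> ('k, 'a) module \<Rightarrow> 'a set \<Rightarrow> ('k, 'b) module \<Rightarrow> 'b set \<Rightarrow> bool" where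
  "linear_iso h M X N Y \<longleftrightarrow>
     bij_betw h X Y \<and>
     (\<forall>x\<in>X. \<forall>y\<in>X. h (x \<oplus>\<^bsub>M\<^esub> y) = h x \<oplus>\<^bsub>N\<^esub> h y) \<and>
     (\<forall>c. \<forall>x\<in>X. h (c \<odot>\<^bsub>M\<^esub> x) = c \<odot>\<^bsub>N\<^esub> h x)"


section \<open>Koszul cohomology of a quadratic algebra\<close>

locale quadratic_data =
  fixes scale :: "'k::field \<Rightarrow> 'v::ab_group_add \<Rightarrow> 'v"
    and V :: "'v set"
    and R :: "('k, 'v) tensor set"
begin

definition T :: "('k, ('k, 'v) tensor) module" where
  "T = tensor_algebra scale V"

definition relation_ideal :: "('k, 'v) tensor set" where
  "relation_ideal = Idl\<^bsub>T\<^esub> R"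

definition A :: "('k, ('k, 'v) tensor set) module" where
  "A = quotient_algebra T relation_ideal"

definition proj :: "('k, 'v) tensor \<Rightarrow> ('k, 'v) tensor set" where
  "proj t = relation_ideal +>\<^bsub>T\<^esub> t"

definition A_weight :: "nat \<Rightarrow> ('k, 'v) tensor set set" where
  "A_weight m = proj ` tensor_power scale V m"

text \<open>For \<open>p < 2\<close> the condition on \<open>i\<close> and \<open>j\<close> is void, so that \<open>W 0\<close> is \<open>k\<close> (the span of the empty
  tensor) and \<open>W 1\<close> is \<open>V\<close>.\<close>

definition W :: "nat \<Rightarrow> ('k, 'v) tensor set" where
  "W p = {w \<in> tensor_power scale V p. \<forall>i j. i + 2 + j = p \<longrightarrow>
     w \<in> Modules.module.span fscale
       {x \<otimes>\<^bsub>T\<^esub> r \<otimes>\<^bsub>T\<^esub> y |x r y. x \<in> tensor_power scale V i \<and> r \<in> R \<and> y \<in> tensor_power scale V j}}"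

text \<open>The space of linear maps from \<open>W p\<close> to \<open>A\<^sub>m\<close>; maps are undefined outside \<open>W p\<close>.\<close>

definition Hom_W :: "nat \<Rightarrow> nat \<Rightarrow> (('k, 'v) tensor \<Rightarrow> ('k, 'v) tensor set) set" where
  "Hom_W p m = {f \<in> W p \<rightarrow>\<^sub>E A_weight m.
     (\<forall>x\<in>W p. \<forall>y\<in>W p. f (x + y) = f x \<oplus>\<^bsub>A\<^esub> f y) \<and>
     (\<forall>c. \<forall>x\<in>W p. f (fscale c x) = c \<odot>\<^bsub>A\<^esub> f x)}"

text \<open>The map on \<open>W (p + q)\<close> denoted
  \<open>x\<^sub>1 \<dots> x\<^sub>p\<^sub>+\<^sub>q \<mapsto> f(x\<^sub>1 \<dots> x\<^sub>p) g(x\<^sub>p\<^sub>+\<^sub>1 \<dots> x\<^sub>p\<^sub>+\<^sub>q)\<close>: an element of \<open>W (p + q)\<close> is a sum of products of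
  elements of \<open>W p\<close> and \<open>W q\<close>, and the value does not depend on the choice of such a sum.\<close>

definition concat_prod ::
    "nat \<Rightarrow> nat \<Rightarrow> (('k, 'v) tensor \<Rightarrow> ('k, 'v) tensor set) \<Rightarrow>
     (('k, 'v) tensor \<Rightarrow> ('k, 'v) tensor set) \<Rightarrow> ('k, 'v) tensor \<Rightarrow> ('k, 'v) tensor set" where
  "concat_prod p q f g = (\<lambda>w\<in>W (p + q). THE a. \<exists>(n::nat) x y.
     (\<forall>i<n. x i \<in> W p \<and> y i \<in> W q) \<and>
     w = (\<Sum>i<n. x i \<otimes>\<^bsub>T\<^esub> y i) \<and>
     a = (\<Oplus>\<^bsub>A\<^esub> i \<in> {..<n}. f (x i) \<otimes>\<^bsub>A\<^esub> g (y i)))"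

text \<open>An element of \<open>Hom(W\<^sub>\<bullet>, A)\<close> is given by its components of biweight \<open>(p, m)\<close>, finitely many of
  which are nonzero. (As \<open>W p\<close> is finite-dimensional, \<open>Hom(W p, A)\<close> is the direct sum of the
  \<open>Hom_W p m\<close> over \<open>m\<close>.)

  The Koszul calculus and the modified one differ only in the weight that governs signs, which is
  the parameter \<open>wt\<close>: \<open>fst\<close> (homological weight) and \<open>snd\<close> (coefficient weight) respectively.\<close>

type_synonym ('a, 'b) cochain = "nat \<times> nat \<Rightarrow> ('a, 'b) tensor \<Rightarrow> ('a, 'b) tensor set"

definition zero_map :: "nat \<Rightarrow> ('k, 'v) tensor \<Rightarrow> ('k, 'v) tensor set" where
  "zero_map p = (\<lambda>w\<in>W p. \<zero>\<^bsub>A\<^esub>)"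

definition cup :: "(nat \<times> nat \<Rightarrow> nat) \<Rightarrow> ('k, 'v) cochain \<Rightarrow> ('k, 'v) cochain \<Rightarrow> ('k, 'v) cochain" where
  "cup wt F G = (\<lambda>(r, l). \<lambda>w\<in>W r. finsum A
     (\<lambda>(p, m). (- 1) ^ (wt (p, m) * wt (r - p, l - m)) \<odot>\<^bsub>A\<^esub>
        concat_prod p (r - p) (F (p, m)) (G (r - p, l - m)) w)
     ({..r} \<times> {..l}))"

definition cochain_algebra :: "(nat \<times> nat \<Rightarrow> nat) \<Rightarrow> ('k, ('k, 'v) cochain) module" where
  "cochain_algebra wt =
     \<lparr>carrier = {F. (\<forall>p m. F (p, m) \<in> Hom_W p m) \<and> finite {(p, m). F (p, m) \<noteq> zero_map p}},
      mult = cup wt,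
      one = (\<lambda>(p, m). if (p, m) = (0, 0) then restrict proj (W 0) else zero_map p),
      zero = (\<lambda>(p, m). zero_map p),
      add = (\<lambda>F G (p, m). \<lambda>w\<in>W p. F (p, m) w \<oplus>\<^bsub>A\<^esub> G (p, m) w),
      smult = (\<lambda>c F (p, m). \<lambda>w\<in>W p. c \<odot>\<^bsub>A\<^esub> F (p, m) w)\<rparr>"

text \<open>The canonical map \<open>V \<rightarrow> A\<close>.\<close>

definition incl :: "('k, 'v) tensor \<Rightarrow> ('k, 'v) tensor set" where
  "incl = restrict proj (W 1)"

text \<open>The differential raises both weights by one: it sends \<open>f\<close> of biweight \<open>(p, m)\<close> to
  \<open>f(x\<^sub>1 \<dots> x\<^sub>p) x\<^sub>p\<^sub>+\<^sub>1 - (-1)\<^bsup>wt(p, m)\<^esup> x\<^sub>1 f(x\<^sub>2 \<dots> x\<^sub>p\<^sub>+\<^sub>1)\<close>, of biweight \<open>(p + 1, m + 1)\<close>.\<close>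

definition differential :: "(nat \<times> nat \<Rightarrow> nat) \<Rightarrow> ('k, 'v) cochain \<Rightarrow> ('k, 'v) cochain" where
  "differential wt F = (\<lambda>(r, l). case (r, l) of
     (Suc p, Suc m) \<Rightarrow> (\<lambda>w\<in>W (Suc p).
       concat_prod p 1 (F (p, m)) incl w \<ominus>\<^bsub>A\<^esub>
       (- 1) ^ wt (p, m) \<odot>\<^bsub>A\<^esub> concat_prod 1 p incl (F (p, m)) w)
   | _ \<Rightarrow> zero_map r)"

definition cocycles :: "(nat \<times> nat \<Rightarrow> nat) \<Rightarrow> ('k, 'v) cochain set" where
  "cocycles wt =
     {F \<in> carrier (cochain_algebra wt). differential wt F = \<zero>\<^bsub>cochain_algebra wt\<^esub>}"

definition coboundaries :: "(nat \<times> nat \<Rightarrow> nat) \<Rightarrow> ('k, 'v) cochain set" where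
  "coboundaries wt = differential wt ` carrier (cochain_algebra wt)"

definition cohomology :: "(nat \<times> nat \<Rightarrow> nat) \<Rightarrow> ('k, ('k, 'v) cochain set) module" where
  "cohomology wt =
     quotient_algebra (cochain_algebra wt\<lparr>carrier := cocycles wt\<rparr>) (coboundaries wt)"

text \<open>The classes of the cocycles in \<open>Hom_W p m\<close>.\<close>

definition cohomology_weight ::
    "(nat \<times> nat \<Rightarrow> nat) \<Rightarrow> nat \<Rightarrow> nat \<Rightarrow> ('k, 'v) cochain set set" where
  "cohomology_weight wt p m =
     {coboundaries wt +>\<^bsub>cochain_algebra wt\<^esub> F |F.
        F \<in> cocycles wt \<and> (\<forall>q n. (q, n) \<noteq> (p, m) \<longrightarrow> F (q, n) = zero_map q)}"

definition HK :: "('k, ('k, 'v) cochain set) module" where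
  "HK = cohomology fst"

definition HK_weight :: "nat \<Rightarrow> nat \<Rightarrow> ('k, 'v) cochain set set" where
  "HK_weight = cohomology_weight fst"

definition modified_HK :: "('k, ('k, 'v) cochain set) module" where
  "modified_HK = cohomology snd"

definition modified_HK_weight :: "nat \<Rightarrow> nat \<Rightarrow> ('k, 'v) cochain set set" where
  "modified_HK_weight = cohomology_weight snd"

end


section \<open>The Koszul dual\<close>

definition dual_space :: "('k::field \<Rightarrow> 'v::ab_group_add \<Rightarrow> 'v) \<Rightarrow> ('v \<Rightarrow> 'k) set" where
  "dual_space scale = {f. Vector_Spaces.linear scale (*) f}"

text \<open>The value at \<open>t\<close> of the form defined by \<open>\<omega>\<close>, a tensor over the dual space:
  \<open>f\<^sub>1 \<otimes> \<dots> \<otimes> f\<^sub>n\<close> is sent to the form \<open>x\<^sub>1 \<otimes> \<dots> \<otimes> x\<^sub>n \<mapsto> f\<^sub>1(x\<^sub>1) \<dots> f\<^sub>n(x\<^sub>n)\<close>, without sign.\<close>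

definition tensor_pairing :: "('k::field, 'v \<Rightarrow> 'k) tensor \<Rightarrow> ('k, 'v) tensor \<Rightarrow> 'k" where
  "tensor_pairing \<omega> t =
     \<omega> (\<lambda>fs. t (\<lambda>xs. if length xs = length fs then \<Prod>i<length fs. (fs ! i) (xs ! i) else 0))"

definition orthogonal_relations ::
    "('k::field \<Rightarrow> 'v::ab_group_add \<Rightarrow> 'v) \<Rightarrow> ('k, 'v) tensor set \<Rightarrow> ('k, 'v \<Rightarrow> 'k) tensor set" where
  "orthogonal_relations scale R =
     {\<omega> \<in> tensor_power fscale (dual_space scale) 2. \<forall>r\<in>R. tensor_pairing \<omega> r = 0}"

end

theory Submission
  imports Defs "HOL-Algebra.Subrings"
begin

text \<open>
  Fix a basis of \<open>V\<close> and the dual basis of the dual space, so that tensors over either space become functions on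
  words in the basis and the pairing of tensors becomes the dot product. Then \<open>W\<^sub>p\<close> is the annihilator of the degree
  \<open>p\<close> part of the ideal generated by \<open>R\<^sup>\<bottom>\<close>, and the degree \<open>m\<close> part of the ideal generated by \<open>R\<close> is the annihilator
  of the space \<open>W\<^sub>m\<close> of \<open>A\<^sup>!\<close>. Hence every cochain \<open>W\<^sub>p \<rightarrow> A\<^sub>m\<close> is induced by a matrix \<open>F\<close> indexed by words of lengths
  \<open>m\<close> and \<open>p\<close>, and \<open>F\<close> induces zero iff the bilinear form \<open>(u, c) \<mapsto> \<Sum> u\<^sub>a F\<^sub>a\<^sub>b c\<^sub>b\<close> vanishes for all \<open>c\<close> in \<open>W\<^sub>p\<close> and
  all \<open>u\<close> in the space \<open>W\<^sub>m\<close> of \<open>A\<^sup>!\<close>. This condition is symmetric in \<open>A\<close> and \<open>A\<^sup>!\<close> up to transposition. The concatenation product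
  of cochains is induced by the tensor product of matrices, which commutes with transposition, and transposition
  exchanges the two weights and so the two sign rules. So it induces an isomorphism of the cochain
  algebras. It preserves the differential, because the differential is the commutator, twisted by the sign
  \<open>(-1)\<^bsup>wt\<^esup>\<close>, with the canonical map \<open>V \<rightarrow> A\<close>, whose matrix is the identity.
\<close>

section \<open>Coordinates of tensors\<close>

text \<open>The concatenation product is defined through arbitrary decompositions of elements of
  \<open>W (p + q)\<close>, which makes the algebra laws awkward to check on cochains. They are
  proved where they are identities of finite sums, in a ring of matrices indexed by words of all
  lengths, and pass to its image, the cochain algebra. A cochain does not determine its matrix, so
  one criterion for two matrices to induce the same cochain carries both the well-definedness and
  the injectivity of transposition. The signs enter only through a weight that is additive and
  equals 1 on the canonical map e, of biweight (1, 1); this covers both calculi at once. The product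
  with e on the right carries the sign (-1)^wt of the other factor, and the twist \<tau> by that
  sign removes it, so the differential of x is \<tau>(x) e - e x. As \<tau> is an involutive
  automorphism with \<tau>(e) = -e, and e e = 0, this formula alone makes the cocycles an algebra
  and the coboundaries an ideal in it.\<close>

interpretation fun_space: vector_space "fscale :: 'k::field \<Rightarrow> ('x \<Rightarrow> 'k) \<Rightarrow> 'x \<Rightarrow> 'k"
  by unfold_locales (auto simp: fscale_def fun_eq_iff algebra_simps)

section \<open>Linear algebra of functions with finite support\<close>

lemma sum_fun_apply: "(\<Sum>i\<in>I. f i) x = (\<Sum>i\<in>I. f i x)"
  by (induction I rule: infinite_finite_induct) auto

lemma sum_delta_mult [simp]:
  fixes f :: "'a \<Rightarrow> 'k::comm_semiring_1"
  assumes "finite D"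
  shows "(\<Sum>v\<in>D. f v * (if v = a then 1 else 0)) = (if a \<in> D then f a else 0)"
    and "(\<Sum>v\<in>D. f v * (if a = v then 1 else 0)) = (if a \<in> D then f a else 0)"
    and "(\<Sum>v\<in>D. (if v = a then 1 else 0) * f v) = (if a \<in> D then f a else 0)"
    and "(\<Sum>v\<in>D. (if a = v then 1 else 0) * f v) = (if a \<in> D then f a else 0)"
proof -
  have *: "(\<Sum>v\<in>D. if v = a then f v else 0) = (if a \<in> D then f a else 0)"
    using assms by (simp add: sum.delta)
  show "(\<Sum>v\<in>D. f v * (if v = a then 1 else 0)) = (if a \<in> D then f a else 0)"
    "(\<Sum>v\<in>D. f v * (if a = v then 1 else 0)) = (if a \<in> D then f a else 0)"
    "(\<Sum>v\<in>D. (if v = a then 1 else 0) * f v) = (if a \<in> D then f a else 0)"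
    "(\<Sum>v\<in>D. (if a = v then 1 else 0) * f v) = (if a \<in> D then f a else 0)"
    by (subst *[symmetric], rule sum.cong, simp, force)+
qed

text \<open>A subspace \<open>X\<close> is the image of a linear projection \<open>g\<close>, and
  \<open>P v\<close> is the value of \<open>g\<close> at the indicator function of \<open>v\<close>.
  As \<open>X\<close> is supported on the finite set \<open>D\<close>, its elements are finite
  combinations of indicator functions, and applying \<open>g\<close> gives the formula. The rows
  \<open>P v\<close> replace a basis of \<open>X\<close>, with the values \<open>c v\<close>
  themselves as coefficients.\<close>

lemma projection_matrix:
  fixes X :: "('a \<Rightarrow> 'k::field) set"
  assumes "fun_space.subspace X" "finite D" and D: "\<And>c a. c \<in> X \<Longrightarrow> a \<notin> D \<Longrightarrow> c a = 0"
  obtains P where "\<And>v. P v \<in> X" "\<And>c a. c \<in> X \<Longrightarrow> (\<Sum>v\<in>D. c v * P v a) = c a"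
proof -
  interpret vector_space_pair "fscale :: 'k \<Rightarrow> ('a \<Rightarrow> 'k) \<Rightarrow> 'a \<Rightarrow> 'k" "fscale :: 'k \<Rightarrow> ('a \<Rightarrow> 'k) \<Rightarrow> 'a \<Rightarrow> 'k" ..
  obtain g where g: "range g \<subseteq> X" "Vector_Spaces.linear fscale fscale g" "\<And>c. c \<in> X \<Longrightarrow> g c = c"
    using linear_exists_left_inverse_on[OF fun_space.linear_id assms(1)] by auto
  define P where "P v = g (\<lambda>a. if a = v then 1 else 0)" for v
  have "(\<Sum>v\<in>D. c v * P v a) = c a" if "c \<in> X" for c a
  proof -
    have "c = (\<Sum>v\<in>D. fscale (c v) (\<lambda>a. if a = v then 1 else 0))"
      using assms(2) D[OF that] by (auto simp: fun_eq_iff sum_fun_apply fscale_def)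
    then have "g c = (\<Sum>v\<in>D. fscale (c v) (P v))"
      by (metis (no_types, lifting) P_def linear_scale[OF g(2)] linear_sum[OF g(2)] sum.cong)
    then show ?thesis using g(3)[OF that] by (metis (no_types, lifting) fscale_def sum_fun_apply sum.cong)
  qed
  moreover have "P v \<in> X" for v
    using g(1) by (auto simp: P_def)
  ultimately show ?thesis using that[of P] by blast
qed

text \<open>An element fixed by the projection matrix of \<open>X\<close> is a combination of its
  rows and so lies in \<open>X\<close>. Whether \<open>c\<close> is fixed is tested by functionals
  that are orthogonal to \<open>X\<close>.\<close>

lemma double_annihilator:
  fixes X :: "('a \<Rightarrow> 'k::field) set"
  assumes X: "fun_space.subspace X" and "finite D" and D: "\<And>c a. c \<in> X \<Longrightarrow> a \<notin> D \<Longrightarrow> c a = 0"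
    and c: "\<And>a. a \<notin> D \<Longrightarrow> c a = 0"
    and perp: "\<And>d. (\<And>a. a \<notin> D \<Longrightarrow> d a = 0) \<Longrightarrow> (\<And>x. x \<in> X \<Longrightarrow> (\<Sum>v\<in>D. d v * x v) = 0)
      \<Longrightarrow> (\<Sum>v\<in>D. d v * c v) = 0"
  shows "c \<in> X"
proof -
  obtain P where P: "\<And>v. P v \<in> X" "\<And>c a. c \<in> X \<Longrightarrow> (\<Sum>v\<in>D. c v * P v a) = c a"
    using projection_matrix[of X D] assms(1-3) by blast
  have "c a = (\<Sum>v\<in>D. c v * P v a)" for a
  proof (cases "a \<in> D")
    case True
    \<comment> \<open>Column \<open>a\<close> of the identity minus \<open>P\<close>: its dot
      product with a function is the defect at \<open>a\<close> between that function and its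
      projection, which is zero on \<open>X\<close>.\<close>
    define d where "d v = (if v \<in> D then (if v = a then 1 else 0) - P v a else 0)" for v
    have *: "(\<Sum>v\<in>D. d v * x v) = x a - (\<Sum>v\<in>D. x v * P v a)" for x
    proof -
      have "(\<Sum>v\<in>D. d v * x v) = (\<Sum>v\<in>D. (if v = a then 1 else 0) * x v - x v * P v a)"
        by (rule sum.cong) (auto simp: d_def algebra_simps)
      then show ?thesis using True assms(2) by (simp add: sum_subtractf)
    qed
    have "(\<Sum>v\<in>D. d v * c v) = 0"
    proof (rule perp)
      show "d a = 0" if "a \<notin> D" for a using that by (simp add: d_def)
      show "(\<Sum>v\<in>D. d v * x v) = 0" if "x \<in> X" for x unfolding * P(2)[OF that] by simp
    qed
    then show ?thesis unfolding * by simp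
  next
    case False
    then show ?thesis using c D[OF P(1)] by simp
  qed
  then have "c = (\<Sum>v\<in>D. fscale (c v) (P v))"
    unfolding fun_eq_iff sum_fun_apply fscale_def by blast
  then show ?thesis
    using P(1) X by (metis (no_types, lifting) fun_space.subspace_scale fun_space.subspace_sum)
qed

section \<open>Words in the basis, and products of linear forms evaluated at lists\<close>

definition words :: "'i set \<Rightarrow> nat \<Rightarrow> 'i list set" where
  "words J n = {w. set w \<subseteq> J \<and> length w = n}"

lemma finite_words [simp]: "finite J \<Longrightarrow> finite (words J n)"
  unfolding words_def by (rule finite_lists_length_eq)

lemma words_0 [simp]: "words J 0 = {[]}"
  by (auto simp: words_def)

lemma sum_words_Suc: "(\<Sum>w\<in>words J (Suc n). f w) = (\<Sum>j\<in>J. \<Sum>w\<in>words J n. f (j # w))"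
proof -
  have "(\<Sum>w\<in>words J (Suc n). f w) = (\<Sum>(j, w)\<in>J \<times> words J n. f (j # w))"
    by (rule sum.reindex_bij_witness[of _ "\<lambda>(j, w). j # w" "\<lambda>w. (hd w, tl w)"])
       (auto simp: words_def length_Suc_conv)
  then show ?thesis by (simp add: sum.cartesian_product)
qed

lemma sum_words_add:
  "(\<Sum>w\<in>words J (m + n). f w) = (\<Sum>a\<in>words J m. \<Sum>b\<in>words J n. f (a @ b))"
  by (induction m arbitrary: f) (simp_all add: sum_words_Suc)

lemma append_in_words:
  "length a = m \<Longrightarrow> a @ b \<in> words J (m + n) \<longleftrightarrow> a \<in> words J m \<and> b \<in> words J n"
  "length b = n \<Longrightarrow> a @ b \<in> words J (m + n) \<longleftrightarrow> a \<in> words J m \<and> b \<in> words J n"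
  by (auto simp: words_def)

text \<open>Extended by zero to lists of the wrong length, so that it is one function on lists of
  all lengths, as \<open>multilinear_on\<close> expects. It serves both for coordinate forms and for
  the pairing of the two tensor algebras.\<close>

definition eval_prod :: "('v \<Rightarrow> 'k::field) list \<Rightarrow> 'v list \<Rightarrow> 'k" where
  "eval_prod fs xs = (if length xs = length fs then prod_list (map2 (\<lambda>f. f) fs xs) else 0)"

text \<open>No condition on lengths: if they do not add up, one of the two factors on the right has
  mismatched lengths and is zero.\<close>

lemma eval_prod_append_right:
  "eval_prod fs (xs @ ys) = eval_prod (take (length xs) fs) xs * eval_prod (drop (length xs) fs) ys"
proof (cases "length fs = length xs + length ys")
  case True
  then have "map2 (\<lambda>f. f) fs (xs @ ys) =
      map2 (\<lambda>f. f) (take (length xs) fs) xs @ map2 (\<lambda>f. f) (drop (length xs) fs) ys"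
    by (simp add: zip_append2)
  with True show ?thesis by (simp add: eval_prod_def)
qed (auto simp: eval_prod_def)

lemma eval_prod_append_left:
  "eval_prod (fs @ gs) xs = eval_prod fs (take (length fs) xs) * eval_prod gs (drop (length fs) xs)"
proof (cases "length xs = length fs + length gs")
  case True
  then have "map2 (\<lambda>f. f) (fs @ gs) xs =
      map2 (\<lambda>f. f) fs (take (length fs) xs) @ map2 (\<lambda>f. f) gs (drop (length fs) xs)"
    by (simp add: zip_append1)
  with True show ?thesis by (simp add: eval_prod_def)
qed (auto simp: eval_prod_def)

lemma multilinear_eval_prod:
  assumes add: "\<And>f u v. f \<in> set fs \<Longrightarrow> u \<in> V \<Longrightarrow> v \<in> V \<Longrightarrow> f (u + v) = f u + f v"
    and scale: "\<And>f c u. f \<in> set fs \<Longrightarrow> u \<in> V \<Longrightarrow> f (scale c u) = c * f u"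
  shows "multilinear_on scale V (*) (eval_prod fs)"
proof -
  \<comment> \<open>One letter is split off. The list of forms that meets it has at most one
    element, so linearity need only be checked on one-letter lists.\<close>
  have split: "eval_prod fs (xs @ u # ys) = eval_prod (take (length xs) fs) xs *
      (eval_prod (take 1 (drop (length xs) fs)) [u] * eval_prod (drop 1 (drop (length xs) fs)) ys)" for xs u ys
    using eval_prod_append_right[of fs xs "u # ys"] eval_prod_append_right[of "drop (length xs) fs" "[u]" ys] by simp
  have "eval_prod gs [u + v] = eval_prod gs [u] + eval_prod gs [v]" "eval_prod gs [scale c u] = c * eval_prod gs [u]"
    if "u \<in> V" "v \<in> V" "set gs \<subseteq> set fs" for gs u v c
    using that by (cases gs; auto simp: eval_prod_def add scale)+
  moreover have "set (take 1 (drop n fs)) \<subseteq> set fs" for n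
    by (meson in_set_dropD in_set_takeD subsetI)
  ultimately show ?thesis
    by (auto simp: multilinear_on_def split algebra_simps)
qed

text \<open>The index type is separate from the type of vectors, so that a space and its dual can
  share the index set \<open>J\<close>; a matrix indexed by words then makes sense for both.
  Coordinates with index outside \<open>J\<close> are zero, so words outside \<open>J\<close> never
  contribute.\<close>

locale based_space =
  fixes scale :: "'k::field \<Rightarrow> 'v::ab_group_add \<Rightarrow> 'v"
    and V :: "'v set"
    and J :: "'i set"
    and e :: "'i \<Rightarrow> 'v"
    and x :: "'i \<Rightarrow> 'v \<Rightarrow> 'k"
  assumes vector_space: "vector_space scale"
    and subspace: "Modules.module.subspace scale V"
    and finite_J [simp]: "finite J"
    and e_in: "j \<in> J \<Longrightarrow> e j \<in> V"
    and x_add: "u \<in> V \<Longrightarrow> v \<in> V \<Longrightarrow> x j (u + v) = x j u + x j v"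
    and x_scale: "u \<in> V \<Longrightarrow> x j (scale c u) = c * x j u"
    and x_outside: "j \<notin> J \<Longrightarrow> x j u = 0"
    and x_e: "i \<in> J \<Longrightarrow> j \<in> J \<Longrightarrow> x i (e j) = (if i = j then 1 else 0)"
    and expand: "v \<in> V \<Longrightarrow> v = (\<Sum>j\<in>J. scale (x j v) (e j))"
begin

sublocale vector_space scale by (rule vector_space)

definition form :: "'i list \<Rightarrow> 'v list \<Rightarrow> 'k" where
  "form w xs = (if length xs = length w then prod_list (map2 x w xs) else 0)"

lemma form_eval_prod: "form w = eval_prod (map x w)"
proof
  have "map2 x w xs = map2 (\<lambda>f. f) (map x w) xs" for xs
    by (simp add: zip_map1 case_prod_unfold comp_def)
  then show "form w xs = eval_prod (map x w) xs" for xs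
    by (simp add: form_def eval_prod_def)
qed

lemma form_append: "form w (xs @ ys) = form (take (length xs) w) xs * form (drop (length xs) w) ys"
  by (simp add: form_eval_prod eval_prod_append_right take_map drop_map)

lemma multilinear_form: "multilinear_on scale V (*) (form w)"
  unfolding form_eval_prod by (rule multilinear_eval_prod) (auto simp: x_add x_scale)

lemma form_map_e: "set w \<subseteq> J \<Longrightarrow> set z \<subseteq> J \<Longrightarrow> form w (map e z) = (if w = z then 1 else 0)"
proof (induction z arbitrary: w)
  case (Cons j z)
  show ?case
  proof (cases w)
    case (Cons i w')
    then show ?thesis
      using Cons.IH[of w'] Cons.prems by (auto simp: form_def x_e)
  qed (auto simp: form_def)
qed (auto simp: form_def)

lemma form_outside: "\<not> set w \<subseteq> J \<Longrightarrow> form w xs = 0"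
proof (induction w arbitrary: xs)
  case IH: (Cons i w)
  show ?case
  proof (cases xs)
    case (Cons y ys)
    then show ?thesis
      using IH.IH[of ys] IH.prems by (cases "i \<in> J") (auto simp: form_def x_outside split: if_splits)
  qed (simp add: form_def)
qed auto

lemma multilinear_append_left:
  assumes "multilinear_on scale V (*) (\<phi> :: 'v list \<Rightarrow> 'k)" "set zs \<subseteq> V"
  shows "multilinear_on scale V (*) (\<lambda>ys. \<phi> (zs @ ys))"
  using assms(1)[unfolded multilinear_on_def, rule_format, of "zs @ _"] assms(2)
  unfolding multilinear_on_def by simp

lemma multilinear_expand:
  assumes "multilinear_on scale V (*) (\<phi> :: 'v list \<Rightarrow> 'k)" "set xs \<subseteq> V"
  shows "\<phi> xs = (\<Sum>w\<in>words J (length xs). form w xs * \<phi> (map e w))"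
  using assms
proof (induction xs arbitrary: \<phi>)
  case Nil
  then show ?case by (simp add: form_def)
next
  case (Cons y ys)
  \<comment> \<open>\<open>multilinear_on\<close> speaks of sums of two vectors only, hence the
    induction over subsets of the basis; the empty sum uses that 0 is 0 times 0.\<close>
  have lin: "\<phi> ((\<Sum>j\<in>I. scale (c j) (e j)) # ys) = (\<Sum>j\<in>I. c j * \<phi> (e j # ys))"
    if "finite I" "I \<subseteq> J" for I c
    using that
  proof (induction I rule: finite_induct)
    case empty
    have "\<phi> ([] @ scale 0 0 # ys) = 0 * \<phi> ([] @ 0 # ys)"
      using Cons.prems unfolding multilinear_on_def
      by (smt (verit, best) empty_set empty_subsetI set_subset_Cons subset_trans subspace_0 subspace)
    then show ?case by simp
  next
    case (insert j I)
    have "(\<Sum>j\<in>I. scale (c j) (e j)) \<in> V"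
      using insert.prems by (intro subspace_sum[OF subspace] subspace_scale[OF subspace] e_in) auto
    moreover have "e j \<in> V" "scale (c j) (e j) \<in> V"
      using insert.prems by (auto intro: subspace_scale[OF subspace] e_in)
    moreover have "set ys \<subseteq> V" using Cons.prems by simp
    ultimately show ?case
      using insert Cons.prems(1)[unfolded multilinear_on_def, rule_format, of "[]" ys] by simp
  qed
  have "\<phi> (e j # ys) = (\<Sum>w\<in>words J (length ys). form w ys * \<phi> (e j # map e w))" if "j \<in> J" for j
    using Cons.IH[of "\<lambda>ys. \<phi> (e j # ys)"] multilinear_append_left[OF Cons.prems(1), of "[e j]"]
      Cons.prems that by (simp add: e_in)
  then have "\<phi> (y # ys) = (\<Sum>j\<in>J. x j y * (\<Sum>w\<in>words J (length ys). form w ys * \<phi> (e j # map e w)))"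
    using lin[of J "\<lambda>j. x j y"] expand[of y] Cons.prems(2) by simp
  also have "\<dots> = (\<Sum>w\<in>words J (length (y # ys)). form w (y # ys) * \<phi> (map e w))"
    by (simp add: sum_words_Suc sum_distrib_left form_def mult.assoc if_distrib if_distribR cong: if_cong sum.cong)
  finally show ?case .
qed

section \<open>Coordinates of tensors and reconstruction from coordinates\<close>

abbreviation pure where "pure \<equiv> pure_tensor scale V"
abbreviation Ts where "Ts \<equiv> tensors scale V"
abbreviation Tp where "Tp \<equiv> tensor_power scale V"
abbreviation tm (infixl "\<bullet>" 70) where "s \<bullet> t \<equiv> tensor_mult scale V s t"

definition coord :: "('k, 'v) tensor \<Rightarrow> 'i list \<Rightarrow> 'k" where
  "coord t w = t (form w)"

definition tens :: "nat \<Rightarrow> ('i list \<Rightarrow> 'k) \<Rightarrow> ('k, 'v) tensor" where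
  "tens n c = (\<Sum>w\<in>words J n. fscale (c w) (pure (map e w)))"

definition supp :: "nat \<Rightarrow> ('i list \<Rightarrow> 'k) set" where
  "supp n = {c. \<forall>w. w \<notin> words J n \<longrightarrow> c w = 0}"

lemma coord_add [simp]: "coord (s + t) w = coord s w + coord t w"
  and coord_diff [simp]: "coord (s - t) w = coord s w - coord t w"
  and coord_scale [simp]: "coord (fscale c t) w = c * coord t w"
  and coord_0 [simp]: "coord 0 w = 0"
  and coord_sum: "coord (\<Sum>i\<in>I. f i) w = (\<Sum>i\<in>I. coord (f i) w)"
  by (auto simp: coord_def fscale_def sum_fun_apply)

lemma coord_pure: "coord (pure xs) w = form w xs"
  by (simp add: coord_def pure_tensor_def multilinear_form)

lemma pure_in: "set xs \<subseteq> V \<Longrightarrow> pure xs \<in> Tp (length xs)"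
  unfolding tensor_power_def by (intro fun_space.span_base) auto

lemma subspace_Tp: "fun_space.subspace (Tp n)" and subspace_Ts: "fun_space.subspace Ts"
  unfolding tensor_power_def tensors_def by (rule fun_space.subspace_span)+

lemma Tp_Ts: "t \<in> Tp n \<Longrightarrow> t \<in> Ts"
  unfolding tensor_power_def tensors_def using fun_space.span_mono[of "{pure xs |xs. set xs \<subseteq> V \<and> length xs = n}"
    "{pure xs |xs. set xs \<subseteq> V}"] by auto

lemma set_map_e: "w \<in> words J n \<Longrightarrow> set (map e w) \<subseteq> V"
  by (auto simp: words_def e_in)

lemma tens_in: "tens n c \<in> Tp n"
  unfolding tens_def
  by (intro fun_space.subspace_sum[OF subspace_Tp] fun_space.subspace_scale[OF subspace_Tp])
     (metis (mono_tags, lifting) set_map_e pure_in length_map mem_Collect_eq words_def)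

lemma tens_cong: "(\<And>w. w \<in> words J n \<Longrightarrow> c w = d w) \<Longrightarrow> tens n c = tens n d"
  by (simp add: tens_def)

lemma coord_tens: "coord (tens n c) w = (if w \<in> words J n then c w else 0)"
proof (cases "set w \<subseteq> J")
  case True
  then have "coord (tens n c) w = (\<Sum>z\<in>words J n. c z * (if w = z then 1 else 0))"
    unfolding tens_def coord_sum
    by (intro sum.cong) (auto simp: coord_pure words_def form_map_e)
  then show ?thesis by simp
next
  case False
  then show ?thesis by (auto simp: tens_def coord_sum coord_pure form_outside words_def)
qed

text \<open>At a multilinear \<phi> this is the expansion of \<phi> in the basis; at any other
  function every pure tensor is zero.\<close>

lemma tens_coord_pure: "set xs \<subseteq> V \<Longrightarrow> tens (length xs) (coord (pure xs)) = pure xs"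
proof
  fix \<phi> assume xs: "set xs \<subseteq> V"
  have "tens (length xs) (coord (pure xs)) \<phi> = (\<Sum>w\<in>words J (length xs). form w xs * pure (map e w) \<phi>)"
    by (simp add: tens_def sum_fun_apply fscale_def coord_pure)
  also have "\<dots> = pure xs \<phi>"
    using multilinear_expand[OF _ xs, of \<phi>] by (auto simp: pure_tensor_def)
  finally show "tens (length xs) (coord (pure xs)) \<phi> = pure xs \<phi>" .
qed

lemma tens_add: "tens n (\<lambda>w. c w + d w) = tens n c + tens n d"
  and tens_diff: "tens n (\<lambda>w. c w - d w) = tens n c - tens n d"
  and tens_scale: "tens n (\<lambda>w. a * c w) = fscale a (tens n c)"
  and tens_0: "tens n (\<lambda>w. 0) = 0"
  by (auto simp: tens_def fscale_def fun_eq_iff sum_fun_apply sum.distrib sum_subtractf sum_distrib_left algebra_simps)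

lemma tens_coord: "t \<in> Tp n \<Longrightarrow> tens n (coord t) = t"
  unfolding tensor_power_def
proof (induction rule: fun_space.span_induct_alt)
  case base
  have "coord 0 = (\<lambda>w. 0)" by (rule ext) (rule coord_0)
  then show ?case using tens_0[of n] by metis
next
  case (step c t s)
  then obtain xs where t: "t = pure xs" "set xs \<subseteq> V" "length xs = n" by auto
  have "tens n (coord (fscale c t + s)) = fscale c (tens n (coord t)) + tens n (coord s)"
    by (simp add: coord_add[abs_def] coord_scale tens_add tens_scale)
  then show ?case using step.IH tens_coord_pure[of xs] t by metis
qed

lemma coord_supp: "t \<in> Tp n \<Longrightarrow> coord t \<in> supp n"
  using coord_tens[of n "coord t"] tens_coord[of t n] unfolding supp_def mem_Collect_eq by metis

lemma coord_tens_supp: "c \<in> supp n \<Longrightarrow> coord (tens n c) = c"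
  by (auto simp: fun_eq_iff coord_tens supp_def)

lemma Tp_eqI: "s \<in> Tp n \<Longrightarrow> t \<in> Tp n \<Longrightarrow> (\<And>w. w \<in> words J n \<Longrightarrow> coord s w = coord t w) \<Longrightarrow> s = t"
  using tens_cong[of n "coord s" "coord t"] tens_coord by metis

end

section \<open>Quadratic algebras in coordinates\<close>

text \<open>As simplification rules these also apply to functions without arguments: they would turn
  \<open>coord (s + t)\<close> into \<open>coord (\<lambda>\<phi>. s \<phi> + t \<phi>)\<close>.\<close>

declare plus_fun_apply [simp del] zero_fun_apply [simp del] minus_apply [simp del] uminus_apply [simp del]

text \<open>Transfers the ring axioms between records that agree on the ring operations, such as a
  factor ring and the quotient algebra that also stores a scalar multiplication.\<close>

lemma ring_cong:
  assumes "ring M" "carrier N = carrier M" "mult N = mult M" "one N = one M" "zero N = zero M" "add N = add M"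
  shows "ring N"
proof -
  interpret M: ring M by fact
  show ?thesis
  proof (intro ringI abelian_groupI monoidI)
    show "\<exists>y\<in>carrier N. y \<oplus>\<^bsub>N\<^esub> x = \<zero>\<^bsub>N\<^esub>" if "x \<in> carrier N" for x
      using that assms(2-) M.l_neg M.a_inv_closed by metis
  qed (simp_all add: assms(2-) M.m_assoc M.l_distr M.r_distr M.a_assoc, simp add: M.a_comm)
qed

section \<open>Pairings, annihilators and the spaces \<open>W\<close>, for functions on
  words\<close>

definition pairing :: "'i set \<Rightarrow> nat \<Rightarrow> ('i list \<Rightarrow> 'k::field) \<Rightarrow> ('i list \<Rightarrow> 'k) \<Rightarrow> 'k" where
  "pairing J n c d = (\<Sum>w\<in>words J n. c w * d w)"

definition annihilator :: "'i set \<Rightarrow> ('i list \<Rightarrow> 'k::field) set \<Rightarrow> ('i list \<Rightarrow> 'k) set" where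
  "annihilator J S = {d. (\<forall>w. w \<notin> words J 2 \<longrightarrow> d w = 0) \<and> (\<forall>r\<in>S. pairing J 2 d r = 0)}"

text \<open>Coordinates of \<open>W p\<close>: fixing all but two consecutive letters leaves a relation.\<close>

definition Wc :: "'i set \<Rightarrow> ('i list \<Rightarrow> 'k::field) set \<Rightarrow> nat \<Rightarrow> ('i list \<Rightarrow> 'k) set" where
  "Wc J S p = {c. (\<forall>w. w \<notin> words J p \<longrightarrow> c w = 0) \<and>
     (\<forall>a b. length a + 2 + length b = p \<longrightarrow> (\<lambda>z. c (a @ z @ b)) \<in> S)}"

lemma pairing_commute: "pairing J n c d = pairing J n d c"
  by (simp add: pairing_def mult.commute)

lemma pairing_linear:
  "pairing J n c (\<lambda>w. d w + d' w) = pairing J n c d + pairing J n c d'"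
  "pairing J n c (\<lambda>w. a * d w) = a * pairing J n c d"
  "pairing J n c (\<lambda>w. d w - d' w) = pairing J n c d - pairing J n c d'"
  by (simp_all add: pairing_def sum.distrib sum_subtractf sum_distrib_left algebra_simps)

lemma annihilator_annihilator:
  assumes "finite J" "fun_space.subspace S" "\<And>c w. c \<in> S \<Longrightarrow> w \<notin> words J 2 \<Longrightarrow> c w = 0"
  shows "annihilator J (annihilator J S) = S"
proof
  show "S \<subseteq> annihilator J (annihilator J S)"
    using assms(3) by (auto simp: annihilator_def pairing_commute)
  show "annihilator J (annihilator J S) \<subseteq> S"
  proof
    fix c assume c: "c \<in> annihilator J (annihilator J S)"
    show "c \<in> S"
    proof (rule double_annihilator[of S "words J 2"])
      fix d :: "'a list \<Rightarrow> 'b"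
      assume "\<And>a. a \<notin> words J 2 \<Longrightarrow> d a = 0" "\<And>x. x \<in> S \<Longrightarrow> (\<Sum>v\<in>words J 2. d v * x v) = 0"
      then have "d \<in> annihilator J S" by (auto simp: annihilator_def pairing_def)
      then have "pairing J 2 c d = 0" using c by (simp add: annihilator_def)
      then show "(\<Sum>v\<in>words J 2. d v * c v) = 0" by (simp add: pairing_def mult.commute)
    qed (use assms c in \<open>auto simp: annihilator_def\<close>)
  qed
qed

lemma subspace_Wc: "fun_space.subspace S \<Longrightarrow> fun_space.subspace (Wc J S p)"
  unfolding fun_space.subspace_def Wc_def by (auto simp: fscale_def plus_fun_def zero_fun_def)

lemma Wc_outside: "c \<in> Wc J S p \<Longrightarrow> w \<notin> words J p \<Longrightarrow> c w = 0"
  by (simp add: Wc_def)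

text \<open>The inclusions of W_(p+q) in W_p tensored with V^q and in V^p tensored with W_q: a
  window of two consecutive letters inside the free part of a word is also a window of the whole
  word.\<close>

lemma Wc_split:
  assumes "c \<in> Wc J S (p + q)"
  shows "length b = q \<Longrightarrow> (\<lambda>a. c (a @ b)) \<in> Wc J S p"
    and "length a = p \<Longrightarrow> (\<lambda>b. c (a @ b)) \<in> Wc J S q"
  using assms
    assms[unfolded Wc_def, simplified, THEN conjunct2, rule_format, of _ "_ @ b"]
    assms[unfolded Wc_def, simplified, THEN conjunct2, rule_format, of "a @ _" _]
  by (auto simp: Wc_def append_in_words)

section \<open>The tensor algebra as a ring, and coordinates of products\<close>

context based_space begin

lemma multilinear_lincomb:
  "multilinear_on scale V (*) (\<phi> :: 'v list \<Rightarrow> 'k) \<Longrightarrow> multilinear_on scale V (*) \<psi> \<Longrightarrow>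
    multilinear_on scale V (*) (\<lambda>xs. \<phi> xs + c * \<psi> xs)"
  unfolding multilinear_on_def by (auto simp: algebra_simps)

lemma tensors_induct [consumes 1, case_names zero step]:
  assumes "t \<in> Ts" "P 0"
    and "\<And>c xs t. set xs \<subseteq> V \<Longrightarrow> t \<in> Ts \<Longrightarrow> P t \<Longrightarrow> P (fscale c (pure xs) + t)"
  shows "P t"
proof -
  have "t \<in> Ts \<and> P t"
    using assms(1) unfolding tensors_def
  proof (induction rule: fun_space.span_induct_alt)
    case base
    then show ?case using assms(2) by (simp add: fun_space.span_zero)
  next
    case (step c s t)
    then obtain xs where "s = pure xs" "set xs \<subseteq> V" by auto
    moreover from this have "s \<in> Ts" using Tp_Ts pure_in by blast
    ultimately show ?case
      using step assms(3)[of xs t c] fun_space.subspace_add[OF subspace_Ts] fun_space.subspace_scale[OF subspace_Ts]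
      by (simp flip: tensors_def)
  qed
  then show ?thesis ..
qed

lemma pure_Ts: "set xs \<subseteq> V \<Longrightarrow> pure xs \<in> Ts"
  using Tp_Ts pure_in by blast

lemma Ts_closed: "0 \<in> Ts" "s \<in> Ts \<Longrightarrow> t \<in> Ts \<Longrightarrow> s + t \<in> Ts" "t \<in> Ts \<Longrightarrow> fscale c t \<in> Ts"
    "s \<in> Ts \<Longrightarrow> t \<in> Ts \<Longrightarrow> s - t \<in> Ts"
  using subspace_Ts fun_space.subspace_0 fun_space.subspace_add fun_space.subspace_scale fun_space.subspace_diff
  by blast+

text \<open>A tensor is a functional on arbitrary functions, but it is linear only on multilinear
  ones, because pure tensors send all other functions to zero.\<close>

lemma tensor_linear:
  assumes "t \<in> Ts" "multilinear_on scale V (*) \<phi>" "multilinear_on scale V (*) \<psi>"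
  shows "t (\<lambda>xs. \<phi> xs + c * \<psi> xs) = t \<phi> + c * t \<psi>"
  using assms(1)
  by (induction rule: tensors_induct)
     (use assms(2,3) multilinear_lincomb[OF assms(2,3)] in
       \<open>simp_all add: fscale_def pure_tensor_def algebra_simps plus_fun_apply zero_fun_apply\<close>)

lemma multilinear_zero: "multilinear_on scale V (*) (\<lambda>xs. 0 :: 'k)"
  by (simp add: multilinear_on_def)

lemma tensor_linear':
  assumes "t \<in> Ts" "multilinear_on scale V (*) \<phi>"
  shows "multilinear_on scale V (*) \<psi> \<Longrightarrow> t (\<lambda>xs. \<phi> xs + \<psi> xs) = t \<phi> + t \<psi>"
    and "t (\<lambda>xs. c * \<phi> xs) = c * t \<phi>"
proof -
  have "t (\<lambda>xs. 0) = 0"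
    using tensor_linear[OF assms(1) multilinear_zero multilinear_zero, of "- 1"] by simp
  then show "multilinear_on scale V (*) \<psi> \<Longrightarrow> t (\<lambda>xs. \<phi> xs + \<psi> xs) = t \<phi> + t \<psi>"
    and "t (\<lambda>xs. c * \<phi> xs) = c * t \<phi>"
    using tensor_linear[OF assms, of \<psi> 1] tensor_linear[OF assms(1) multilinear_zero assms(2), of c]
    by simp_all
qed

text \<open>The inner part of a product \<open>s \<bullet> t\<close>: it ensures that
  \<open>s\<close> is evaluated at a multilinear form.\<close>

lemma multilinear_contract:
  assumes "t \<in> Ts" "multilinear_on scale V (*) \<phi>"
  shows "multilinear_on scale V (*) (\<lambda>xs. t (\<lambda>ys. \<phi> (xs @ ys)))"
  unfolding multilinear_on_def
proof (intro allI impI conjI ballI; elim conjE)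
  fix xs ys u c assume V: "set xs \<subseteq> V" "set ys \<subseteq> V" "u \<in> V"
  note ml = multilinear_append_left[OF assms(2)]
  have cu: "scale c u \<in> V" using V subspace_scale[OF subspace] by blast
  have "\<phi> (xs @ scale c u # ys @ zs) = c * \<phi> (xs @ u # ys @ zs)" if "set zs \<subseteq> V" for zs
    using assms(2) V that unfolding multilinear_on_def by simp
  \<comment> \<open>The two forms agree at lists over \<open>V\<close> and may differ at others, so
    they are not equal as functions. A tensor cannot tell them apart, since it is a combination of
    pure tensors over \<open>V\<close>.\<close>
  have "t (\<lambda>zs. \<phi> (xs @ scale c u # ys @ zs)) = t (\<lambda>zs. c * \<phi> (xs @ u # ys @ zs))"
    using assms(1)
  proof (induction rule: tensors_induct)
    case (step a zs t)
    have "multilinear_on scale V (*) (\<lambda>zs. \<phi> (xs @ scale c u # ys @ zs))"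
      "multilinear_on scale V (*) (\<lambda>zs. c * \<phi> (xs @ u # ys @ zs))"
      using ml[of "xs @ scale c u # ys"] ml[of "xs @ u # ys"] multilinear_lincomb[OF multilinear_zero, of _ c] V cu
      by simp_all
    moreover have "\<phi> (xs @ scale c u # ys @ zs) = c * \<phi> (xs @ u # ys @ zs)"
      using assms(2) V step.hyps unfolding multilinear_on_def by simp
    ultimately show ?case using step.IH by (simp add: fscale_def pure_tensor_def plus_fun_apply)
  qed (simp add: zero_fun_apply)
  then show "t (\<lambda>zs. \<phi> ((xs @ scale c u # ys) @ zs)) = c * t (\<lambda>zs. \<phi> ((xs @ u # ys) @ zs))"
    using tensor_linear'(2)[OF assms(1) ml[of "xs @ u # ys"], of c] V by simp
next
  fix xs ys u v assume V: "set xs \<subseteq> V" "set ys \<subseteq> V" "u \<in> V" "v \<in> V"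
  note ml = multilinear_append_left[OF assms(2)]
  have uv: "u + v \<in> V" using V subspace_add[OF subspace] by blast
  have "t (\<lambda>zs. \<phi> (xs @ (u + v) # ys @ zs)) = t (\<lambda>zs. \<phi> (xs @ u # ys @ zs) + \<phi> (xs @ v # ys @ zs))"
    using assms(1)
  proof (induction rule: tensors_induct)
    case (step a zs t)
    have "multilinear_on scale V (*) (\<lambda>zs. \<phi> (xs @ (u + v) # ys @ zs))"
      "multilinear_on scale V (*) (\<lambda>zs. \<phi> (xs @ u # ys @ zs) + \<phi> (xs @ v # ys @ zs))"
      using ml[of "xs @ (u + v) # ys"] ml[of "xs @ u # ys"] ml[of "xs @ v # ys"] multilinear_lincomb[of _ _ 1] V uv
      by simp_all
    moreover have "\<phi> (xs @ (u + v) # ys @ zs) = \<phi> (xs @ u # ys @ zs) + \<phi> (xs @ v # ys @ zs)"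
      using assms(2) V step.hyps unfolding multilinear_on_def by simp
    ultimately show ?case using step.IH by (simp add: fscale_def pure_tensor_def plus_fun_apply)
  qed (simp add: zero_fun_apply)
  then show "t (\<lambda>zs. \<phi> ((xs @ (u + v) # ys) @ zs)) = t (\<lambda>zs. \<phi> ((xs @ u # ys) @ zs)) + t (\<lambda>zs. \<phi> ((xs @ v # ys) @ zs))"
    using tensor_linear'(1)[OF assms(1) ml[of "xs @ u # ys"] ml[of "xs @ v # ys"]] V by simp
qed

lemma tm_left:
  "(s + s') \<bullet> t = s \<bullet> t + s' \<bullet> t" "fscale c s \<bullet> t = fscale c (s \<bullet> t)" "0 \<bullet> t = 0"
  by (auto simp: tensor_mult_def fscale_def fun_eq_iff plus_fun_apply zero_fun_apply)

text \<open>On the left, linearity is immediate since the left factor is applied outermost. On the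
  right it is the linearity of \<open>s\<close> at the forms contracted with \<open>t\<close> and
  \<open>t'\<close>.\<close>

lemma tm_right:
  assumes "s \<in> Ts" "t \<in> Ts"
  shows "t' \<in> Ts \<Longrightarrow> s \<bullet> (t + t') = s \<bullet> t + s \<bullet> t'" "s \<bullet> fscale c t = fscale c (s \<bullet> t)"
  using tensor_linear'(2)[OF assms(1) multilinear_contract[OF assms(2)]]
    tensor_linear'(1)[OF assms(1) multilinear_contract[OF assms(2)] multilinear_contract[of t']]
  by (auto simp: tensor_mult_def fscale_def fun_eq_iff plus_fun_apply)

lemma tm_zero_right: "s \<in> Ts \<Longrightarrow> s \<bullet> 0 = 0"
  using tm_right(2)[of s 0 0] Ts_closed(1) by (simp add: fscale_def zero_fun_def)

lemma tm_pure: "set xs \<subseteq> V \<Longrightarrow> set ys \<subseteq> V \<Longrightarrow> pure xs \<bullet> pure ys = pure (xs @ ys)"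
  by (rule tensor_mult_pure[OF vector_space subspace])

lemma tm_pure_closed: "set xs \<subseteq> V \<Longrightarrow> t \<in> Ts \<Longrightarrow> pure xs \<bullet> t \<in> Ts"
  by (rotate_tac, induction rule: tensors_induct)
     (auto simp: tm_zero_right tm_right pure_Ts Ts_closed tm_pure)

lemma tm_closed: "s \<in> Ts \<Longrightarrow> t \<in> Ts \<Longrightarrow> s \<bullet> t \<in> Ts"
  by (induction rule: tensors_induct) (auto simp: tm_left Ts_closed tm_pure_closed)

lemma tm_assoc: "s \<in> Ts \<Longrightarrow> t \<in> Ts \<Longrightarrow> u \<in> Ts \<Longrightarrow> (s \<bullet> t) \<bullet> u = s \<bullet> (t \<bullet> u)"
proof (induction rule: tensors_induct)
  case (step c xs s)
  note xs = step.hyps(1)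
  have "pure xs \<bullet> t \<bullet> u = pure xs \<bullet> (t \<bullet> u)"
    using step.prems(1)
  proof (induction rule: tensors_induct)
    case (step c ys t)
    note ys = step.hyps(1)
    have "pure xs \<bullet> pure ys \<bullet> u = pure xs \<bullet> (pure ys \<bullet> u)"
      using \<open>u \<in> Ts\<close>
      by (induction rule: tensors_induct)
         (use xs ys in \<open>simp_all add: tm_zero_right tm_right pure_Ts Ts_closed tm_pure tm_closed\<close>)
    then show ?case
      using step xs \<open>u \<in> Ts\<close> by (simp add: tm_left tm_right pure_Ts Ts_closed tm_closed)
  qed (use xs \<open>u \<in> Ts\<close> in \<open>simp add: tm_left tm_zero_right pure_Ts\<close>)
  then show ?case
    using step by (simp add: tm_left tm_right pure_Ts Ts_closed tm_closed)
qed (simp add: tm_left)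

lemma tm_one: "t \<in> Ts \<Longrightarrow> pure [] \<bullet> t = t" "t \<in> Ts \<Longrightarrow> t \<bullet> pure [] = t"
  by (induction rule: tensors_induct)
     (simp_all add: tm_left tm_zero_right tm_right pure_Ts Ts_closed tm_pure)

lemma power_induct [consumes 1, case_names zero step]:
  assumes "t \<in> Tp n" "P 0"
    and "\<And>c xs t. set xs \<subseteq> V \<Longrightarrow> length xs = n \<Longrightarrow> t \<in> Tp n \<Longrightarrow> P t \<Longrightarrow> P (fscale c (pure xs) + t)"
  shows "P t"
proof -
  have "t \<in> Tp n \<and> P t"
    using assms(1) unfolding tensor_power_def
  proof (induction rule: fun_space.span_induct_alt)
    case base
    then show ?case using assms(2) by (simp add: fun_space.span_zero)
  next
    case (step c s t)
    then obtain xs where "s = pure xs" "set xs \<subseteq> V" "length xs = n" by auto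
    moreover from this have "s \<in> Tp n" using pure_in by blast
    ultimately show ?case
      using step assms(3)[of xs t c] fun_space.subspace_add[OF subspace_Tp] fun_space.subspace_scale[OF subspace_Tp]
      by (simp flip: tensor_power_def)
  qed
  then show ?thesis ..
qed

lemma Tp_closed: "0 \<in> Tp n" "s \<in> Tp n \<Longrightarrow> t \<in> Tp n \<Longrightarrow> s + t \<in> Tp n" "t \<in> Tp n \<Longrightarrow> fscale c t \<in> Tp n"
    "s \<in> Tp n \<Longrightarrow> t \<in> Tp n \<Longrightarrow> s - t \<in> Tp n" "(\<And>i. i \<in> I \<Longrightarrow> f i \<in> Tp n) \<Longrightarrow> sum f I \<in> Tp n"
  using subspace_Tp fun_space.subspace_0 fun_space.subspace_add fun_space.subspace_scale fun_space.subspace_diff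
    fun_space.subspace_sum by blast+

lemma tm_degree: "s \<in> Tp m \<Longrightarrow> t \<in> Tp n \<Longrightarrow> s \<bullet> t \<in> Tp (m + n)"
proof (induction rule: power_induct)
  case (step c xs s)
  have "pure xs \<bullet> t \<in> Tp (m + n)"
    using step.prems(1)
  proof (induction rule: power_induct)
    case (step c ys t)
    then show ?case
      using \<open>set xs \<subseteq> V\<close> \<open>length xs = m\<close> pure_in[of "xs @ ys"]
      by (simp add: tm_right pure_Ts Ts_closed Tp_Ts Tp_closed tm_pure)
  qed (use step.hyps in \<open>simp add: tm_zero_right pure_Ts Tp_closed\<close>)
  then show ?case using step by (simp add: tm_left Tp_closed)
qed (simp add: tm_left Tp_closed)

lemma coord_pure_mult:
  "set xs \<subseteq> V \<Longrightarrow> t \<in> Ts \<Longrightarrow>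
    coord (pure xs \<bullet> t) w = form (take (length xs) w) xs * coord t (drop (length xs) w)"
  by (rotate_tac, induction rule: tensors_induct)
     (simp_all add: tm_zero_right tm_right pure_Ts Ts_closed tm_pure coord_pure form_append algebra_simps)

text \<open>The word is cut from its right end, because \<open>t\<close> need not be homogeneous and
  only the degree of the right factor is known.\<close>

lemma coord_mult_pure:
  "t \<in> Ts \<Longrightarrow> set ys \<subseteq> V \<Longrightarrow>
    coord (t \<bullet> pure ys) w = coord t (take (length w - length ys) w) * form (drop (length w - length ys) w) ys"
proof (induction rule: tensors_induct)
  case (step c xs t)
  have "form w (xs @ ys) = form (take (length w - length ys) w) xs * form (drop (length w - length ys) w) ys"
  proof (cases "length w = length xs + length ys")
    case False
    then show ?thesis by (auto simp: form_def)
  qed (simp add: form_append)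
  with step show ?case by (simp add: tm_left tm_pure coord_pure algebra_simps)
qed (simp add: tm_left)

lemma coord_mult:
  assumes "s \<in> Tp m" "t \<in> Ts"
  shows "coord (s \<bullet> t) w = coord s (take m w) * coord t (drop m w)"
  using assms(1)
  by (induction rule: power_induct) (use assms(2) in \<open>simp_all add: tm_left coord_pure_mult coord_pure algebra_simps\<close>)

end

section \<open>The spaces \<open>W\<close>, the ideal of relations and the quotient algebra in
  coordinates\<close>

locale based_quadratic = based_space scale V J e x + quadratic_data scale V R
  for scale :: "'k::field \<Rightarrow> 'v::ab_group_add \<Rightarrow> 'v" and V and J :: "'i set" and e x
    and R :: "('k, 'v) tensor set" +
  assumes R_subspace: "fun_space.subspace R" and R_degree: "R \<subseteq> Tp 2"
begin

lemma T_simps [simp]: "carrier T = Ts" "mult T = tensor_mult scale V" "one T = pure []" "zero T = 0"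
    "add T = (+)" "smult T = fscale"
  by (simp_all add: T_def tensor_algebra_def)

lemma ring_T: "ring T"
proof (intro ringI abelian_groupI monoidI)
  show "\<exists>y\<in>carrier T. y \<oplus>\<^bsub>T\<^esub> t = \<zero>\<^bsub>T\<^esub>" if "t \<in> carrier T" for t
    using that Ts_closed(1) Ts_closed(4)[of 0 t] by (intro bexI[of _ "- t"]) auto
qed (auto simp: Ts_closed tm_closed tm_assoc tm_one tm_left tm_right pure_Ts add.assoc add.commute del: ext)

sublocale T: ring T by (rule ring_T)

definition S :: "('i list \<Rightarrow> 'k) set" where "S = coord ` R"
text \<open>The coordinates of the spaces \<open>W\<close> of the Koszul dual, available here
  without mentioning the dual space.\<close>

abbreviation W' :: "nat \<Rightarrow> ('i list \<Rightarrow> 'k) set" where "W' \<equiv> Wc J (annihilator J S)"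

lemma S_supp: "c \<in> S \<Longrightarrow> w \<notin> words J 2 \<Longrightarrow> c w = 0"
  using R_degree coord_supp[of _ 2] by (auto simp: S_def supp_def)

lemma coord_linear: "coord (s + t) = coord s + coord t" "coord (fscale c t) = fscale c (coord t)"
    "coord (s - t) = coord s - coord t" "coord 0 = 0"
  by (rule ext, simp only: plus_fun_apply zero_fun_apply minus_apply fscale_def coord_add coord_diff coord_0
      coord_scale[unfolded fscale_def])+

lemma subspace_coord_image:
  assumes "fun_space.subspace X"
  shows "fun_space.subspace (coord ` X)"
proof (rule fun_space.subspaceI)
  show "0 \<in> coord ` X"
    using coord_linear(4) fun_space.subspace_0[OF assms] by (rule image_eqI[OF sym])
  show "c + d \<in> coord ` X" if "c \<in> coord ` X" "d \<in> coord ` X" for c d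
    using that fun_space.subspace_add[OF assms] by (auto simp: image_iff coord_linear(1)[symmetric])
  show "fscale a c \<in> coord ` X" if "c \<in> coord ` X" for a c
    using that fun_space.subspace_scale[OF assms] by (auto simp: image_iff coord_linear(2)[symmetric])
qed

lemma subspace_S: "fun_space.subspace S"
  unfolding S_def by (rule subspace_coord_image[OF R_subspace])

lemma R_I: "r \<in> R \<Longrightarrow> r \<in> relation_ideal"
  unfolding relation_ideal_def using T.genideal_self[of R] R_degree Tp_Ts by auto

lemma ideal_I: "ideal relation_ideal T"
  unfolding relation_ideal_def by (rule T.genideal_ideal) (use R_degree Tp_Ts in auto)

sublocale I: ideal relation_ideal T by (rule ideal_I)

text \<open>A ring ideal of the tensor algebra is closed under scalars because scaling by
  \<open>c\<close> is multiplication by \<open>c\<close> times the unit.\<close>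

lemma subspace_I: "fun_space.subspace relation_ideal"
proof -
  have "fscale c t \<in> relation_ideal" if "t \<in> relation_ideal" for c t
  proof -
    have "t \<in> Ts" using that I.a_subset by auto
    then have "fscale c t = fscale c (pure []) \<bullet> t" by (simp add: tm_left tm_one)
    then show ?thesis using I.I_l_closed[OF that, of "fscale c (pure [])"] Ts_closed pure_Ts by simp
  qed
  then show ?thesis
    using I.zero_closed I.a_closed by (simp add: fun_space.subspace_def)
qed

text \<open>Fixing the outer letters in a tensor x r y with r in \<open>R\<close> leaves a multiple
  of r. Conversely, w is the sum over all outer words a, b of e_a r_ab e_b, where r_ab is the window
  of w that remains when a and b are fixed.\<close>

lemma W_iff: "w \<in> W p \<longleftrightarrow> w \<in> Tp p \<and> coord w \<in> Wc J S p"
proof safe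
  assume w: "w \<in> W p"
  then show Tp: "w \<in> Tp p" by (simp add: W_def)
  have "(\<lambda>z. coord w (a @ z @ b)) \<in> S" if p: "length a + 2 + length b = p" for a b
  proof -
    have "w \<in> fun_space.span {x \<bullet> r \<bullet> y |x r y. x \<in> Tp (length a) \<and> r \<in> R \<and> y \<in> Tp (length b)}"
      using w p unfolding W_def T_simps by blast
    then show ?thesis
    proof (induction rule: fun_space.span_induct_alt)
      case base
      then show ?case using fun_space.subspace_0[OF subspace_S] by (simp flip: zero_fun_def)
    next
      case (step c g t)
      then obtain s r y where g: "g = s \<bullet> r \<bullet> y" "s \<in> Tp (length a)" "r \<in> R" "y \<in> Tp (length b)" by auto
      have sr: "s \<bullet> r \<in> Tp (length a + 2)" "r \<in> Tp 2" "r \<in> Ts" "y \<in> Ts"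
        using g tm_degree[OF g(2), of r 2] R_degree Tp_Ts by auto
      \<comment> \<open>The identity is needed for every word \<open>z\<close>; unless
        \<open>z\<close> has length two, both sides vanish for reasons of degree.\<close>
      have "coord g (a @ z @ b) = coord s a * coord y b * coord r z" for z
      proof (cases "length z = 2")
        case True
        then show ?thesis using g sr by (simp add: coord_mult)
      next
        case False
        then have "a @ z @ b \<notin> words J p" "z \<notin> words J 2" using p by (auto simp: words_def)
        moreover have "g \<in> Tp p" using tm_degree[OF sr(1) g(4)] g(1) p by simp
        ultimately show ?thesis
          using coord_supp[of g p] coord_supp[OF sr(2)] by (simp add: supp_def)
      qed
      then have "(\<lambda>z. coord (fscale c g + t) (a @ z @ b)) =
          fscale (c * (coord s a * coord y b)) (coord r) + (\<lambda>z. coord t (a @ z @ b))"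
        by (simp add: fun_eq_iff fscale_def coord_def plus_fun_apply)
      moreover have "coord r \<in> S" using g by (simp add: S_def)
      ultimately show ?case
        using step.IH subspace_S by (metis fun_space.subspace_add fun_space.subspace_scale)
    qed
  qed
  then show "coord w \<in> Wc J S p"
    using coord_supp[OF Tp] by (auto simp: Wc_def supp_def)
next
  assume w: "w \<in> Tp p" "coord w \<in> Wc J S p"
  have "w \<in> fun_space.span {x \<bullet> r \<bullet> y |x r y. x \<in> Tp i \<and> r \<in> R \<and> y \<in> Tp j}" (is "_ \<in> fun_space.span ?G")
    if p: "i + 2 + j = p" for i j
  proof -
    define g where "g a b = pure (map e a) \<bullet> tens 2 (\<lambda>z. coord w (a @ z @ b)) \<bullet> pure (map e b)" for a b
    have r: "tens 2 (\<lambda>z. coord w (a @ z @ b)) \<in> R" if "a \<in> words J i" "b \<in> words J j" for a b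
    proof -
      have "(\<lambda>z. coord w (a @ z @ b)) \<in> S" using w(2) that p by (auto simp: Wc_def words_def)
      then obtain r where "r \<in> R" "(\<lambda>z. coord w (a @ z @ b)) = coord r" by (auto simp: S_def)
      then show ?thesis using tens_coord[of r 2] R_degree by auto
    qed
    have pE: "pure (map e a) \<in> Tp (length a)" "set (map e a) \<subseteq> V" if "a \<in> words J n" for a n
      using pure_in[OF set_map_e[OF that]] set_map_e[OF that] by auto
    have G: "g a b \<in> ?G" if "a \<in> words J i" "b \<in> words J j" for a b
      using r[OF that] pE[OF that(1)] pE[OF that(2)] that by (auto simp: g_def words_def)
    have gT: "g a b \<in> Tp p" if "a \<in> words J i" "b \<in> words J j" for a b
      using tm_degree[OF tm_degree[OF pE(1)[OF that(1)] tens_in[of 2]] pE(1)[OF that(2)]] that p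
      by (simp add: g_def words_def)
    have "w = (\<Sum>a\<in>words J i. \<Sum>b\<in>words J j. g a b)"
    proof (rule Tp_eqI[OF w(1)])
      show "(\<Sum>a\<in>words J i. \<Sum>b\<in>words J j. g a b) \<in> Tp p"
        by (intro Tp_closed gT)
      fix v assume "v \<in> words J p"
      then have v: "take i v \<in> words J i" "drop (i + 2) v \<in> words J j" "take 2 (drop i v) \<in> words J 2"
          "take i v @ take 2 (drop i v) @ drop (i + 2) v = v"
        using p append_take_drop_id[of i v] append_take_drop_id[of 2 "drop i v"]
        by (auto simp: words_def add.commute dest: in_set_takeD in_set_dropD)
      have "coord (g a b) v = (if a = take i v then 1 else 0) * ((if b = drop (i + 2) v then 1 else 0) * coord w v)"
        if "a \<in> words J i" "b \<in> words J j" for a b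
      proof -
        have "coord (g a b) v = coord (pure (map e a)) (take i v) *
            (coord (tens 2 (\<lambda>z. coord w (a @ z @ b))) (take 2 (drop i v)) * coord (pure (map e b)) (drop (i + 2) v))"
          using that tm_degree[OF pE(1)[OF that(1)] tens_in[of 2]] pE(1)[OF that(1)]
            Tp_Ts[OF pE(1)[OF that(2)]] Tp_Ts[OF tens_in[of 2]]
          by (simp add: g_def coord_mult[of _ "length a + 2", simplified] coord_mult[of _ "length a"] words_def drop_take)
        then show ?thesis
          using that v form_map_e[of "take i v" a] form_map_e[of "drop (i + 2) v" b]
          by (auto simp: coord_pure coord_tens words_def)
      qed
      then show "coord w v = coord (\<Sum>a\<in>words J i. \<Sum>b\<in>words J j. g a b) v"
        using v by (simp add: coord_sum flip: sum_distrib_left)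
    qed
    then show ?thesis
      using G by (metis (no_types, lifting) fun_space.span_base fun_space.span_sum)
  qed
  then show "w \<in> W p" using w(1) by (simp add: W_def)
qed

text \<open>The tensors all of whose homogeneous components are orthogonal to the spaces
  \<open>W'\<close> form a two-sided ideal \<open>K\<close>: multiplying by a pure tensor on one
  side amounts, in the pairing, to fixing letters of \<open>u\<close> at that side, which leaves an
  element of a smaller \<open>W'\<close>. As \<open>K\<close> contains \<open>R\<close>, it contains
  the ideal generated by \<open>R\<close>.\<close>

lemma I_pairing:
  assumes "t \<in> relation_ideal" "u \<in> W' m"
  shows "pairing J m u (coord t) = 0"
proof -
  define K where "K = {t \<in> Ts. \<forall>m. \<forall>u\<in>W' m. pairing J m u (coord t) = 0}"
  have K_sub: "fun_space.subspace K"
    unfolding K_def fun_space.subspace_def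
    by (auto simp: Ts_closed pairing_def distrib_left mult.left_commute sum.distrib simp flip: sum_distrib_left)
  have pure_left: "pure xs \<bullet> t \<in> K" and pure_right: "t \<bullet> pure xs \<in> K" if "set xs \<subseteq> V" and t: "t \<in> K" for xs t
  proof -
    let ?k = "length xs"
    have tT: "t \<in> Ts" using t by (simp add: K_def)
    have "pairing J m u (coord (pure xs \<bullet> t)) = 0 \<and> pairing J m u (coord (t \<bullet> pure xs)) = 0" if u: "u \<in> W' m" for m u
    proof (cases "?k \<le> m")
      case True
      \<comment> \<open>The word is cut after its first \<open>?k\<close> letters for the left
        product and before its last \<open>?k\<close> letters for the right one.\<close>
      then obtain n where m: "m = ?k + n" "m = n + ?k" by (metis le_Suc_ex add.commute)
      have "(\<Sum>b\<in>words J n. u (a @ b) * coord t b) = 0" if "a \<in> words J ?k" for a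
        using Wc_split(2)[of u J _ ?k n a] u m that t by (auto simp: K_def pairing_def words_def)
      then have "(\<Sum>b\<in>words J n. u (a @ b) * (form a xs * coord t b)) = 0" if "a \<in> words J ?k" for a
        using that by (simp add: mult.left_commute flip: sum_distrib_left)
      moreover have "(\<Sum>a\<in>words J n. u (a @ b) * coord t a) = 0" if "b \<in> words J ?k" for b
        using Wc_split(1)[of u J _ n ?k b] u[unfolded m(2)] that t by (auto simp: K_def pairing_def words_def)
      then have "(\<Sum>a\<in>words J n. u (a @ b) * (coord t a * form b xs)) = 0" if "b \<in> words J ?k" for b
        using that by (simp flip: sum_distrib_right mult.assoc)
      then have "(\<Sum>a\<in>words J n. \<Sum>b\<in>words J ?k. u (a @ b) * (coord t a * form b xs)) = 0"
        by (subst sum.swap) simp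
      moreover have "pairing J m u (coord (pure xs \<bullet> t)) =
          (\<Sum>a\<in>words J ?k. \<Sum>b\<in>words J n. u (a @ b) * (form a xs * coord t b))"
        unfolding m(1) pairing_def sum_words_add
        by (intro sum.cong) (simp_all add: coord_pure_mult[OF \<open>set xs \<subseteq> V\<close> tT] words_def)
      moreover have "pairing J m u (coord (t \<bullet> pure xs)) =
          (\<Sum>a\<in>words J n. \<Sum>b\<in>words J ?k. u (a @ b) * (coord t a * form b xs))"
        unfolding m(2) pairing_def sum_words_add
        by (intro sum.cong) (simp_all add: coord_mult_pure[OF tT \<open>set xs \<subseteq> V\<close>] words_def)
      ultimately show ?thesis by simp
    next
      case False
      then have "form (take ?k w) xs = 0" "form (drop (length w - ?k) w) xs = 0" if "w \<in> words J m" for w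
        using that by (auto simp: form_def words_def)
      then show ?thesis
        by (simp add: pairing_def coord_mult_pure[OF tT \<open>set xs \<subseteq> V\<close>] coord_pure_mult[OF \<open>set xs \<subseteq> V\<close> tT])
    qed
    then show "pure xs \<bullet> t \<in> K" "t \<bullet> pure xs \<in> K"
      using tm_closed pure_Ts tT \<open>set xs \<subseteq> V\<close> by (auto simp: K_def)
  qed
  have "ideal K T"
  proof (rule idealI[OF ring_T])
    have "\<ominus>\<^bsub>T\<^esub> t = - t" if "t \<in> Ts" for t
      using that Ts_closed(4)[OF Ts_closed(1) that] by (intro T.minus_equality) auto
    then have "inv\<^bsub>add_monoid T\<^esub> t \<in> K" if "t \<in> K" for t
      using fun_space.subspace_neg[OF K_sub that] that by (simp add: a_inv_def K_def)
    then show "subgroup K (add_monoid T)"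
      using K_sub by (intro subgroup.intro) (auto simp: K_def fun_space.subspace_def)
    show "s \<otimes>\<^bsub>T\<^esub> t \<in> K" if "t \<in> K" "s \<in> carrier T" for s t
      using that(2)[simplified]
    proof (induction rule: tensors_induct)
      case (step c xs s)
      then show ?case
        using pure_left[of xs t] that(1) K_sub by (simp add: tm_left fun_space.subspace_def)
    qed (use K_sub in \<open>simp add: tm_left fun_space.subspace_def\<close>)
    show "t \<otimes>\<^bsub>T\<^esub> s \<in> K" if "t \<in> K" "s \<in> carrier T" for s t
      using that(2)[simplified]
    proof (induction rule: tensors_induct)
      have tT: "t \<in> Ts" using that(1) by (simp add: K_def)
      case (step c xs s)
      then show ?case
        using pure_right[of xs t] that(1) K_sub tT
        by (simp add: tm_right Ts_closed pure_Ts fun_space.subspace_def)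
    qed (use K_sub that in \<open>simp add: tm_zero_right K_def fun_space.subspace_def\<close>)
  qed
  moreover have "R \<subseteq> K"
  proof
    fix r assume r: "r \<in> R"
    then have rT: "r \<in> Tp 2" "coord r \<in> S" using R_degree by (auto simp: S_def)
    have "pairing J m u (coord r) = 0" if u: "u \<in> W' m" for u m
    proof (cases "m = 2")
      case True
      then have "u \<in> annihilator J S" using u by (auto simp: Wc_def dest: spec[of _ "[]"])
      then show ?thesis using rT(2) True by (simp add: annihilator_def)
    next
      case False
      then have "coord r w = 0" if "w \<in> words J m" for w
        using coord_supp[OF rT(1)] that by (auto simp: supp_def words_def)
      then show ?thesis by (simp add: pairing_def)
    qed
    then show "r \<in> K" using Tp_Ts[OF rT(1)] by (simp add: K_def)
  qed
  ultimately have "relation_ideal \<subseteq> K"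
    unfolding relation_ideal_def by (rule T.genideal_minimal)
  then show ?thesis using assms by (auto simp: K_def)
qed

text \<open>The converse is a double annihilator argument in degree \<open>m\<close>: a functional
  \<open>d\<close> orthogonal to the degree \<open>m\<close> part of the ideal lies in
  \<open>W' m\<close>, because the ideal contains all products e_a r e_b with \<open>r\<close> in
  \<open>R\<close>.\<close>

lemma I_iff:
  assumes "t \<in> Tp m"
  shows "t \<in> relation_ideal \<longleftrightarrow> (\<forall>u\<in>W' m. pairing J m u (coord t) = 0)"
proof
  show "t \<in> relation_ideal \<Longrightarrow> \<forall>u\<in>W' m. pairing J m u (coord t) = 0"
    using I_pairing by blast
  assume perp: "\<forall>u\<in>W' m. pairing J m u (coord t) = 0"
  define X where "X = coord ` (relation_ideal \<inter> Tp m)"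
  have "coord t \<in> X"
  proof (rule double_annihilator[of _ "words J m"])
    have "fun_space.subspace (relation_ideal \<inter> Tp m)"
      by (rule fun_space.subspace_inter[OF subspace_I subspace_Tp])
    then show "fun_space.subspace X"
      unfolding X_def by (rule subspace_coord_image)
    show "c a = 0" if "c \<in> X" "a \<notin> words J m" for c a
      using that coord_supp[of _ m] by (auto simp: X_def supp_def)
    show "coord t a = 0" if "a \<notin> words J m" for a
      using that coord_supp[OF assms] by (simp add: supp_def)
    fix d assume d: "\<And>a. a \<notin> words J m \<Longrightarrow> d a = 0" "\<And>c. c \<in> X \<Longrightarrow> (\<Sum>v\<in>words J m. d v * c v) = 0"
    have "d \<in> W' m"
      unfolding Wc_def
    proof (intro CollectI conjI allI impI)
      show "d v = 0" if "v \<notin> words J m" for v using d(1)[OF that] .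
      fix a b :: "'i list" assume m: "length a + 2 + length b = m"
      show "(\<lambda>z. d (a @ z @ b)) \<in> annihilator J S"
        unfolding annihilator_def
      proof (intro CollectI conjI allI impI ballI)
        show "d (a @ w @ b) = 0" if "w \<notin> words J 2" for w
          using that m by (intro d(1)) (auto simp: words_def)
        fix c assume "c \<in> S"
        then obtain r where r: "r \<in> R" "c = coord r" by (auto simp: S_def)
        show "pairing J 2 (\<lambda>z. d (a @ z @ b)) c = 0"
        proof (cases "set a \<subseteq> J \<and> set b \<subseteq> J")
          case False
          then have "d (a @ z @ b) = 0" for z by (intro d(1)) (auto simp: words_def)
          then show ?thesis by (simp add: pairing_def)
        next
          case True
          then have V: "set (map e a) \<subseteq> V" "set (map e b) \<subseteq> V" by (auto intro: e_in)
          have rT: "r \<in> Tp 2" "r \<in> Ts" using r R_degree Tp_Ts by auto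
          have aw: "a \<in> words J (length a)" "b \<in> words J (length b)" using True by (simp_all add: words_def)
          \<comment> \<open>Pairing \<open>d\<close> with this element of the ideal gives the
            pairing of \<open>r\<close> with the window of \<open>d\<close> between \<open>a\<close>
            and \<open>b\<close>.\<close>
          define g where "g = pure (map e a) \<bullet> r \<bullet> pure (map e b)"
          have "g \<in> relation_ideal"
            using I.I_r_closed[OF I.I_l_closed[OF R_I[OF r(1)], of "pure (map e a)"], of "pure (map e b)"] V pure_Ts
            by (simp add: g_def)
          moreover have ar: "pure (map e a) \<bullet> r \<in> Tp (length a + 2)"
            using tm_degree[OF pure_in[OF V(1)] rT(1)] by simp
          have gT: "g \<in> Tp m"
            using tm_degree[OF ar pure_in[OF V(2)]] m by (simp add: g_def)
          ultimately have "(\<Sum>v\<in>words J m. d v * coord g v) = 0" by (intro d(2)) (auto simp: X_def)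
          moreover have "coord g (a' @ z @ b') = (if a' = a then 1 else 0) * ((if b' = b then 1 else 0) * coord r z)"
            if "a' \<in> words J (length a)" "z \<in> words J 2" "b' \<in> words J (length b)" for a' z b'
            using that True V pure_Ts rT(2) form_map_e[of a' a] form_map_e[of b' b]
            by (simp add: g_def coord_mult[OF ar] coord_pure_mult coord_pure words_def)
          ultimately have "(\<Sum>a'\<in>words J (length a). \<Sum>z\<in>words J 2. \<Sum>b'\<in>words J (length b).
             d (a' @ z @ b') * ((if a' = a then 1 else 0) * ((if b' = b then 1 else 0) * coord r z))) = 0"
            unfolding m[symmetric] add.assoc sum_words_add by simp
          also have "(\<Sum>a'\<in>words J (length a). \<Sum>z\<in>words J 2. \<Sum>b'\<in>words J (length b).
             d (a' @ z @ b') * ((if a' = a then 1 else 0) * ((if b' = b then 1 else 0) * coord r z))) =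
             (\<Sum>a'\<in>words J (length a). (if a' = a then 1 else 0) * (\<Sum>z\<in>words J 2. \<Sum>b'\<in>words J (length b).
               (if b' = b then 1 else 0) * (d (a' @ z @ b') * coord r z)))"
            unfolding sum_distrib_left by (intro sum.cong) auto
          finally show ?thesis
            using r(2) by (simp add: pairing_def aw)
        qed
      qed
    qed
    then show "(\<Sum>v\<in>words J m. d v * coord t v) = 0" using perp by (simp add: pairing_def)
  qed simp
  then obtain t' where "t' \<in> relation_ideal" "t' \<in> Tp m" "coord t = coord t'" by (auto simp: X_def)
  then show "t \<in> relation_ideal" using Tp_eqI[OF assms, of t'] by auto
qed

lemma A_simps [simp]: "carrier A = carrier (T Quot relation_ideal)" "mult A = mult (T Quot relation_ideal)"
    "one A = one (T Quot relation_ideal)" "zero A = zero (T Quot relation_ideal)"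
    "add A = add (T Quot relation_ideal)"
  by (simp_all add: A_def quotient_algebra_def)

lemma ring_A: "ring A"
  by (rule ring_cong[OF I.quotient_is_ring]) simp_all

sublocale A: ring A by (rule ring_A)

lemma proj_eq: "proj t = (\<lambda>i. i + t) ` relation_ideal"
  by (auto simp: proj_def a_r_coset_def r_coset_def)

lemma proj_eq_iff: "proj s = proj t \<longleftrightarrow> s - t \<in> relation_ideal"
proof
  assume "proj s = proj t"
  moreover have "s \<in> proj s" using fun_space.subspace_0[OF subspace_I] by (force simp: proj_eq)
  ultimately show "s - t \<in> relation_ideal" by (auto simp: proj_eq)
next
  assume st: "s - t \<in> relation_ideal"
  show "proj s = proj t"
    unfolding proj_eq
  proof safe
    fix i assume i: "i \<in> relation_ideal"
    have "i + s = (i + (s - t)) + t" "i + t = (i - (s - t)) + s" by simp_all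
    then show "i + s \<in> (\<lambda>i. i + t) ` relation_ideal" "i + t \<in> (\<lambda>i. i + s) ` relation_ideal"
      using fun_space.subspace_add[OF subspace_I i st] fun_space.subspace_diff[OF subspace_I i st]
      by (metis imageI)+
  qed
qed

lemma proj_hom: "proj \<in> ring_hom T A"
  using I.rcos_ring_hom by (simp add: proj_def[abs_def] ring_hom_def)

lemma proj_simps:
  assumes "s \<in> Ts"
  shows "proj s \<in> carrier A" "t \<in> Ts \<Longrightarrow> proj s \<oplus>\<^bsub>A\<^esub> proj t = proj (s + t)"
    "t \<in> Ts \<Longrightarrow> proj s \<otimes>\<^bsub>A\<^esub> proj t = proj (s \<bullet> t)"
  using ring_hom_closed[OF proj_hom, of s] ring_hom_add[OF proj_hom, of s t] ring_hom_mult[OF proj_hom, of s t] assms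
  by simp_all

lemma proj_0: "proj 0 = \<zero>\<^bsub>A\<^esub>"
  using ring_hom_zero[OF proj_hom ring_T ring_A] by simp

lemma smult_proj: "c \<odot>\<^bsub>A\<^esub> proj s = proj (fscale c s)"
proof -
  \<comment> \<open>Scalar multiplication on the quotient is a union over all representatives; they
    yield one and the same coset, so the union is that coset.\<close>
  have "proj (fscale c (i + s)) = proj (fscale c s)" if "i \<in> relation_ideal" for i
    using fun_space.subspace_scale[OF subspace_I that]
    by (simp add: proj_eq_iff fun_space.scale_right_distrib)
  then have "c \<odot>\<^bsub>A\<^esub> proj s = (\<Union>i\<in>relation_ideal. proj (fscale c s))"
    by (simp add: A_def quotient_algebra_def proj_eq[of s] flip: proj_def)
  then show ?thesis using fun_space.subspace_0[OF subspace_I] by auto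
qed

end

section \<open>Koszul cochains as matrices\<close>

definition bilinear :: "'i set \<Rightarrow> nat \<Rightarrow> nat \<Rightarrow> ('i list \<Rightarrow> 'i list \<Rightarrow> 'k::field) \<Rightarrow> ('i list \<Rightarrow> 'k) \<Rightarrow> ('i list \<Rightarrow> 'k) \<Rightarrow> 'k" where
  "bilinear J p m F u c = (\<Sum>a\<in>words J m. \<Sum>b\<in>words J p. u a * F a b * c b)"

text \<open>An entry of the tensor product of two matrices. The places of the cuts are arguments
  because the matrices are not assumed to be homogeneous.\<close>

definition block :: "nat \<Rightarrow> nat \<Rightarrow> ('i list \<Rightarrow> 'i list \<Rightarrow> 'k::field) \<Rightarrow> ('i list \<Rightarrow> 'i list \<Rightarrow> 'k) \<Rightarrow> 'i list \<Rightarrow> 'i list \<Rightarrow> 'k" where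
  "block p m F G u v = F (take m u) (take p v) * G (drop m u) (drop p v)"

context based_quadratic begin

definition pr :: "nat \<Rightarrow> ('i list \<Rightarrow> 'k) \<Rightarrow> ('k, 'v) tensor set" where
  "pr m c = proj (tens m c)"

lemma tens_Ts: "tens m c \<in> Ts"
  using Tp_Ts tens_in .

lemma pr_carrier [simp]: "pr m c \<in> carrier A"
  unfolding pr_def using proj_simps(1)[OF tens_Ts] .

lemma pr_add: "pr m c \<oplus>\<^bsub>A\<^esub> pr m d = pr m (\<lambda>w. c w + d w)"
  unfolding pr_def by (simp add: proj_simps(2)[OF tens_Ts tens_Ts] tens_add del: A_simps)

lemma pr_scale: "a \<odot>\<^bsub>A\<^esub> pr m c = pr m (\<lambda>w. a * c w)"
  unfolding pr_def by (simp add: smult_proj tens_scale)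

lemma pr_zero: "pr m (\<lambda>w. 0) = \<zero>\<^bsub>A\<^esub>"
  unfolding pr_def tens_0 by (rule proj_0)

lemma pr_cong: "(\<And>w. w \<in> words J m \<Longrightarrow> c w = d w) \<Longrightarrow> pr m c = pr m d"
  unfolding pr_def using tens_cong by metis

lemma pr_minus: "pr m c \<ominus>\<^bsub>A\<^esub> pr m d = pr m (\<lambda>w. c w - d w)"
proof -
  have "\<ominus>\<^bsub>A\<^esub> pr m d = pr m (\<lambda>w. - d w)"
    by (rule A.minus_equality) (simp_all add: pr_add pr_zero del: A_simps)
  then show ?thesis by (simp add: a_minus_def pr_add del: A_simps)
qed

lemma pr_mult: "pr m c \<otimes>\<^bsub>A\<^esub> pr n d = pr (m + n) (\<lambda>w. c (take m w) * d (drop m w))"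
proof -
  have "tens m c \<bullet> tens n d = tens (m + n) (\<lambda>w. c (take m w) * d (drop m w))"
  proof (rule Tp_eqI[OF tm_degree[OF tens_in tens_in] tens_in])
    fix w assume "w \<in> words J (m + n)"
    then have "take m w \<in> words J m" "drop m w \<in> words J n" "w \<in> words J (m + n)"
      by (auto simp: words_def dest: in_set_takeD in_set_dropD)
    then show "coord (tens m c \<bullet> tens n d) w = coord (tens (m + n) (\<lambda>w. c (take m w) * d (drop m w))) w"
      by (simp add: coord_mult[OF tens_in tens_Ts] coord_tens)
  qed
  then show ?thesis unfolding pr_def by (simp add: proj_simps(3)[OF tens_Ts tens_Ts] del: A_simps)
qed

lemma pr_eq_iff: "pr m c = pr m d \<longleftrightarrow> (\<forall>u\<in>W' m. pairing J m u c = pairing J m u d)"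
proof -
  have *: "pairing J m u (coord (tens m c)) = pairing J m u c" for u c
    by (auto simp: pairing_def coord_tens)
  have "pr m c = pr m d \<longleftrightarrow> tens m (\<lambda>w. c w - d w) \<in> relation_ideal"
    unfolding pr_def proj_eq_iff tens_diff ..
  then show ?thesis by (simp add: I_iff[OF tens_in] * pairing_linear)
qed

lemma A_weight_eq: "A_weight m = range (pr m)"
proof -
  have "Tp m = range (tens m)" 
  proof safe
    show "t \<in> range (tens m)" if "t \<in> Tp m" for t
      by (rule range_eqI[where x = "coord t"]) (simp add: tens_coord[OF that])
  qed (rule tens_in)
  then show ?thesis by (simp add: A_weight_def pr_def image_image)
qed

lemma pr_finsum:
  "finite D \<Longrightarrow> finsum A (\<lambda>i. pr m (c i)) D = pr m (\<lambda>w. \<Sum>i\<in>D. c i w)"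
proof (induction D rule: finite_induct)
  case (insert i D)
  then show ?case by (simp add: A.finsum_insert pr_add del: A_simps)
qed (simp add: pr_zero del: A_simps)

lemma subspace_W: "fun_space.subspace (W p)"
  using subspace_Tp[of p] subspace_Wc[OF subspace_S, of J p]
  by (auto simp: fun_space.subspace_def W_iff coord_linear)

lemma W_closed: "v \<in> W p \<Longrightarrow> w \<in> W p \<Longrightarrow> v + w \<in> W p" "w \<in> W p \<Longrightarrow> fscale c w \<in> W p"
  "(\<And>i. i \<in> I \<Longrightarrow> f i \<in> W p) \<Longrightarrow> sum f I \<in> W p"
  using subspace_W fun_space.subspace_add fun_space.subspace_scale fun_space.subspace_sum by blast+

lemma W_Tp: "w \<in> W p \<Longrightarrow> w \<in> Tp p" and W_coord: "w \<in> W p \<Longrightarrow> coord w \<in> Wc J S p"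
  by (simp_all add: W_iff)

lemma tens_W: "c \<in> Wc J S p \<Longrightarrow> tens p c \<in> W p" "c \<in> Wc J S p \<Longrightarrow> coord (tens p c) = c"
proof -
  assume c: "c \<in> Wc J S p"
  then have "c \<in> supp p" using Wc_outside[OF c] by (auto simp: supp_def)
  then show "tens p c \<in> W p" "coord (tens p c) = c" using c by (simp_all add: W_iff tens_in coord_tens_supp)
qed

definition matrix_map ::
    "nat \<Rightarrow> nat \<Rightarrow> ('i list \<Rightarrow> 'i list \<Rightarrow> 'k) \<Rightarrow> ('k, 'v) tensor \<Rightarrow> ('k, 'v) tensor set" where
  "matrix_map p m F = (\<lambda>w\<in>W p. pr m (\<lambda>u. \<Sum>v\<in>words J p. F u v * coord w v))"

lemma matrix_map_cong:
  "(\<And>u v. u \<in> words J m \<Longrightarrow> v \<in> words J p \<Longrightarrow> F u v = G u v) \<Longrightarrow> matrix_map p m F = matrix_map p m G"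
  unfolding matrix_map_def by (intro restrict_ext pr_cong sum.cong) auto

lemma matrix_map_Hom: "matrix_map p m F \<in> Hom_W p m"
  unfolding Hom_W_def A_weight_eq
  by (auto simp: matrix_map_def W_closed pr_add pr_scale distrib_left sum.distrib sum_distrib_left mult.left_commute
      simp del: A_simps)

lemma matrix_map_zero: "matrix_map p m (\<lambda>u v. 0) = zero_map p"
  by (simp add: matrix_map_def zero_map_def pr_zero del: A_simps cong: restrict_cong)

text \<open>The criterion behind the duality. Equality of the values in A_m is tested by pairing
  with \<open>W' m\<close>, and the coordinates of elements of \<open>W p\<close> run through all of
  \<open>Wc J S p\<close>, so both arguments of the form range over spaces of the same kind.\<close>

lemma matrix_map_eq_iff:
  "matrix_map p m F = matrix_map p m G \<longleftrightarrow>
    (\<forall>c\<in>Wc J S p. \<forall>u\<in>W' m. bilinear J p m F u c = bilinear J p m G u c)"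
proof -
  have *: "pairing J m u (\<lambda>u. \<Sum>v\<in>words J p. F u v * c v) = bilinear J p m F u c" for u F c
    by (simp add: pairing_def bilinear_def sum_distrib_left mult.assoc)
  have "matrix_map p m F = matrix_map p m G \<longleftrightarrow>
      (\<forall>w\<in>W p. pr m (\<lambda>u. \<Sum>v\<in>words J p. F u v * coord w v) = pr m (\<lambda>u. \<Sum>v\<in>words J p. G u v * coord w v))"
    unfolding matrix_map_def restrict_def fun_eq_iff by auto
  also have "\<dots> \<longleftrightarrow> (\<forall>w\<in>W p. \<forall>u\<in>W' m. bilinear J p m F u (coord w) = bilinear J p m G u (coord w))"
    by (simp add: pr_eq_iff *)
  also have "\<dots> \<longleftrightarrow> (\<forall>c\<in>Wc J S p. \<forall>u\<in>W' m. bilinear J p m F u c = bilinear J p m G u c)"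
    using W_coord tens_W by metis
  finally show ?thesis .
qed

lemma Wc_projection:
  obtains P where "\<And>v. P v \<in> Wc J S p" "\<And>c a. c \<in> Wc J S p \<Longrightarrow> (\<Sum>v\<in>words J p. c v * P v a) = c a"
proof (rule projection_matrix[OF subspace_Wc[OF subspace_S, of J p] finite_words[OF finite_J, of p]])
  show "c a = 0" if "c \<in> Wc J S p" "a \<notin> words J p" for c a
    using Wc_outside[OF that] .
qed (use that in blast)

text \<open>A map on \<open>W p\<close> is extended to all functions on words by composing it with a
  projection onto \<open>W p\<close>. The matrix depends on the projection and on representatives in
  A_m.\<close>

lemma Hom_W_matrix:
  assumes f: "f \<in> Hom_W p m"
  obtains F where "f = matrix_map p m F"
proof -
  obtain P where P: "\<And>v. P v \<in> Wc J S p" "\<And>c a. c \<in> Wc J S p \<Longrightarrow> (\<Sum>v\<in>words J p. c v * P v a) = c a"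
    using Wc_projection[of p] by blast
  have fW: "f w \<in> range (pr m)" if "w \<in> W p" for w
    using f that by (auto simp: Hom_W_def A_weight_eq)
  have add: "f (v + w) = f v \<oplus>\<^bsub>A\<^esub> f w" if "v \<in> W p" "w \<in> W p" for v w
    using f that by (auto simp: Hom_W_def)
  have scale: "f (fscale c w) = c \<odot>\<^bsub>A\<^esub> f w" if "w \<in> W p" for c w
    using f that by (auto simp: Hom_W_def)
  \<comment> \<open>A representative of the value at each row of the projection is chosen; these
    become the columns of the matrix.\<close>
  have "\<exists>a. f (tens p (P v)) = pr m a" for v
    using fW[OF tens_W(1)[OF P(1)]] by blast
  then obtain a where a: "\<And>v. f (tens p (P v)) = pr m (a v)" by metis
  have f0: "f 0 = \<zero>\<^bsub>A\<^esub>"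
  proof -
    have z: "0 \<in> W p" using fun_space.subspace_0[OF subspace_W] .
    obtain c where "f 0 = pr m c" using fW[OF z] by blast
    then show ?thesis using scale[OF z, of 0] pr_scale[of 0 m c] pr_zero by simp
  qed
  have sum: "f (\<Sum>v\<in>D. fscale (c v) (tens p (P v))) = pr m (\<lambda>u. \<Sum>v\<in>D. c v * a v u)" if "finite D" for c D
    using that
  proof (induction D rule: finite_induct)
    case (insert v D)
    then show ?case
      by (simp add: add scale W_closed tens_W P(1) a pr_scale pr_add del: A_simps)
  qed (simp add: f0 pr_zero del: A_simps)
  have "f w = matrix_map p m (\<lambda>u v. a v u) w" for w
  proof (cases "w \<in> W p")
    case True
    have "w = (\<Sum>v\<in>words J p. fscale (coord w v) (tens p (P v)))"
      using P(2)[OF W_coord[OF True]] tens_W(2)[OF P(1)]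
      by (intro Tp_eqI[of _ p] Tp_closed tens_in W_Tp[OF True]) (simp add: coord_sum)
    then have "f w = f (\<Sum>v\<in>words J p. fscale (coord w v) (tens p (P v)))" by (rule arg_cong)
    also have "\<dots> = pr m (\<lambda>u. \<Sum>v\<in>words J p. coord w v * a v u)" by (rule sum) simp
    finally show ?thesis using True by (simp add: matrix_map_def mult.commute)
  next
    case False
    then show ?thesis using f by (auto simp: Hom_W_def matrix_map_def)
  qed
  then show ?thesis using that by blast
qed

text \<open>With the last \<open>q\<close> letters fixed, \<open>w\<close> lies in
  \<open>W p\<close> and can be expanded in the rows of the projection matrix. The coefficients are
  \<open>w\<close> with its first \<open>p\<close> letters fixed, and these lie in
  \<open>W q\<close>.\<close>

lemma W_decomposition:
  assumes "w \<in> W (p + q)"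
  obtains N :: nat and y z where "\<And>i. i < N \<Longrightarrow> y i \<in> W p" "\<And>i. i < N \<Longrightarrow> z i \<in> W q"
    "w = (\<Sum>i<N. y i \<bullet> z i)"
proof -
  obtain P where P: "\<And>v. P v \<in> Wc J S p" "\<And>c a. c \<in> Wc J S p \<Longrightarrow> (\<Sum>v\<in>words J p. c v * P v a) = c a"
    using Wc_projection[of p] by blast
  define Y where "Y v = tens p (P v)" for v
  define Z where "Z v = tens q (\<lambda>b. coord w (v @ b))" for v
  have Y: "Y v \<in> W p" "coord (Y v) = P v" for v
    unfolding Y_def using tens_W[OF P(1)] .
  have Z: "Z v \<in> W q" "coord (Z v) = (\<lambda>b. coord w (v @ b))" if "v \<in> words J p" for v
    unfolding Z_def using tens_W[OF Wc_split(2)[OF W_coord[OF assms], of v]] that by (simp_all add: words_def)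
  have eq: "w = (\<Sum>v\<in>words J p. Y v \<bullet> Z v)"
  proof (rule Tp_eqI[OF W_Tp[OF assms]])
    show "(\<Sum>v\<in>words J p. Y v \<bullet> Z v) \<in> Tp (p + q)"
      by (intro Tp_closed(5) tm_degree W_Tp Y Z)
    fix v assume "v \<in> words J (p + q)"
    then have v: "length (drop p v) = q" by (auto simp: words_def)
    have "coord w v = coord w (take p v @ drop p v)" by simp
    also have "\<dots> = (\<Sum>a\<in>words J p. coord w (a @ drop p v) * P a (take p v))"
      using P(2)[OF Wc_split(1)[OF W_coord[OF assms] v], of "take p v"] by simp
    also have "\<dots> = coord (\<Sum>v\<in>words J p. Y v \<bullet> Z v) v"
      by (simp add: coord_sum coord_mult[OF W_Tp[OF Y(1)] Tp_Ts[OF W_Tp[OF Z(1)]]] Y(2) Z(2) mult.commute)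
    finally show "coord w v = coord (\<Sum>v\<in>words J p. Y v \<bullet> Z v) v" .
  qed
  \<comment> \<open>The sum over words is renumbered, since \<open>concat_prod\<close> asks for sums
    over an initial segment of the naturals.\<close>
  obtain N b where b: "bij_betw b {..<N::nat} (words J p)"
    using ex_bij_betw_nat_finite[OF finite_words[OF finite_J]] by (metis atLeast0LessThan)
  show ?thesis
  proof (rule that[of N "Y \<circ> b" "Z \<circ> b"])
    show "(Z \<circ> b) i \<in> W q" if "i < N" for i
      using Z(1) b that by (auto simp: bij_betw_def)
    show "w = (\<Sum>i<N. (Y \<circ> b) i \<bullet> (Z \<circ> b) i)"
      unfolding eq by (subst sum.reindex_bij_betw[OF b, symmetric]) simp
  qed (simp add: Y)
qed

text \<open>The value of the matrix on the right does not depend on a decomposition of the argument; this gives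
  the uniqueness that \<open>THE\<close> requires.\<close>

lemma concat_prod_matrix:
  "concat_prod p q (matrix_map p m F) (matrix_map q n G) = matrix_map (p + q) (m + n) (block p m F G)"
proof -
  let ?f = "matrix_map p m F" and ?g = "matrix_map q n G"
  have unique: "finsum A (\<lambda>i. ?f (y i) \<otimes>\<^bsub>A\<^esub> ?g (z i)) {..<N} = matrix_map (p + q) (m + n) (block p m F G) w"
    if w: "w \<in> W (p + q)" and yz: "\<And>i. i < N \<Longrightarrow> y i \<in> W p" "\<And>i. i < N \<Longrightarrow> z i \<in> W q"
      and eq: "w = (\<Sum>i<N. y i \<bullet> z i)" for w y z and N :: nat
  proof -
    let ?F = "\<lambda>i u. \<Sum>v\<in>words J p. F u v * coord (y i) v"
    let ?G = "\<lambda>i u. \<Sum>v\<in>words J q. G u v * coord (z i) v"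
    have coord_w: "coord w (a @ b) = (\<Sum>i<N. coord (y i) a * coord (z i) b)" if "a \<in> words J p" for a b
      unfolding eq coord_sum
    proof (rule sum.cong)
      fix i assume "i \<in> {..<N}"
      then have "y i \<in> Tp p" "z i \<in> Ts" using yz W_Tp Tp_Ts by blast+
      then show "coord (y i \<bullet> z i) (a @ b) = coord (y i) a * coord (z i) b"
        using that by (simp add: coord_mult words_def)
    qed simp
    have "finsum A (\<lambda>i. ?f (y i) \<otimes>\<^bsub>A\<^esub> ?g (z i)) {..<N} =
        finsum A (\<lambda>i. pr (m + n) (\<lambda>u. ?F i (take m u) * ?G i (drop m u))) {..<N}"
      using yz by (intro A.finsum_cong') (auto simp: matrix_map_def pr_mult simp del: A_simps)
    also have "\<dots> = pr (m + n) (\<lambda>u. \<Sum>i<N. ?F i (take m u) * ?G i (drop m u))"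
      by (rule pr_finsum) simp
    also have "\<dots> = pr (m + n) (\<lambda>u. \<Sum>v\<in>words J (p + q). block p m F G u v * coord w v)"
    proof (rule pr_cong)
      fix u
      have "(\<Sum>v\<in>words J (p + q). block p m F G u v * coord w v) = (\<Sum>a\<in>words J p. \<Sum>b\<in>words J q. \<Sum>i<N.
          (F (take m u) a * coord (y i) a) * (G (drop m u) b * coord (z i) b))"
        unfolding sum_words_add
        by (intro sum.cong) (auto simp: words_def block_def coord_w sum_distrib_left algebra_simps)
      also have "\<dots> = (\<Sum>i<N. \<Sum>a\<in>words J p. \<Sum>b\<in>words J q.
          (F (take m u) a * coord (y i) a) * (G (drop m u) b * coord (z i) b))"
        by (subst (2) sum.swap, subst sum.swap) simp
      finally show "(\<Sum>i<N. ?F i (take m u) * ?G i (drop m u)) = (\<Sum>v\<in>words J (p + q). block p m F G u v * coord w v)"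
        by (simp add: sum_product)
    qed
    finally show ?thesis using w by (simp add: matrix_map_def)
  qed
  show ?thesis
  proof
    fix w
    show "concat_prod p q ?f ?g w = matrix_map (p + q) (m + n) (block p m F G) w"
    proof (cases "w \<in> W (p + q)")
      case True
      show ?thesis
      proof (rule W_decomposition[OF True])
        fix N :: nat and y z
        assume yz: "\<And>i. i < N \<Longrightarrow> y i \<in> W p" "\<And>i. i < N \<Longrightarrow> z i \<in> W q" "w = (\<Sum>i<N. y i \<bullet> z i)"
      have "(THE a. \<exists>(n::nat) x y. (\<forall>i<n. x i \<in> W p \<and> y i \<in> W q) \<and> w = (\<Sum>i<n. x i \<otimes>\<^bsub>T\<^esub> y i) \<and>
          a = (\<Oplus>\<^bsub>A\<^esub> i \<in> {..<n}. ?f (x i) \<otimes>\<^bsub>A\<^esub> ?g (y i))) = matrix_map (p + q) (m + n) (block p m F G) w"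
      proof (rule the_equality)
        show "\<exists>(l::nat) x y. (\<forall>i<l. x i \<in> W p \<and> y i \<in> W q) \<and> w = (\<Sum>i<l. x i \<otimes>\<^bsub>T\<^esub> y i) \<and>
          matrix_map (p + q) (m + n) (block p m F G) w = (\<Oplus>\<^bsub>A\<^esub> i \<in> {..<l}. ?f (x i) \<otimes>\<^bsub>A\<^esub> ?g (y i))"
          unfolding T_simps
          by (rule exI[of _ N], rule exI[of _ y], rule exI[of _ z])
             (use yz(1,2) yz(3)[symmetric] unique[OF True yz] in simp)
        fix a assume "\<exists>(n::nat) x y. (\<forall>i<n. x i \<in> W p \<and> y i \<in> W q) \<and> w = (\<Sum>i<n. x i \<otimes>\<^bsub>T\<^esub> y i) \<and>
          a = (\<Oplus>\<^bsub>A\<^esub> i \<in> {..<n}. ?f (x i) \<otimes>\<^bsub>A\<^esub> ?g (y i))"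
        then obtain l y z where "\<forall>i<l. y i \<in> W p \<and> z i \<in> W q" "w = (\<Sum>i<l. y i \<bullet> z i)"
          "a = (\<Oplus>\<^bsub>A\<^esub> i \<in> {..<l::nat}. ?f (y i) \<otimes>\<^bsub>A\<^esub> ?g (z i))"
          unfolding T_simps by blast
        then show "a = matrix_map (p + q) (m + n) (block p m F G) w"
          using unique[OF True, of l y z] by simp
      qed
      then show ?thesis using True by (simp add: concat_prod_def)
      qed
    next
      case False
      then show ?thesis by (simp add: concat_prod_def matrix_map_def)
    qed
  qed
qed

end

section \<open>The ring of word matrices with signs\<close>

text \<open>In \<open>F u v\<close> the word \<open>u\<close> is the coefficient index, so that \<open>length v\<close> is the homological weight and
  \<open>length u\<close> the coefficient weight.\<close>

type_synonym ('i, 'k) word_matrix = "'i list \<Rightarrow> 'i list \<Rightarrow> 'k"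

text \<open>What \<open>fst\<close> and \<open>snd\<close> have in common. Additivity governs signs
  of iterated products; (1, 1) is the biweight of the canonical map from V to A.\<close>

definition additive_weight :: "(nat \<times> nat \<Rightarrow> nat) \<Rightarrow> bool" where
  "additive_weight wt \<longleftrightarrow> (\<forall>p q m n. wt (p + q, m + n) = wt (p, m) + wt (q, n)) \<and> wt (1, 1) = 1"

text \<open>Mirrors \<open>cup\<close>: the cuts of the two words correspond to the splittings of
  the biweight. Within the range of summation the subtractions are never truncated.\<close>

definition sgn_mult :: "(nat \<times> nat \<Rightarrow> nat) \<Rightarrow> ('i, 'k::field) word_matrix \<Rightarrow> ('i, 'k) word_matrix \<Rightarrow> ('i, 'k) word_matrix" where
  "sgn_mult wt F G u v = (\<Sum>(p, m)\<in>{..length v} \<times> {..length u}.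
     (- 1) ^ (wt (p, m) * wt (length v - p, length u - m)) * block p m F G u v)"

text \<open>Deconcatenations of a pair of words. In these terms the associativity of
  \<open>sgn_mult\<close> involves neither indices nor subtraction.\<close>

definition splits :: "'i list \<times> 'i list \<Rightarrow> (('i list \<times> 'i list) \<times> ('i list \<times> 'i list)) set" where
  "splits z = {(x, y). (fst x @ fst y, snd x @ snd y) = z}"

definition word_sgn :: "(nat \<times> nat \<Rightarrow> nat) \<Rightarrow> 'i list \<times> 'i list \<Rightarrow> 'i list \<times> 'i list \<Rightarrow> 'k::field" where
  "word_sgn wt x y = (- 1) ^ (wt (length (snd x), length (fst x)) * wt (length (snd y), length (fst y)))"

lemma sum_splits:
  "(\<Sum>(x, y)\<in>splits (u, v). f x y) =
    (\<Sum>(p, m)\<in>{..length v} \<times> {..length u}. f (take m u, take p v) (drop m u, drop p v))"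
  by (rule sum.reindex_bij_witness[of _ "\<lambda>(p, m). ((take m u, take p v), (drop m u, drop p v))"
        "\<lambda>(x, y). (length (snd x), length (fst x))"])
     (auto simp: splits_def)

lemma finite_splits: "finite (splits z)"
proof -
  have "splits z \<subseteq> (\<lambda>(p, m). ((take m (fst z), take p (snd z)), (drop m (fst z), drop p (snd z)))) `
      ({..length (snd z)} \<times> {..length (fst z)})"
  proof clarify
    fix a b c d assume "((a, b), (c, d)) \<in> splits z"
    then show "((a, b), (c, d)) \<in> (\<lambda>(p, m). ((take m (fst z), take p (snd z)), (drop m (fst z), drop p (snd z)))) `
      ({..length (snd z)} \<times> {..length (fst z)})"
      by (intro image_eqI[of _ _ "(length b, length a)"]) (auto simp: splits_def)
  qed
  then show ?thesis by (rule finite_subset) simp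
qed

text \<open>Both sides run over the ways to cut \<open>z\<close> into three consecutive
  pieces.\<close>

lemma sum_splits_assoc:
  "(\<Sum>(x, y)\<in>splits z. \<Sum>(a, b)\<in>splits x. h a b y) = (\<Sum>(a, w)\<in>splits z. \<Sum>(b, y)\<in>splits w. h a b y)"
proof -
  have "(\<Sum>(x, y)\<in>splits z. \<Sum>(a, b)\<in>splits x. h a b y) =
      (\<Sum>((x, y), (a, b))\<in>(SIGMA xy:splits z. splits (fst xy)). h a b y)"
    by (subst sum.Sigma[symmetric]) (auto simp: finite_splits case_prod_unfold)
  also have "\<dots> = (\<Sum>((a, w), (b, y))\<in>(SIGMA aw:splits z. splits (snd aw)). h a b y)"
    by (rule sum.reindex_bij_witness[of _
        "\<lambda>((a, w), (b, y)). (((fst a @ fst b, snd a @ snd b), y), (a, b))"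
        "\<lambda>((x, y), (a, b)). ((a, (fst b @ fst y, snd b @ snd y)), (b, y))"])
       (auto simp: splits_def)
  also have "\<dots> = (\<Sum>(a, w)\<in>splits z. \<Sum>(b, y)\<in>splits w. h a b y)"
    by (subst sum.Sigma[symmetric]) (auto simp: finite_splits case_prod_unfold)
  finally show ?thesis .
qed

lemma sgn_mult_splits:
  "sgn_mult wt F G u v = (\<Sum>(x, y)\<in>splits (u, v). word_sgn wt x y * (case_prod F x * case_prod G y))"
  unfolding sum_splits sgn_mult_def by (intro sum.cong) (auto simp: word_sgn_def block_def)

text \<open>As the weight is additive, the sign is multiplicative in each argument under
  concatenation, so either bracketing gives a triple of pieces the product of its three pairwise
  signs.\<close>

lemma sgn_mult_assoc:
  assumes "additive_weight wt"
  shows "sgn_mult wt (sgn_mult wt F G) H = sgn_mult wt F (sgn_mult wt G H)"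
proof (intro ext)
  fix u v :: "'a list"
  let ?h = "\<lambda>a b y. word_sgn wt a b * word_sgn wt a y * word_sgn wt b y * (case_prod F a * case_prod G b * case_prod H y) :: 'b"
  have left: "word_sgn wt x y * (case_prod (sgn_mult wt F G) x * case_prod H y) = (\<Sum>(a, b)\<in>splits x. ?h a b y)"
    and right: "word_sgn wt x y * (case_prod F x * case_prod (sgn_mult wt G H) y) = (\<Sum>(b, y)\<in>splits y. ?h x b y)"
    for x y :: "'a list \<times> 'a list"
  proof -
    have *: "word_sgn wt x y = word_sgn wt a y * (word_sgn wt b y :: 'b)" if "(a, b) \<in> splits x" for a b
      using that assms by (auto simp: additive_weight_def splits_def word_sgn_def distrib_right simp flip: power_add)
    show "word_sgn wt x y * (case_prod (sgn_mult wt F G) x * case_prod H y) = (\<Sum>(a, b)\<in>splits x. ?h a b y)"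
      unfolding sgn_mult_splits case_prod_beta[of "sgn_mult wt F G"] prod.collapse sum_distrib_left sum_distrib_right
      by (intro sum.cong refl) (auto simp: * algebra_simps)
    have *: "word_sgn wt x y = word_sgn wt x b * (word_sgn wt x c :: 'b)" if "(b, c) \<in> splits y" for b c
      using that assms by (auto simp: additive_weight_def splits_def word_sgn_def distrib_left simp flip: power_add)
    show "word_sgn wt x y * (case_prod F x * case_prod (sgn_mult wt G H) y) = (\<Sum>(b, y)\<in>splits y. ?h x b y)"
      unfolding sgn_mult_splits case_prod_beta[of "sgn_mult wt G H"] prod.collapse sum_distrib_left
      by (intro sum.cong refl) (auto simp: * algebra_simps)
  qed
  have "sgn_mult wt (sgn_mult wt F G) H u v = (\<Sum>(x, y)\<in>splits (u, v). \<Sum>(a, b)\<in>splits x. ?h a b y)"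
    unfolding sgn_mult_splits[of _ "sgn_mult wt F G"] left ..
  also have "\<dots> = (\<Sum>(a, w)\<in>splits (u, v). \<Sum>(b, y)\<in>splits w. ?h a b y)"
    by (rule sum_splits_assoc)
  also have "\<dots> = sgn_mult wt F (sgn_mult wt G H) u v"
    unfolding sgn_mult_splits[of _ _ "sgn_mult wt G H"] right ..
  finally show "sgn_mult wt (sgn_mult wt F G) H u v = sgn_mult wt F (sgn_mult wt G H) u v" .
qed

definition unit_matrix :: "('i, 'k::field) word_matrix" where
  "unit_matrix u v = (if u = [] \<and> v = [] then 1 else 0)"

definition letter_matrix :: "('i, 'k::field) word_matrix" where
  "letter_matrix u v = (if u = v \<and> length u = 1 then 1 else 0)"

lemma sgn_mult_unit:
  assumes "additive_weight wt"
  shows "sgn_mult wt unit_matrix F = F" "sgn_mult wt F unit_matrix = F"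
proof -
  \<comment> \<open>Additivity forces weight zero at the biweight of the unit, so the unit
    introduces no sign.\<close>
  have "wt (0 + 0, 0 + 0) = wt (0, 0) + wt (0, 0)" using assms unfolding additive_weight_def by blast
  then have wt0: "wt (0, 0) = 0" by simp
  have "sgn_mult wt unit_matrix F u v =
      (\<Sum>i\<in>{..length v} \<times> {..length u}. if i = (0, 0) then F u v else 0)" for u v
    unfolding sgn_mult_def by (intro sum.cong) (auto simp: block_def unit_matrix_def wt0 split: if_splits)
  then show "sgn_mult wt unit_matrix F = F" by (simp add: fun_eq_iff)
  have "sgn_mult wt F unit_matrix u v =
      (\<Sum>i\<in>{..length v} \<times> {..length u}. if i = (length v, length u) then F u v else 0)" for u v
    unfolding sgn_mult_def by (intro sum.cong) (auto simp: block_def unit_matrix_def wt0 split: if_splits)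
  then show "sgn_mult wt F unit_matrix = F" by (simp add: fun_eq_iff)
qed

text \<open>Only the cut that isolates the last letter, respectively the first, gives a nonzero
  block. Its sign is that of the remaining factor because the letter has weight 1.\<close>

lemma sgn_mult_letter:
  assumes "additive_weight wt"
  shows "sgn_mult wt F letter_matrix u v = (if u = [] \<or> v = [] then 0 else
      (- 1) ^ wt (length v - 1, length u - 1) * block (length v - 1) (length u - 1) F letter_matrix u v)"
    and "sgn_mult wt letter_matrix F u v = (if u = [] \<or> v = [] then 0 else
      (- 1) ^ wt (length v - 1, length u - 1) * block 1 1 letter_matrix F u v)"
proof -
  have wt1: "wt (1, 1) = 1" "wt (Suc 0, Suc 0) = 1" using assms unfolding additive_weight_def by simp_all
  \<comment> \<open>Equal remainders have equal lengths, so isolating one letter of one word fixes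
    the cut of the other.\<close>
  have drop_eq: "length u - b = length v - a" if "drop b u = drop a v" for a b
    using arg_cong[OF that, of length] by simp
  have take_eq: "min (length u) b = min (length v) a" if "take b u = take a v" for a b
    using arg_cong[OF that, of length] by (simp add: min.commute)
  have "sgn_mult wt F letter_matrix u v = (\<Sum>i\<in>{..length v} \<times> {..length u}.
      if i = (length v - 1, length u - 1) then (if u = [] \<or> v = [] then 0 else
      (- 1) ^ wt (length v - 1, length u - 1) * block (length v - 1) (length u - 1) F letter_matrix u v) else 0)"
    unfolding sgn_mult_def
    by (intro sum.cong) (auto simp: block_def letter_matrix_def wt1 Suc_leI split: if_splits, (drule drop_eq, arith)+)
  then show "sgn_mult wt F letter_matrix u v = (if u = [] \<or> v = [] then 0 else
      (- 1) ^ wt (length v - 1, length u - 1) * block (length v - 1) (length u - 1) F letter_matrix u v)"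
    by simp
  have "sgn_mult wt letter_matrix F u v = (\<Sum>i\<in>{..length v} \<times> {..length u}.
      if i = (1, 1) then (if u = [] \<or> v = [] then 0 else
      (- 1) ^ wt (length v - 1, length u - 1) * block 1 1 letter_matrix F u v) else 0)"
    unfolding sgn_mult_def
    by (intro sum.cong) (auto simp: block_def letter_matrix_def wt1 split: if_splits, drule take_eq, arith)
  then show "sgn_mult wt letter_matrix F u v = (if u = [] \<or> v = [] then 0 else
      (- 1) ^ wt (length v - 1, length u - 1) * block 1 1 letter_matrix F u v)"
    by (auto simp: Suc_le_eq)
qed

text \<open>Vanishing on long words mirrors the finite number of nonzero components of a cochain.
  Only the product depends on \<open>wt\<close>, so a transposed matrix belongs to the ring for
  either sign rule.\<close>

definition matrix_ring :: "(nat \<times> nat \<Rightarrow> nat) \<Rightarrow> ('i, 'k::field) word_matrix ring" where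
  "matrix_ring wt = \<lparr>carrier = {F. \<exists>N. \<forall>u v. N < length u \<or> N < length v \<longrightarrow> F u v = 0},
     mult = sgn_mult wt, one = unit_matrix, zero = (\<lambda>u v. 0), add = (\<lambda>F G u v. F u v + G u v)\<rparr>"

lemma matrix_ring_simps [simp]:
  "mult (matrix_ring wt) = sgn_mult wt" "one (matrix_ring wt) = unit_matrix"
  "zero (matrix_ring wt) = (\<lambda>u v. 0)" "add (matrix_ring wt) = (\<lambda>F G u v. F u v + G u v)"
  by (simp_all add: matrix_ring_def)

lemma carrier_matrix_ring:
  "F \<in> carrier (matrix_ring wt) \<longleftrightarrow> (\<exists>N. \<forall>u v. N < length u \<or> N < length v \<longrightarrow> F u v = 0)"
  by (simp add: matrix_ring_def)

lemma matrix_ring_closed: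
  assumes F: "F \<in> carrier (matrix_ring wt)" and G: "G \<in> carrier (matrix_ring wt)"
  shows "(\<lambda>u v. F u v + G u v) \<in> carrier (matrix_ring wt)" "sgn_mult wt F G \<in> carrier (matrix_ring wt)"
proof -
  obtain M N where M: "\<And>u v. M < length u \<or> M < length v \<Longrightarrow> F u v = 0"
    and N: "\<And>u v. N < length u \<or> N < length v \<Longrightarrow> G u v = 0"
    using F G unfolding carrier_matrix_ring by blast
  show "(\<lambda>u v. F u v + G u v) \<in> carrier (matrix_ring wt)"
    unfolding carrier_matrix_ring using M N by (intro exI[of _ "max M N"]) auto
  have "block p m F G u v = 0" if "M + N < length u \<or> M + N < length v" "p \<le> length v" "m \<le> length u" for p m u v
  proof (cases "M < length (take m u) \<or> M < length (take p v)")
    case False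
    then have "N < length (drop m u) \<or> N < length (drop p v)" using that by auto
    then show ?thesis unfolding block_def by (simp only: N mult_zero_right)
  qed (simp only: block_def M mult_zero_left)
  then show "sgn_mult wt F G \<in> carrier (matrix_ring wt)"
    unfolding carrier_matrix_ring sgn_mult_def by (intro exI[of _ "M + N"] allI impI sum.neutral) auto
qed

lemma matrix_ring_pointwise:
  "F \<in> carrier (matrix_ring wt) \<Longrightarrow> (\<And>u v. G u v = c u v * F u v) \<Longrightarrow> G \<in> carrier (matrix_ring wt)"
  unfolding carrier_matrix_ring by (metis mult_zero_right)

lemma ring_matrix_ring:
  assumes "additive_weight wt"
  shows "ring (matrix_ring wt :: ('i, 'k::field) word_matrix ring)"
proof (intro ringI abelian_groupI monoidI)
  show "\<exists>G\<in>carrier (matrix_ring wt). G \<oplus>\<^bsub>matrix_ring wt\<^esub> F = \<zero>\<^bsub>matrix_ring wt\<^esub>"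
    if "F \<in> carrier (matrix_ring wt)" for F :: "('i, 'k) word_matrix"
    using matrix_ring_pointwise[OF that, of "\<lambda>u v. - F u v" "\<lambda>u v. - 1"]
    by (intro bexI[of _ "\<lambda>u v. - F u v"]) auto
next
  show "\<one>\<^bsub>matrix_ring wt\<^esub> \<in> carrier (matrix_ring wt :: ('i, 'k) word_matrix ring)"
    by (auto simp: carrier_matrix_ring unit_matrix_def)
  show "\<zero>\<^bsub>matrix_ring wt\<^esub> \<in> carrier (matrix_ring wt :: ('i, 'k) word_matrix ring)"
    by (auto simp: carrier_matrix_ring)
  have dist: "sgn_mult wt (\<lambda>u v. F u v + G u v) H u v = sgn_mult wt F H u v + sgn_mult wt G H u v"
    "sgn_mult wt H (\<lambda>u v. F u v + G u v) u v = sgn_mult wt H F u v + sgn_mult wt H G u v"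
    for F G H :: "('i, 'k) word_matrix" and u v
    unfolding sgn_mult_def sum.distrib[symmetric]
    by (auto intro!: sum.cong simp: block_def distrib_left distrib_right)
  show "(F \<oplus>\<^bsub>matrix_ring wt\<^esub> G) \<otimes>\<^bsub>matrix_ring wt\<^esub> H = F \<otimes>\<^bsub>matrix_ring wt\<^esub> H \<oplus>\<^bsub>matrix_ring wt\<^esub> G \<otimes>\<^bsub>matrix_ring wt\<^esub> H"
    "H \<otimes>\<^bsub>matrix_ring wt\<^esub> (F \<oplus>\<^bsub>matrix_ring wt\<^esub> G) = H \<otimes>\<^bsub>matrix_ring wt\<^esub> F \<oplus>\<^bsub>matrix_ring wt\<^esub> H \<otimes>\<^bsub>matrix_ring wt\<^esub> G"
    for F G H :: "('i, 'k) word_matrix"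
    by (simp_all add: fun_eq_iff dist)
qed (simp_all only: matrix_ring_closed sgn_mult_assoc[OF assms] sgn_mult_unit[OF assms] matrix_ring_simps
    add.assoc add_0, simp only: add.commute)

definition twist :: "(nat \<times> nat \<Rightarrow> nat) \<Rightarrow> ('i, 'k::field) word_matrix \<Rightarrow> ('i, 'k) word_matrix" where
  "twist wt F u v = (- 1) ^ wt (length v, length u) * F u v"

text \<open>The sign \<open>(- 1) ^ wt\<close> is multiplicative along every cut because the weight
  is additive.\<close>

lemma twist_mult:
  assumes "additive_weight wt"
  shows "twist wt (sgn_mult wt F G) = sgn_mult wt (twist wt F) (twist wt G)"
proof (intro ext)
  fix u v :: "'a list"
  have "wt (length v, length u) = wt (p, m) + wt (length v - p, length u - m)"
    if "p \<le> length v" "m \<le> length u" for p m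
    using assms[unfolded additive_weight_def, THEN conjunct1, rule_format, of p "length v - p" m "length u - m"] that
    by simp
  then show "twist wt (sgn_mult wt F G) u v = sgn_mult wt (twist wt F) (twist wt G) u v"
    unfolding twist_def[of _ "sgn_mult wt F G"] sgn_mult_def sum_distrib_left
    by (intro sum.cong) (auto simp: block_def twist_def power_add)
qed

definition matrix_part :: "nat \<times> nat \<Rightarrow> ('i, 'k::field) word_matrix \<Rightarrow> ('i, 'k) word_matrix" where
  "matrix_part i F u v = (if (length v, length u) = i then F u v else 0)"

section \<open>From matrices to cochains\<close>

context based_quadratic begin

definition cochain :: "('i, 'k) word_matrix \<Rightarrow> ('k, 'v) cochain" where
  "cochain F = (\<lambda>(p, m). matrix_map p m F)"

abbreviation C where "C \<equiv> cochain_algebra"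
abbreviation K :: "(nat \<times> nat \<Rightarrow> nat) \<Rightarrow> ('i, 'k) word_matrix ring" where "K \<equiv> matrix_ring"

lemma C_simps [simp]: "mult (C wt) = cup wt" "zero (C wt) = (\<lambda>(p, m). zero_map p)"
  "add (C wt) = (\<lambda>F G (p, m). \<lambda>w\<in>W p. F (p, m) w \<oplus>\<^bsub>A\<^esub> G (p, m) w)"
  "smult (C wt) = (\<lambda>c F (p, m). \<lambda>w\<in>W p. c \<odot>\<^bsub>A\<^esub> F (p, m) w)"
  by (simp_all add: cochain_algebra_def)

lemma cochain_in:
  assumes "F \<in> carrier (K wt')"
  shows "cochain F \<in> carrier (C wt)"
proof -
  obtain N where N: "\<And>u v. N < length u \<or> N < length v \<Longrightarrow> F u v = 0"
    using assms unfolding carrier_matrix_ring by blast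
  have "matrix_map p m F = zero_map p" if "N < p \<or> N < m" for p m
    unfolding matrix_map_zero[of p m, symmetric]
    by (rule matrix_map_cong, rule N) (use that in \<open>auto simp: words_def\<close>)
  then have "{(p, m). cochain F (p, m) \<noteq> zero_map p} \<subseteq> {..N} \<times> {..N}"
    by (auto simp: cochain_def not_less[symmetric])
  then have "finite {(p, m). cochain F (p, m) \<noteq> zero_map p}" by (rule finite_subset) simp
  then show ?thesis by (auto simp: cochain_algebra_def cochain_def matrix_map_Hom)
qed

lemma cochain_surj:
  assumes "X \<in> carrier (C wt)"
  obtains F where "F \<in> carrier (K wt')" "X = cochain F"
proof -
  have X: "X (p, m) \<in> Hom_W p m" "finite {(p, m). X (p, m) \<noteq> zero_map p}" for p m
    using assms by (auto simp: cochain_algebra_def)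
  \<comment> \<open>For a zero component the zero matrix is chosen; otherwise the matrix assembled
    from all components might fail to vanish on long words.\<close>
  have "\<exists>F. X (p, m) = matrix_map p m F \<and> (X (p, m) = zero_map p \<longrightarrow> F = (\<lambda>u v. 0))" for p m
    using Hom_W_matrix[OF X(1)] matrix_map_zero by metis
  then obtain G where G: "\<And>p m. X (p, m) = matrix_map p m (G p m)"
    "\<And>p m. X (p, m) = zero_map p \<Longrightarrow> G p m = (\<lambda>u v. 0)" by metis
  define F where "F u v = G (length v) (length u) u v" for u v
  let ?I = "{(p, m). X (p, m) \<noteq> zero_map p}"
  have "finite (fst ` ?I \<union> snd ` ?I)" using X(2) by simp
  then obtain N where N: "\<forall>x\<in>fst ` ?I \<union> snd ` ?I. x \<le> N"
    unfolding finite_nat_set_iff_bounded_le by blast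
  have "F u v = 0" if "N < length u \<or> N < length v" for u v
  proof -
    have "X (length v, length u) = zero_map (length v)" using N that by force
    then show ?thesis by (simp add: F_def G(2))
  qed
  then have "F \<in> carrier (K wt')" unfolding carrier_matrix_ring by blast
  moreover have "X = cochain F"
    by (auto simp: cochain_def fun_eq_iff F_def G(1) words_def intro!: fun_cong[OF matrix_map_cong])
  ultimately show ?thesis using that by blast
qed

lemma cochain_eq_iff:
  "cochain F = cochain G \<longleftrightarrow> (\<forall>p m. \<forall>c\<in>Wc J S p. \<forall>u\<in>W' m. bilinear J p m F u c = bilinear J p m G u c)"
  by (simp add: cochain_def fun_eq_iff[where f="\<lambda>(p, m). _ p m"] matrix_map_eq_iff)

lemma cochain_cong:
  "(\<And>u v. set u \<subseteq> J \<Longrightarrow> set v \<subseteq> J \<Longrightarrow> F u v = G u v) \<Longrightarrow> cochain F = cochain G"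
  unfolding cochain_def by (intro ext, clarify, rule fun_cong[OF matrix_map_cong]) (auto simp: words_def)

lemma cochain_zero: "cochain (\<lambda>u v. 0) = \<zero>\<^bsub>C wt\<^esub>"
  by (simp add: cochain_def matrix_map_zero)

lemma cochain_add: "cochain F \<oplus>\<^bsub>C wt\<^esub> cochain G = cochain (\<lambda>u v. F u v + G u v)"
  by (auto simp: cochain_def matrix_map_def pr_add distrib_right sum.distrib simp del: A_simps cong: restrict_cong)

lemma cochain_scale: "c \<odot>\<^bsub>C wt\<^esub> cochain F = cochain (\<lambda>u v. c * F u v)"
  by (auto simp: cochain_def matrix_map_def pr_scale sum_distrib_left mult.assoc cong: restrict_cong)

lemma cochain_one: "cochain unit_matrix = \<one>\<^bsub>C wt\<^esub>"
proof -
  have "matrix_map 0 0 unit_matrix w = restrict proj (W 0) w" for w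
  proof (cases "w \<in> W 0")
    case True
    have "pr 0 (\<lambda>u. \<Sum>v\<in>words J 0. unit_matrix u v * coord w v) = pr 0 (coord w)"
      by (rule pr_cong) (simp add: unit_matrix_def)
    then show ?thesis using True tens_coord[OF W_Tp[OF True]] by (simp add: matrix_map_def pr_def)
  qed (simp add: matrix_map_def)
  moreover have "matrix_map p m unit_matrix = zero_map p" if "(p, m) \<noteq> (0, 0)" for p m
    unfolding matrix_map_zero[of p m, symmetric]
    by (rule matrix_map_cong) (use that in \<open>auto simp: unit_matrix_def words_def\<close>)
  ultimately show ?thesis
    by (auto simp: cochain_def cochain_algebra_def fun_eq_iff)
qed

text \<open>In biweight \<open>(r, l)\<close> the words have lengths \<open>r\<close> and
  \<open>l\<close>, so the splittings summed by \<open>cup\<close> and the cuts summed by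
  \<open>sgn_mult\<close> are the same pairs.\<close>

lemma cochain_mult: "cochain F \<otimes>\<^bsub>C wt\<^esub> cochain G = cochain (sgn_mult wt F G)"
proof -
  have "cup wt (cochain F) (cochain G) (r, l) w = matrix_map r l (sgn_mult wt F G) w" for r l w
  proof (cases "w \<in> W r")
    case True
    let ?s = "\<lambda>p m. (- 1) ^ (wt (p, m) * wt (r - p, l - m)) :: 'k"
    have "cup wt (cochain F) (cochain G) (r, l) w = finsum A
        (\<lambda>i. pr l (\<lambda>u. ?s (fst i) (snd i) * (\<Sum>v\<in>words J r. block (fst i) (snd i) F G u v * coord w v))) ({..r} \<times> {..l})"
    proof -
      have "concat_prod p (r - p) (cochain F (p, m)) (cochain G (r - p, l - m)) w =
          pr l (\<lambda>u. \<Sum>v\<in>words J r. block p m F G u v * coord w v)" if "p \<le> r" "m \<le> l" for p m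
        using True that by (simp add: cochain_def concat_prod_matrix) (simp add: matrix_map_def)
      then show ?thesis
        unfolding cup_def prod.case restrict_apply'[OF True]
        by (intro A.finsum_cong') (auto simp: pr_scale simp del: A_simps)
    qed
    also have "\<dots> = pr l (\<lambda>u. \<Sum>i\<in>{..r} \<times> {..l}. ?s (fst i) (snd i) * (\<Sum>v\<in>words J r. block (fst i) (snd i) F G u v * coord w v))"
      by (rule pr_finsum) simp
    also have "\<dots> = pr l (\<lambda>u. \<Sum>v\<in>words J r. sgn_mult wt F G u v * coord w v)"
    proof (rule pr_cong)
      fix u assume u: "u \<in> words J l"
      have "(\<Sum>i\<in>{..r} \<times> {..l}. ?s (fst i) (snd i) * (\<Sum>v\<in>words J r. block (fst i) (snd i) F G u v * coord w v)) =
          (\<Sum>v\<in>words J r. \<Sum>i\<in>{..r} \<times> {..l}. ?s (fst i) (snd i) * block (fst i) (snd i) F G u v * coord w v)"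
        unfolding sum_distrib_left by (subst sum.swap) (simp add: mult.assoc)
      also have "\<dots> = (\<Sum>v\<in>words J r. sgn_mult wt F G u v * coord w v)"
        using u by (intro sum.cong) (auto simp: sgn_mult_def words_def sum_distrib_right case_prod_unfold)
      finally show "(\<Sum>i\<in>{..r} \<times> {..l}. ?s (fst i) (snd i) * (\<Sum>v\<in>words J r. block (fst i) (snd i) F G u v * coord w v)) =
          (\<Sum>v\<in>words J r. sgn_mult wt F G u v * coord w v)" .
    qed
    finally show ?thesis using True by (simp add: matrix_map_def)
  qed (simp add: cup_def matrix_map_def)
  then show ?thesis by (simp add: cochain_def fun_eq_iff)
qed

lemma cochain_hom: "cochain \<in> ring_hom (K wt) (C wt)"
  by (rule ring_hom_memI) (simp_all only: cochain_in cochain_add cochain_mult cochain_one matrix_ring_simps)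

lemma carrier_C: "cochain ` carrier (K wt') = carrier (C wt)"
proof safe
  show "X \<in> cochain ` carrier (K wt')" if "X \<in> carrier (C wt)" for X
    by (rule cochain_surj[OF that, of wt']) blast
qed (rule cochain_in)

lemma ring_C:
  assumes "additive_weight wt"
  shows "ring (C wt)"
proof -
  have "ring (C wt\<lparr>carrier := cochain ` carrier (K wt), zero := cochain \<zero>\<^bsub>K wt\<^esub>\<rparr>)"
    by (rule ring.ring_hom_imp_img_ring[OF ring_matrix_ring[OF assms] cochain_hom])
  then show ?thesis
    by (rule ring_cong) (simp_all add: carrier_C[of wt wt] cochain_zero[of wt, simplified])
qed

text \<open>Defined on the values of a cochain and not on a matrix, since the matrix is not
  determined by the cochain.\<close>

definition C_twist :: "(nat \<times> nat \<Rightarrow> nat) \<Rightarrow> ('k, 'v) cochain \<Rightarrow> ('k, 'v) cochain" where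
  "C_twist wt X = (\<lambda>(p, m). \<lambda>w\<in>W p. (- 1) ^ wt (p, m) \<odot>\<^bsub>A\<^esub> X (p, m) w)"

definition C_part :: "nat \<times> nat \<Rightarrow> ('k, 'v) cochain \<Rightarrow> ('k, 'v) cochain" where
  "C_part i X = (\<lambda>j. if j = i then X i else zero_map (fst j))"

lemma cochain_twist: "C_twist wt (cochain F) = cochain (twist wt F)"
proof -
  have "C_twist wt (cochain F) (p, m) = cochain (twist wt F) (p, m)" for p m
    unfolding C_twist_def cochain_def prod.case matrix_map_def
    by (rule restrict_ext)
       (auto simp: pr_scale twist_def words_def sum_distrib_left mult.assoc intro!: pr_cong sum.cong)
  then show ?thesis by auto
qed

lemma cochain_part: "C_part i (cochain F) = cochain (matrix_part i F)"
proof -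
  have "C_part i (cochain F) (p, m) = cochain (matrix_part i F) (p, m)" for p m
    by (auto simp: C_part_def cochain_def matrix_part_def words_def
        simp flip: matrix_map_zero[of p m] intro!: fun_cong[OF matrix_map_cong] matrix_map_cong)
  then show ?thesis by auto
qed

lemma letter_incl: "incl = matrix_map 1 1 letter_matrix"
proof
  fix w
  show "incl w = matrix_map 1 1 letter_matrix w"
  proof (cases "w \<in> W 1")
    case True
    have "(\<Sum>v\<in>words J 1. letter_matrix u v * coord w v) = coord w u" if "u \<in> words J 1" for u
    proof -
      have "(\<Sum>v\<in>words J 1. letter_matrix u v * coord w v) = (\<Sum>v\<in>words J 1. (if u = v then 1 else 0) * coord w v)"
        using that by (intro sum.cong) (auto simp: letter_matrix_def words_def)
      then show ?thesis using that by simp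
    qed
    then have "pr 1 (\<lambda>u. \<Sum>v\<in>words J 1. letter_matrix u v * coord w v) = pr 1 (coord w)"
      by (rule pr_cong)
    then show ?thesis using True tens_coord[OF W_Tp[OF True]] by (simp add: incl_def matrix_map_def pr_def)
  qed (simp add: incl_def matrix_map_def)
qed

text \<open>In the right product the twist and the sign of the product are both
  \<open>(-1)^wt\<close> and cancel; in the left product the sign remains and is the one in the
  differential.\<close>

lemma differential_cochain:
  assumes wt: "additive_weight wt"
  shows "differential wt (cochain F) =
    cochain (\<lambda>u v. sgn_mult wt (twist wt F) letter_matrix u v - sgn_mult wt letter_matrix F u v)"
    (is "_ = cochain ?D")
proof -
  \<comment> \<open>Matches the default \<open>zero_map\<close> of \<open>differential\<close> where
    one of the weights is zero.\<close>
  have D0: "?D u v = 0" if "u = [] \<or> v = []" for u v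
    using that by (simp add: sgn_mult_letter[OF wt])
  have DS: "?D u v = block p m F letter_matrix u v - (- 1) ^ wt (p, m) * block 1 1 letter_matrix F u v"
    if "length u = Suc m" "length v = Suc p" for u v p m
    using that by (auto simp: sgn_mult_letter[OF wt] block_def twist_def simp flip: power_add mult_2)
  have "differential wt (cochain F) (r, l) = matrix_map r l ?D" for r l
  proof (cases "r = 0 \<or> l = 0")
    case True
    have "matrix_map r l ?D = matrix_map r l (\<lambda>u v. 0)"
      by (rule matrix_map_cong, rule D0) (use True in \<open>auto simp: words_def\<close>)
    then show ?thesis using True by (auto simp: matrix_map_zero differential_def split: nat.split)
  next
    case False
    then obtain p m where rl: "r = Suc p" "l = Suc m" by (metis not0_implies_Suc)
    show ?thesis
    proof
      fix w
      show "differential wt (cochain F) (r, l) w = matrix_map r l ?D w"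
      proof (cases "w \<in> W (Suc p)")
        case True
        have "differential wt (cochain F) (r, l) w =
            matrix_map (p + 1) (m + 1) (block p m F letter_matrix) w \<ominus>\<^bsub>A\<^esub>
            (- 1) ^ wt (p, m) \<odot>\<^bsub>A\<^esub> matrix_map (1 + p) (1 + m) (block 1 1 letter_matrix F) w"
          using True by (simp add: differential_def rl cochain_def letter_incl concat_prod_matrix del: One_nat_def A_simps)
        also have "\<dots> = pr (Suc m) (\<lambda>u. \<Sum>v\<in>words J (Suc p).
            (block p m F letter_matrix u v - (- 1) ^ wt (p, m) * block 1 1 letter_matrix F u v) * coord w v)"
          using True
          by (simp add: matrix_map_def pr_scale pr_minus sum_distrib_left left_diff_distrib sum_subtractf mult.assoc
              del: A_simps)
        also have "\<dots> = matrix_map r l ?D w"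
          using True by (auto simp: matrix_map_def rl DS words_def intro!: pr_cong sum.cong)
        finally show ?thesis .
      qed (simp add: differential_def rl matrix_map_def)
    qed
  qed
  then show ?thesis by (auto simp: cochain_def)
qed

text \<open>The product of matrices is minus the identity on words of length two, hence not zero.
  Its bilinear form is minus the pairing of the relations with their annihilator, so the induced
  cochain is zero.\<close>

lemma cochain_letter_square:
  assumes wt: "additive_weight wt"
  shows "cochain letter_matrix \<otimes>\<^bsub>C wt\<^esub> cochain letter_matrix = \<zero>\<^bsub>C wt\<^esub>"
proof -
  have wt1: "wt (Suc 0, Suc 0) = 1" using wt by (simp add: additive_weight_def)
  have sq: "sgn_mult wt letter_matrix letter_matrix u v = (if u = v \<and> length u = 2 then - 1 else 0)" for u v :: "'i list"
    by (cases u; cases v; cases "tl u"; cases "tl v")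
       (auto simp: sgn_mult_letter[OF wt] block_def letter_matrix_def wt1)
  have "bilinear J p m (sgn_mult wt letter_matrix letter_matrix) u c = 0"
    if c: "c \<in> Wc J S p" and u: "u \<in> W' m" for p m u c
  proof (cases "p = 2 \<and> m = 2")
    case True
    \<comment> \<open>In length two, the window between two empty words is the whole word.\<close>
    have "c \<in> S" "u \<in> annihilator J S" using c u True by (auto simp: Wc_def dest: spec[of _ "[]"])
    then have "pairing J 2 u c = 0" by (simp add: annihilator_def)
    moreover have "bilinear J 2 2 (sgn_mult wt letter_matrix letter_matrix) u c =
        (\<Sum>a\<in>words J 2. \<Sum>b\<in>words J 2. (if a = b then 1 else 0) * (- (u a * c b)))"
      unfolding bilinear_def by (intro sum.cong) (auto simp: sq words_def)
    ultimately show ?thesis using True by (simp add: pairing_def sum_negf)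
  next
    case False
    then show ?thesis unfolding bilinear_def by (intro sum.neutral ballI) (auto simp: sq words_def)
  qed
  then have "cochain (sgn_mult wt letter_matrix letter_matrix) = cochain (\<lambda>u v. 0)"
    unfolding cochain_eq_iff by (simp add: bilinear_def)
  then show ?thesis by (simp only: cochain_mult cochain_zero[of wt])
qed

end

section \<open>Bigraded subquotients\<close>

lemma scalars_simps [simp]: "carrier scalars = UNIV" "mult scalars = (*)" "one scalars = 1" "zero scalars = 0"
    "add scalars = (+)"
  by (simp_all add: scalars_def)

lemma cring_scalars: "cring (scalars :: 'k::field ring)"
proof (rule cringI)
  show "abelian_group (scalars :: 'k ring)"
  proof (rule abelian_groupI)
    show "\<exists>y\<in>carrier scalars. y \<oplus>\<^bsub>scalars\<^esub> x = \<zero>\<^bsub>scalars\<^esub>" for x :: 'k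
      by (rule bexI[of _ "- x"]) simp_all
  qed (simp_all add: add_ac)
  show "Group.comm_monoid (scalars :: 'k ring)"
    by (rule comm_monoidI) (simp_all add: mult_ac)
qed (simp add: distrib_right)

lemma quotient_algebra_simps [simp]: "carrier (quotient_algebra M I) = a_rcosets\<^bsub>M\<^esub> I"
    "mult (quotient_algebra M I) = rcoset_mult M I" "one (quotient_algebra M I) = I +>\<^bsub>M\<^esub> \<one>\<^bsub>M\<^esub>"
    "zero (quotient_algebra M I) = I" "add (quotient_algebra M I) = (<+>\<^bsub>M\<^esub>)"
    "smult (quotient_algebra M I) = (\<lambda>c X. \<Union>x\<in>X. I +>\<^bsub>M\<^esub> (c \<odot>\<^bsub>M\<^esub> x))"
  by (simp_all add: quotient_algebra_def FactRing_def)

lemma coset_update_carrier: "I +>\<^bsub>M\<lparr>carrier := Z\<rparr>\<^esub> x = I +>\<^bsub>M\<^esub> x"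
  by (simp add: a_r_coset_def r_coset_def)

section \<open>Algebras over a field, homogeneous ideals and their quotients\<close>

locale k_algebra = ring M for M :: "('k::field, 'a) module" (structure) +
  assumes smult_closed [simp]: "x \<in> carrier M \<Longrightarrow> c \<odot> x \<in> carrier M"
    and smult_r_distr: "x \<in> carrier M \<Longrightarrow> y \<in> carrier M \<Longrightarrow> c \<odot> (x \<oplus> y) = c \<odot> x \<oplus> c \<odot> y"
    and smult_l_distr: "x \<in> carrier M \<Longrightarrow> (a + b) \<odot> x = a \<odot> x \<oplus> b \<odot> x"
    and smult_assoc: "x \<in> carrier M \<Longrightarrow> (a * b) \<odot> x = a \<odot> (b \<odot> x)"
    and smult_one [simp]: "x \<in> carrier M \<Longrightarrow> 1 \<odot> x = x"
    and smult_mult: "x \<in> carrier M \<Longrightarrow> y \<in> carrier M \<Longrightarrow> (c \<odot> x) \<otimes> y = c \<odot> (x \<otimes> y)"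
      "x \<in> carrier M \<Longrightarrow> y \<in> carrier M \<Longrightarrow> x \<otimes> (c \<odot> y) = c \<odot> (x \<otimes> y)"
begin

lemma module_scalars: "Module.module scalars M"
  by (rule moduleI[OF cring_scalars abelian_group_axioms])
     (auto simp: smult_r_distr smult_l_distr smult_assoc)

end

locale k_ideal = k_algebra M + ideal I M for I and M :: "('k::field, 'a) module" (structure)
begin

abbreviation Q where "Q \<equiv> quotient_algebra M I"

lemma smult_ideal: "x \<in> I \<Longrightarrow> c \<odot> x \<in> I"
  using I_l_closed[of x "c \<odot> \<one>"] smult_mult(1)[of \<one> x c] a_Hcarr[of x] by simp

lemma smult_coset: "x \<in> carrier M \<Longrightarrow> c \<odot>\<^bsub>Q\<^esub> (I +> x) = I +> c \<odot> x"
proof -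
  assume x: "x \<in> carrier M"
  have "I +> c \<odot> y = I +> c \<odot> x" if y: "y \<in> I +> x" for y
  proof -
    obtain i where i: "i \<in> I" "y = i \<oplus> x" using y by (auto simp: a_r_coset_def')
    then have "c \<odot> y \<in> I +> c \<odot> x"
      using x smult_ideal[OF i(1)] by (auto simp: smult_r_distr a_r_coset_def' a_Hcarr)
    then show ?thesis using x by (intro a_repr_independence'[symmetric]) simp_all
  qed
  then have "c \<odot>\<^bsub>Q\<^esub> (I +> x) = (\<Union>y\<in>I +> x. I +> c \<odot> x)"
    unfolding quotient_algebra_simps by (rule SUP_cong[OF refl])
  then show ?thesis using a_rcos_self[OF x] by auto
qed

lemma ring_Q: "ring Q"
  by (rule ring_cong[OF quotient_is_ring]) (simp_all add: FactRing_def)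

lemma coset_hom: "(+>) I \<in> ring_hom M Q"
  using rcos_ring_hom by (simp add: ring_hom_def FactRing_def)

lemma coset_simps:
  assumes "x \<in> carrier M" "y \<in> carrier M"
  shows "(I +> x) \<oplus>\<^bsub>Q\<^esub> (I +> y) = I +> (x \<oplus> y)" "(I +> x) \<otimes>\<^bsub>Q\<^esub> (I +> y) = I +> (x \<otimes> y)"
  using ring_hom_add[OF coset_hom assms] ring_hom_mult[OF coset_hom assms] by simp_all

lemma coset_closed: "x \<in> carrier M \<Longrightarrow> I +> x \<in> carrier Q"
  using ring_hom_closed[OF coset_hom] .

lemma coset_surj: "X \<in> carrier Q \<Longrightarrow> \<exists>x\<in>carrier M. X = I +> x"
  by (auto simp: A_RCOSETS_def')

lemma k_algebra_Q: "k_algebra Q"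
proof (intro k_algebra.intro ring_Q k_algebra_axioms.intro)
  note [simp del] = quotient_algebra_simps
  note simps = smult_coset coset_simps coset_closed smult_r_distr smult_l_distr smult_assoc smult_mult
  fix X assume "X \<in> carrier Q"
  then obtain x where x: "x \<in> carrier M" "X = I +> x" using coset_surj by blast
  then show "c \<odot>\<^bsub>Q\<^esub> X \<in> carrier Q" "(a + b) \<odot>\<^bsub>Q\<^esub> X = a \<odot>\<^bsub>Q\<^esub> X \<oplus>\<^bsub>Q\<^esub> b \<odot>\<^bsub>Q\<^esub> X"
    "(a * b) \<odot>\<^bsub>Q\<^esub> X = a \<odot>\<^bsub>Q\<^esub> (b \<odot>\<^bsub>Q\<^esub> X)" "1 \<odot>\<^bsub>Q\<^esub> X = X" for a b c
    by (simp_all add: simps)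
  fix Y assume "Y \<in> carrier Q"
  then obtain y where y: "y \<in> carrier M" "Y = I +> y" using coset_surj by blast
  then show "c \<odot>\<^bsub>Q\<^esub> (X \<oplus>\<^bsub>Q\<^esub> Y) = c \<odot>\<^bsub>Q\<^esub> X \<oplus>\<^bsub>Q\<^esub> c \<odot>\<^bsub>Q\<^esub> Y"
    "(c \<odot>\<^bsub>Q\<^esub> X) \<otimes>\<^bsub>Q\<^esub> Y = c \<odot>\<^bsub>Q\<^esub> (X \<otimes>\<^bsub>Q\<^esub> Y)" "X \<otimes>\<^bsub>Q\<^esub> (c \<odot>\<^bsub>Q\<^esub> Y) = c \<odot>\<^bsub>Q\<^esub> (X \<otimes>\<^bsub>Q\<^esub> Y)" for c
    using x by (simp_all add: simps)
qed

lemma coset_eq_iff: "x \<in> carrier M \<Longrightarrow> y \<in> carrier M \<Longrightarrow> I +> x = I +> y \<longleftrightarrow> x \<ominus> y \<in> I"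
  using a_rcos_module_minus[OF ring_axioms, of y x] a_rcos_self[of x] a_repr_independence'[of x y] by auto

end

text \<open>The grading is given by its projections: \<open>x\<close> is homogeneous of degree i if
  \<open>part i x = x\<close>, and the ideal is homogeneous if it is stable under all
  projections.\<close>

locale graded_ideal = k_ideal I M for I and M :: "('k::field, 'a) module" (structure) +
  fixes part :: "nat \<times> nat \<Rightarrow> 'a \<Rightarrow> 'a"
  assumes part_closed [simp]: "x \<in> carrier M \<Longrightarrow> part i x \<in> carrier M"
    and part_add: "x \<in> carrier M \<Longrightarrow> y \<in> carrier M \<Longrightarrow> part i (x \<oplus> y) = part i x \<oplus> part i y"
    and part_smult: "x \<in> carrier M \<Longrightarrow> part i (c \<odot> x) = c \<odot> part i x"
    and part_part: "x \<in> carrier M \<Longrightarrow> part i (part j x) = (if i = j then part i x else \<zero>)"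
    and part_finite: "x \<in> carrier M \<Longrightarrow> finite {i. part i x \<noteq> \<zero>}"
    and part_decomp: "x \<in> carrier M \<Longrightarrow> (\<Oplus>i\<in>{i. part i x \<noteq> \<zero>}. part i x) = x"
    and part_one: "part (0, 0) \<one> = \<one>"
    and part_mult: "x \<in> carrier M \<Longrightarrow> y \<in> carrier M \<Longrightarrow> part (p, m) x = x \<Longrightarrow> part (q, n) y = y \<Longrightarrow>
      part (p + q, m + n) (x \<otimes> y) = x \<otimes> y"
    and part_ideal: "x \<in> I \<Longrightarrow> part i x \<in> I"
begin

definition G where "G i = (+>) I ` {x \<in> carrier M. part i x = x}"

lemma G_memI: "x \<in> carrier M \<Longrightarrow> part i x = x \<Longrightarrow> I +> x \<in> G i"
  unfolding G_def by blast

lemma G_rep: "X \<in> G i \<Longrightarrow> \<exists>x. x \<in> carrier M \<and> part i x = x \<and> X = I +> x"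
  unfolding G_def by blast

lemma part_zero: "part i \<zero> = \<zero>"
  using part_add[of \<zero> \<zero> i] add.l_cancel_one'[of "part i \<zero>" "part i \<zero>"] by simp

lemma part_finsum:
  assumes "finite N" "\<And>i. i \<in> N \<Longrightarrow> y i \<in> carrier M \<and> part i (y i) = y i"
  shows "part j (\<Oplus>i\<in>N. y i) = (if j \<in> N then y j else \<zero>)"
  using assms
proof (induction N rule: finite_induct)
  case (insert i N)
  have y: "y i \<in> carrier M" "part i (y i) = y i" "y \<in> N \<rightarrow> carrier M" using insert.prems by auto
  have "part j (y i) = (if j = i then y i else \<zero>)"
    using part_part[OF y(1), of j i] y by auto
  then show ?case
    using insert y insert.prems[of j] by (auto simp: part_add finsum_insert[OF insert.hyps y(3,1)])
qed (simp add: part_zero)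

lemma coset_finsum:
  "finite N \<Longrightarrow> (\<And>i. i \<in> N \<Longrightarrow> y i \<in> carrier M) \<Longrightarrow> I +> (\<Oplus>i\<in>N. y i) = (\<Oplus>\<^bsub>Q\<^esub>i\<in>N. I +> y i)"
proof (induction N rule: finite_induct)
  interpret Q: ring Q by (rule ring_Q)
  note [simp del] = quotient_algebra_simps
  {
    case empty
    then show ?case using ring_hom_zero[OF coset_hom ring_axioms ring_Q] by simp
  next
    case (insert i N)
    then have y: "y i \<in> carrier M" "y \<in> N \<rightarrow> carrier M" "(\<lambda>i. I +> y i) \<in> N \<rightarrow> carrier Q"
      by (auto simp: coset_closed)
    then show ?case
      using insert by (simp add: coset_simps[symmetric] coset_closed finsum_closed)
  }
qed

text \<open>Homogeneous representatives of the \<open>f i\<close> have a sum that differs from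
  \<open>z\<close> by an element of \<open>I\<close>. Applying \<open>part j\<close> keeps the
  difference in \<open>I\<close> and isolates the representative of \<open>f j\<close>.\<close>

lemma decomposition_unique:
  assumes z: "z \<in> carrier M" and f: "\<And>i. f i \<in> G i" and fin: "finite {i. f i \<noteq> \<zero>\<^bsub>Q\<^esub>}"
    and eq: "I +> z = (\<Oplus>\<^bsub>Q\<^esub>i\<in>{i. f i \<noteq> \<zero>\<^bsub>Q\<^esub>}. f i)"
  shows "f j = I +> part j z"
proof -
  note [simp del] = quotient_algebra_simps
  have "\<forall>i. \<exists>y. y \<in> carrier M \<and> part i y = y \<and> f i = I +> y" using G_rep[OF f] by blast
  then obtain y where y: "\<And>i. y i \<in> carrier M" "\<And>i. part i (y i) = y i" "\<And>i. f i = I +> y i" by metis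
  let ?N = "{i. f i \<noteq> \<zero>\<^bsub>Q\<^esub>}"
  let ?s = "\<Oplus>i\<in>?N. y i"
  have s: "?s \<in> carrier M" using y by (intro finsum_closed) auto
  have "I +> z = I +> ?s"
    unfolding eq coset_finsum[OF fin y(1)] by (simp only: y(3)[symmetric])
  then have "z \<ominus> ?s \<in> I" using z s by (simp add: coset_eq_iff)
  then have i: "part j (z \<ominus> ?s) \<in> I" by (rule part_ideal)
  have "z = (z \<ominus> ?s) \<oplus> ?s" using z s by (simp add: a_minus_def a_assoc l_neg)
  then have "part j z = part j (z \<ominus> ?s) \<oplus> part j ?s" using z s part_add[of "z \<ominus> ?s" ?s j] by simp
  moreover have "I +> part j (z \<ominus> ?s) = \<zero>\<^bsub>Q\<^esub>"
    using i z s by (simp add: quotient_algebra_simps a_rcos_const)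
  ultimately have "I +> part j z = I +> part j ?s"
    using z s coset_simps(1)[of "part j (z \<ominus> ?s)" "part j ?s"] ring.ring_simprules(8)[OF ring_Q coset_closed[of "part j ?s"]]
    by simp
  also have "\<dots> = f j"
  proof (cases "j \<in> ?N")
    case False
    then show ?thesis using part_finsum[OF fin, of y j] y ring_hom_zero[OF coset_hom ring_axioms ring_Q] by simp
  qed (use part_finsum[OF fin, of y j] y in simp)
  finally show ?thesis by simp
qed

theorem bigraded_quotient: "bigraded_algebra Q G"
proof -
  note [simp del] = quotient_algebra_simps
  interpret Q: k_algebra Q by (rule k_algebra_Q)
  have zero: "I +> \<zero> = \<zero>\<^bsub>Q\<^esub>" using ring_hom_zero[OF coset_hom ring_axioms ring_Q] .
  have sub: "submodule (G i) scalars Q" for i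
  proof (rule module.submoduleI[OF Q.module_scalars])
    show "G i \<subseteq> carrier Q" by (auto simp: G_def coset_closed)
    show "\<zero>\<^bsub>Q\<^esub> \<in> G i" unfolding G_def zero[symmetric] using part_zero by blast
    have smult: "c \<odot>\<^bsub>Q\<^esub> X \<in> G i" if X: "X \<in> G i" for c X
    proof -
      obtain x where "x \<in> carrier M" "part i x = x" "X = I +> x" using G_rep[OF X] by blast
      then show ?thesis using part_smult[of x i c] smult_coset[of x c] G_memI[of "c \<odot> x" i] by simp
    qed
    show "c \<odot>\<^bsub>Q\<^esub> X \<in> G i" if "X \<in> G i" for c X using smult[OF that] .
    show "\<ominus>\<^bsub>Q\<^esub> X \<in> G i" if X: "X \<in> G i" for X
    proof -
      have Xc: "X \<in> carrier Q" using X by (auto simp: G_def coset_closed)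
      have "(- 1) \<odot>\<^bsub>Q\<^esub> X \<oplus>\<^bsub>Q\<^esub> X = \<zero>\<^bsub>Q\<^esub>"
        using Q.smult_l_distr[OF Xc, of "- 1" 1] module.smult_l_null[OF Q.module_scalars Xc] Q.smult_one[OF Xc] by simp
      then have "\<ominus>\<^bsub>Q\<^esub> X = (- 1) \<odot>\<^bsub>Q\<^esub> X" using Xc by (intro Q.minus_equality) auto
      then show ?thesis using smult[OF X] by simp
    qed
    show "X \<oplus>\<^bsub>Q\<^esub> Y \<in> G i" if "X \<in> G i" "Y \<in> G i" for X Y
    proof -
      obtain x y where "x \<in> carrier M" "part i x = x" "X = I +> x" "y \<in> carrier M" "part i y = y" "Y = I +> y"
        using G_rep[OF \<open>X \<in> G i\<close>] G_rep[OF \<open>Y \<in> G i\<close>] by blast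
      then show ?thesis using part_add[of x y i] coset_simps(1)[of x y] G_memI[of "x \<oplus> y" i] by simp
    qed
  qed
  have dec: "\<exists>!f. (\<forall>i. f i \<in> G i) \<and> finite {i. f i \<noteq> \<zero>\<^bsub>Q\<^esub>} \<and> X = (\<Oplus>\<^bsub>Q\<^esub>i\<in>{i. f i \<noteq> \<zero>\<^bsub>Q\<^esub>}. f i)"
    if X: "X \<in> carrier Q" for X
  proof -
    obtain z where z: "z \<in> carrier M" "X = I +> z" using coset_surj[OF X] by blast
    let ?f = "\<lambda>i. I +> part i z"
    \<comment> \<open>A nonzero part of \<open>z\<close> may lie in \<open>I\<close>, so fewer
      indices can remain in the quotient; the summands lost are zero there.\<close>
    have sub: "{i. ?f i \<noteq> \<zero>\<^bsub>Q\<^esub>} \<subseteq> {i. part i z \<noteq> \<zero>}"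
      using zero by (intro Collect_mono impI notI) simp
    have "X = (\<Oplus>\<^bsub>Q\<^esub>i\<in>{i. part i z \<noteq> \<zero>}. ?f i)"
      using coset_finsum[OF part_finite[OF z(1)] part_closed[OF z(1)], of "\<lambda>i. i"] unfolding part_decomp[OF z(1)] z(2) .
    also have "\<dots> = (\<Oplus>\<^bsub>Q\<^esub>i\<in>{i. ?f i \<noteq> \<zero>\<^bsub>Q\<^esub>}. ?f i)"
      using sub part_finite[OF z(1)] coset_closed z(1)
      by (intro Q.add.finprod_mono_neutral_cong_right) auto
    finally have "(\<forall>i. ?f i \<in> G i) \<and> finite {i. ?f i \<noteq> \<zero>\<^bsub>Q\<^esub>} \<and> X = (\<Oplus>\<^bsub>Q\<^esub>i\<in>{i. ?f i \<noteq> \<zero>\<^bsub>Q\<^esub>}. ?f i)"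
      using finite_subset[OF sub part_finite[OF z(1)]] z(1)
      by (simp add: G_memI part_part)
    moreover have "f = ?f" if "(\<forall>i. f i \<in> G i) \<and> finite {i. f i \<noteq> \<zero>\<^bsub>Q\<^esub>} \<and> X = (\<Oplus>\<^bsub>Q\<^esub>i\<in>{i. f i \<noteq> \<zero>\<^bsub>Q\<^esub>}. f i)" for f
      using that decomposition_unique[OF z(1), of f] z(2) by auto
    ultimately show ?thesis by (rule ex1I)
  qed
  have one: "\<one>\<^bsub>Q\<^esub> \<in> G (0, 0)"
    using G_memI[OF one_closed part_one] by (simp add: quotient_algebra_simps)
  have mult: "X \<otimes>\<^bsub>Q\<^esub> Y \<in> G (p + q, m + n)" if X: "X \<in> G (p, m)" and Y: "Y \<in> G (q, n)" for p q m n X Y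
  proof -
    obtain x y where "x \<in> carrier M" "part (p, m) x = x" "X = I +> x" "y \<in> carrier M" "part (q, n) y = y" "Y = I +> y"
      using G_rep[OF X] G_rep[OF Y] by blast
    then show ?thesis using part_mult[of x y p m q n] coset_simps(2)[of x y] G_memI[of "x \<otimes> y"] by simp
  qed
  show ?thesis
    unfolding bigraded_algebra_def
    by (intro conjI allI ballI)
       (rule ring_Q Q.module_scalars sub one Q.smult_mult dec mult; assumption)+
qed

end

text \<open>In the Koszul calculus \<open>e\<close> is the canonical map \<open>V \<rightarrow> A\<close> and \<open>\<tau>\<close> is multiplication by
  \<open>(-1)\<^bsup>wt(p, m)\<^esup>\<close>. That \<open>e\<close> squares to zero is the vanishing of the relations \<open>W 2 = R\<close> in \<open>A\<close>.\<close>

locale twisted_commutator = k_algebra C for C :: "('k::field, 'a) module" (structure) +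
  fixes d \<tau> :: "'a \<Rightarrow> 'a" and e :: 'a and part :: "nat \<times> nat \<Rightarrow> 'a \<Rightarrow> 'a"
  assumes e_closed [simp]: "e \<in> carrier C"
    and tw_closed [simp]: "x \<in> carrier C \<Longrightarrow> \<tau> x \<in> carrier C"
    and tw_add: "x \<in> carrier C \<Longrightarrow> y \<in> carrier C \<Longrightarrow> \<tau> (x \<oplus> y) = \<tau> x \<oplus> \<tau> y"
    and tw_smult: "x \<in> carrier C \<Longrightarrow> \<tau> (c \<odot> x) = c \<odot> \<tau> x"
    and tw_mult: "x \<in> carrier C \<Longrightarrow> y \<in> carrier C \<Longrightarrow> \<tau> (x \<otimes> y) = \<tau> x \<otimes> \<tau> y"
    and tw_tw: "x \<in> carrier C \<Longrightarrow> \<tau> (\<tau> x) = x"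
    and tw_one: "\<tau> \<one> = \<one>"
    and tw_e: "\<tau> e = \<ominus> e"
    and e_e: "e \<otimes> e = \<zero>"
    and d_eq: "x \<in> carrier C \<Longrightarrow> d x = \<tau> x \<otimes> e \<ominus> e \<otimes> x"
    and part_closed [simp]: "x \<in> carrier C \<Longrightarrow> part i x \<in> carrier C"
    and part_add: "x \<in> carrier C \<Longrightarrow> y \<in> carrier C \<Longrightarrow> part i (x \<oplus> y) = part i x \<oplus> part i y"
    and part_smult: "x \<in> carrier C \<Longrightarrow> part i (c \<odot> x) = c \<odot> part i x"
    and part_part: "x \<in> carrier C \<Longrightarrow> part i (part j x) = (if i = j then part i x else \<zero>)"
    and part_finite: "x \<in> carrier C \<Longrightarrow> finite {i. part i x \<noteq> \<zero>}"
    and part_decomp: "x \<in> carrier C \<Longrightarrow> (\<Oplus>i\<in>{i. part i x \<noteq> \<zero>}. part i x) = x"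
    and part_one: "part (0, 0) \<one> = \<one>"
    and part_mult: "x \<in> carrier C \<Longrightarrow> y \<in> carrier C \<Longrightarrow> part (p, m) x = x \<Longrightarrow> part (q, n) y = y \<Longrightarrow>
      part (p + q, m + n) (x \<otimes> y) = x \<otimes> y"
    and part_d: "x \<in> carrier C \<Longrightarrow> part (Suc p, Suc m) (d x) = d (part (p, m) x)"
    and part_d_zero: "x \<in> carrier C \<Longrightarrow> p = 0 \<or> m = 0 \<Longrightarrow> part (p, m) (d x) = \<zero>"
begin

section \<open>Cocycles and coboundaries of a twisted commutator\<close>

definition Z where "Z = {x \<in> carrier C. d x = \<zero>}"
definition B where "B = d ` carrier C"

lemma d_closed [simp]: "x \<in> carrier C \<Longrightarrow> d x \<in> carrier C"
  by (simp add: d_eq)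

lemma d_add: "x \<in> carrier C \<Longrightarrow> y \<in> carrier C \<Longrightarrow> d (x \<oplus> y) = d x \<oplus> d y"
  by (simp add: d_eq tw_add l_distr r_distr a_minus_def minus_add a_ac)

lemma smult_minus: "x \<in> carrier C \<Longrightarrow> c \<odot> (\<ominus> x) = \<ominus> (c \<odot> x)"
  using module.smult_r_minus[OF module_scalars, of c x] by simp

lemma d_smult: "x \<in> carrier C \<Longrightarrow> d (c \<odot> x) = c \<odot> d x"
  by (simp add: d_eq tw_smult smult_mult a_minus_def smult_r_distr smult_minus)

lemma d_zero: "d \<zero> = \<zero>"
  using d_add[of \<zero> \<zero>] add.l_cancel_one'[of "d \<zero>" "d \<zero>"] by simp

lemma minus_smult: "x \<in> carrier C \<Longrightarrow> \<ominus> x = (- 1) \<odot> x"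
  using module.smult_l_minus[OF module_scalars, of 1 x] cring_scalars
  by (intro minus_equality) (use smult_l_distr[of x "- 1" 1] module.smult_l_null[OF module_scalars] in auto)

lemma tw_minus: "x \<in> carrier C \<Longrightarrow> \<tau> (\<ominus> x) = \<ominus> \<tau> x"
  by (simp add: minus_smult tw_smult)

text \<open>The twisted Leibniz rule: the two terms with \<open>e\<close> between
  \<open>\<tau> x\<close> and \<open>y\<close> cancel.\<close>

lemma d_mult:
  assumes "x \<in> carrier C" "y \<in> carrier C"
  shows "d (x \<otimes> y) = \<tau> x \<otimes> d y \<oplus> d x \<otimes> y"
proof -
  have "\<tau> x \<otimes> d y \<oplus> d x \<otimes> y =
      \<tau> x \<otimes> \<tau> y \<otimes> e \<oplus> (\<ominus> (\<tau> x \<otimes> e \<otimes> y) \<oplus> \<tau> x \<otimes> e \<otimes> y) \<oplus> \<ominus> (e \<otimes> (x \<otimes> y))"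
    using assms by (simp add: d_eq a_minus_def l_distr r_distr l_minus r_minus m_assoc a_assoc)
  then show ?thesis using assms by (simp add: d_eq a_minus_def tw_mult l_neg)
qed

lemma e_e_left: "x \<in> carrier C \<Longrightarrow> e \<otimes> (e \<otimes> x) = \<zero>"
  by (simp add: e_e flip: m_assoc)

text \<open>The two terms with \<open>e\<close> on both sides of \<open>\<tau> x\<close> cancel
  because \<open>\<tau> e = \<ominus> e\<close>; the others contain
  \<open>e \<otimes> e\<close>.\<close>

lemma d_d: "x \<in> carrier C \<Longrightarrow> d (d x) = \<zero>"
  by (simp add: d_eq a_minus_def tw_add tw_minus tw_mult tw_tw tw_e l_distr r_distr l_minus r_minus m_assoc
      e_e e_e_left l_neg r_neg)

text \<open>The twist anticommutes with \<open>d\<close>. The stability of cocycles under \<tau> is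
  needed because the Leibniz rule twists the left factor.\<close>

lemma tw_Z: "x \<in> Z \<Longrightarrow> \<tau> x \<in> Z"
proof -
  assume x: "x \<in> Z"
  then have xC: "x \<in> carrier C" by (simp add: Z_def)
  have "d (\<tau> x) = \<ominus> \<tau> (d x)"
    using xC by (simp add: d_eq a_minus_def tw_add tw_minus tw_mult tw_tw tw_e minus_add l_minus r_minus a_comm)
  moreover have "\<tau> (d x) = \<zero>" using x tw_smult[of \<zero> 0] module.smult_l_null[OF module_scalars]
    by (simp add: Z_def)
  ultimately show ?thesis using xC by (simp add: Z_def)
qed

lemma subring_Z: "subring Z C"
proof (rule subringI)
  show "\<one> \<in> Z" by (simp add: Z_def d_eq tw_one a_minus_def r_neg)
  show "\<ominus> x \<in> Z" if "x \<in> Z" for x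
    using that module.smult_r_null[OF module_scalars] by (auto simp: Z_def minus_smult d_smult)
qed (auto simp: Z_def d_mult d_add)

abbreviation ZC where "ZC \<equiv> C\<lparr>carrier := Z\<rparr>"

lemma Z_carrier: "x \<in> Z \<Longrightarrow> x \<in> carrier C" by (simp add: Z_def)

lemma k_algebra_Z: "k_algebra ZC"
  by (intro k_algebra.intro subring_is_ring[OF subring_Z] k_algebra_axioms.intro)
     (use module.smult_r_null[OF module_scalars] in
       \<open>auto simp: Z_def d_smult smult_r_distr smult_l_distr smult_assoc smult_mult\<close>)

lemma B_Z: "x \<in> B \<Longrightarrow> x \<in> Z"
  by (auto simp: B_def Z_def d_d)

lemma minus_ZC: "x \<in> Z \<Longrightarrow> \<ominus>\<^bsub>ZC\<^esub> x = \<ominus> x"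
  using subringE(5)[OF subring_Z] Z_carrier
  by (intro abelian_group.minus_equality[OF ring.is_abelian_group[OF subring_is_ring[OF subring_Z]]]) (auto simp: l_neg)

lemma ideal_B: "ideal B ZC"
proof (rule idealI[OF subring_is_ring[OF subring_Z]])
  show "subgroup B (add_monoid ZC)"
  proof (rule subgroup.intro)
    show "inv\<^bsub>add_monoid ZC\<^esub> x \<in> B" if "x \<in> B" for x
      unfolding a_inv_def[of ZC, symmetric] minus_ZC[OF B_Z[OF that]]
      using that by (auto simp: B_def minus_smult simp flip: d_smult)
    show "\<one>\<^bsub>add_monoid ZC\<^esub> \<in> B"
      using d_zero by (auto simp: B_def intro: image_eqI[of _ _ \<zero>])
    show "B \<subseteq> carrier (add_monoid ZC)" using B_Z by auto
    show "x \<otimes>\<^bsub>add_monoid ZC\<^esub> y \<in> B" if "x \<in> B" "y \<in> B" for x y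
      using that by (auto simp: B_def simp flip: d_add)
  qed
next
  fix b z assume b: "b \<in> B" and z: "z \<in> carrier ZC"
  then obtain y where y: "y \<in> carrier C" "b = d y" by (auto simp: B_def)
  have zC: "z \<in> carrier C" "d z = \<zero>" "d (\<tau> z) = \<zero>" using z tw_Z[of z] by (auto simp: Z_def)
  \<comment> \<open>The cocycle is twisted beforehand, so that the twist in the Leibniz rule
    restores \<open>z\<close>.\<close>
  have "z \<otimes> d y = d (\<tau> z \<otimes> y)" using zC y by (simp add: d_mult tw_tw)
  then show "z \<otimes>\<^bsub>ZC\<^esub> b \<in> B" using y zC by (simp add: B_def)
  have "d y \<otimes> z = d (y \<otimes> z)" using zC y by (simp add: d_mult)
  then show "b \<otimes>\<^bsub>ZC\<^esub> z \<in> B" using y zC by (simp add: B_def)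
qed

lemma part_Z: "x \<in> Z \<Longrightarrow> part i x \<in> Z"
proof -
  assume x: "x \<in> Z"
  obtain p m where i: "i = (p, m)" by (cases i)
  have "part (Suc p, Suc m) \<zero> = \<zero>"
    using part_add[of \<zero> \<zero>] add.l_cancel_one'[of "part (Suc p, Suc m) \<zero>" "part (Suc p, Suc m) \<zero>"] by simp
  then have "d (part i x) = \<zero>" using x part_d[of x p m] by (simp add: i Z_def)
  then show ?thesis using x by (simp add: Z_def)
qed

lemma part_B: "x \<in> B \<Longrightarrow> part i x \<in> B"
proof -
  assume "x \<in> B"
  then obtain y where y: "y \<in> carrier C" "x = d y" by (auto simp: B_def)
  obtain p m where i: "i = (p, m)" by (cases i)
  show ?thesis
  proof (cases "p = 0 \<or> m = 0")
    case True
    \<comment> \<open>Both weights of a coboundary are positive, so this part is zero, which is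
      itself a coboundary.\<close>
    then have "part i x = d \<zero>" using part_d_zero[OF y(1)] by (simp add: i y(2) d_zero)
    then show ?thesis by (simp add: B_def)
  next
    case False
    then obtain p' m' where "p = Suc p'" "m = Suc m'" by (metis not0_implies_Suc)
    then have "part i x = d (part (p', m') y)" using part_d[OF y(1)] by (simp add: i y(2))
    then show ?thesis using y by (simp add: B_def)
  qed
qed

lemma finsum_Z:
  "finite N \<Longrightarrow> (\<And>i. i \<in> N \<Longrightarrow> f i \<in> Z) \<Longrightarrow> finsum ZC f N = finsum C f N"
proof (induction N rule: finite_induct)
  interpret ZC: ring ZC by (rule subring_is_ring[OF subring_Z])
  {
    case empty
    show ?case by simp
  next
    case (insert i N)
    then have "f \<in> N \<rightarrow> carrier C" "f \<in> N \<rightarrow> carrier ZC" "f i \<in> carrier C" "f i \<in> carrier ZC"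
      using Z_carrier by auto
    then show ?case using insert by (simp add: finsum_insert[of N i f] ZC.finsum_insert[of N i f])
  }
qed

sublocale H: graded_ideal B ZC part
proof (intro graded_ideal.intro k_ideal.intro k_algebra_Z ideal_B graded_ideal_axioms.intro)
  fix x assume x: "x \<in> carrier ZC"
  have "finsum ZC (\<lambda>i. part i x) {i. part i x \<noteq> \<zero>} = finsum C (\<lambda>i. part i x) {i. part i x \<noteq> \<zero>}"
    using x part_Z Z_carrier by (intro finsum_Z part_finite) auto
  then show "finsum ZC (\<lambda>i. part i x) {i. part i x \<noteq> \<zero>\<^bsub>ZC\<^esub>} = x"
    using x part_decomp[of x] Z_carrier by simp
qed (use part_Z part_B part_add part_smult part_part part_finite part_one part_mult Z_carrier in auto)

end

text \<open>Elements of the quotient are cosets as sets, so the induced map is the image map and no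
  representatives need be chosen.\<close>

lemma quotient_algebra_iso:
  fixes M :: "('k::field, 'a) module" and N :: "('k, 'b) module"
  assumes "k_ideal I M" "k_ideal L N"
    and bij: "bij_betw \<phi> (carrier M) (carrier N)"
    and add: "\<And>x y. x \<in> carrier M \<Longrightarrow> y \<in> carrier M \<Longrightarrow> \<phi> (x \<oplus>\<^bsub>M\<^esub> y) = \<phi> x \<oplus>\<^bsub>N\<^esub> \<phi> y"
    and mult: "\<And>x y. x \<in> carrier M \<Longrightarrow> y \<in> carrier M \<Longrightarrow> \<phi> (x \<otimes>\<^bsub>M\<^esub> y) = \<phi> x \<otimes>\<^bsub>N\<^esub> \<phi> y"
    and one: "\<phi> \<one>\<^bsub>M\<^esub> = \<one>\<^bsub>N\<^esub>"
    and smult: "\<And>c x. x \<in> carrier M \<Longrightarrow> \<phi> (c \<odot>\<^bsub>M\<^esub> x) = c \<odot>\<^bsub>N\<^esub> \<phi> x"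
    and ideal: "\<phi> ` I = L"
  shows "(`) \<phi> \<in> ring_iso (quotient_algebra M I) (quotient_algebra N L)"
    and "\<And>x. x \<in> carrier M \<Longrightarrow> \<phi> ` (I +>\<^bsub>M\<^esub> x) = L +>\<^bsub>N\<^esub> \<phi> x"
    and "\<And>c X. X \<in> carrier (quotient_algebra M I) \<Longrightarrow>
      \<phi> ` (c \<odot>\<^bsub>quotient_algebra M I\<^esub> X) = c \<odot>\<^bsub>quotient_algebra N L\<^esub> (\<phi> ` X)"
proof -
  note [simp del] = quotient_algebra_simps
  interpret M: k_ideal I M by fact
  interpret N: k_ideal L N by fact
  have \<phi>: "\<phi> x \<in> carrier N" if "x \<in> carrier M" for x using bij that by (auto simp: bij_betw_def)
  show coset: "\<phi> ` (I +>\<^bsub>M\<^esub> x) = L +>\<^bsub>N\<^esub> \<phi> x" if "x \<in> carrier M" for x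
    using that M.a_subset by (auto simp: a_r_coset_def' add ideal[symmetric] image_iff)
  show smult': "\<phi> ` (c \<odot>\<^bsub>M.Q\<^esub> X) = c \<odot>\<^bsub>N.Q\<^esub> (\<phi> ` X)" if X: "X \<in> carrier M.Q" for c X
  proof -
    obtain x where x: "x \<in> carrier M" "X = I +>\<^bsub>M\<^esub> x" using M.coset_surj[OF X] by blast
    then show ?thesis by (simp add: M.smult_coset N.smult_coset coset \<phi> smult)
  qed
  have hom: "(`) \<phi> \<in> ring_hom M.Q N.Q"
  proof (rule ring_hom_memI)
    fix X assume "X \<in> carrier M.Q"
    then obtain x where x: "x \<in> carrier M" "X = I +>\<^bsub>M\<^esub> x" using M.coset_surj by blast
    then show "\<phi> ` X \<in> carrier N.Q" by (simp add: coset N.coset_closed \<phi>)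
    fix Y assume "Y \<in> carrier M.Q"
    then obtain y where y: "y \<in> carrier M" "Y = I +>\<^bsub>M\<^esub> y" using M.coset_surj by blast
    show "\<phi> ` (X \<otimes>\<^bsub>M.Q\<^esub> Y) = \<phi> ` X \<otimes>\<^bsub>N.Q\<^esub> \<phi> ` Y" "\<phi> ` (X \<oplus>\<^bsub>M.Q\<^esub> Y) = \<phi> ` X \<oplus>\<^bsub>N.Q\<^esub> \<phi> ` Y"
      using x y by (simp_all add: M.coset_simps N.coset_simps coset \<phi> add mult)
  next
    show "\<phi> ` \<one>\<^bsub>M.Q\<^esub> = \<one>\<^bsub>N.Q\<^esub>" by (simp add: quotient_algebra_simps coset one)
  qed
  have "inj_on ((`) \<phi>) (carrier M.Q)"
  proof (rule inj_onI)
    fix X Y assume XY: "X \<in> carrier M.Q" "Y \<in> carrier M.Q" "\<phi> ` X = \<phi> ` Y"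
    have "X \<subseteq> carrier M" "Y \<subseteq> carrier M"
      using XY M.coset_surj M.a_r_coset_subset_G[OF M.a_subset] by blast+
    then show "X = Y" using XY(3) bij by (auto simp: bij_betw_def inj_on_image_eq_iff)
  qed
  moreover have "(`) \<phi> ` carrier M.Q = carrier N.Q"
  proof safe
    show "\<phi> ` X \<in> carrier N.Q" if "X \<in> carrier M.Q" for X using ring_hom_closed[OF hom that] .
    fix Y assume "Y \<in> carrier N.Q"
    then obtain y where y: "y \<in> carrier N" "Y = L +>\<^bsub>N\<^esub> y" using N.coset_surj by blast
    then obtain x where "x \<in> carrier M" "y = \<phi> x" using bij by (auto simp: bij_betw_def)
    then show "Y \<in> (`) \<phi> ` carrier M.Q" using y coset M.coset_closed by (metis imageI)
  qed
  ultimately show "(`) \<phi> \<in> ring_iso M.Q N.Q"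
    using hom by (simp add: ring_iso_def bij_betw_def)
qed

text \<open>Composing a family of components with the exchange of indices matches the decompositions
  for the two gradings. This supplies the inverse biweight.\<close>

lemma bigraded_algebra_swap:
  assumes "bigraded_algebra M G"
  shows "bigraded_algebra M (\<lambda>(a, b). G (b, a))"
proof -
  note M = assms[unfolded bigraded_algebra_def]
  interpret M: ring M using M by blast
  have "\<exists>!f. (\<forall>i. f i \<in> G (prod.swap i)) \<and> finite {i. f i \<noteq> \<zero>\<^bsub>M\<^esub>} \<and> x = (\<Oplus>\<^bsub>M\<^esub>i\<in>{i. f i \<noteq> \<zero>\<^bsub>M\<^esub>}. f i)"
    if x: "x \<in> carrier M" for x
  proof -
    let ?P = "\<lambda>G f. (\<forall>i. f i \<in> G i) \<and> finite {i. f i \<noteq> \<zero>\<^bsub>M\<^esub>} \<and> x = (\<Oplus>\<^bsub>M\<^esub>i\<in>{i. f i \<noteq> \<zero>\<^bsub>M\<^esub>}. f i)"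
    have swap: "?P (G \<circ> prod.swap) (f \<circ> prod.swap)" if f: "?P G f" and G: "\<And>i. G i \<subseteq> carrier M" for G and f :: "nat \<times> nat \<Rightarrow> 'a"
    proof -
      have eq: "{i. (f \<circ> prod.swap) i \<noteq> \<zero>\<^bsub>M\<^esub>} = prod.swap ` {i. f i \<noteq> \<zero>\<^bsub>M\<^esub>}" by (auto simp: image_iff)
      have "(\<Oplus>\<^bsub>M\<^esub>i\<in>prod.swap ` {i. f i \<noteq> \<zero>\<^bsub>M\<^esub>}. (f \<circ> prod.swap) i) = (\<Oplus>\<^bsub>M\<^esub>i\<in>{i. f i \<noteq> \<zero>\<^bsub>M\<^esub>}. (f \<circ> prod.swap) (prod.swap i))"
        using f G by (intro M.add.finprod_reindex) (auto, blast)
      then show ?thesis unfolding eq using f by simp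
    qed
    have Gc: "G i \<subseteq> carrier M" for i
    proof -
      have "submodule (G i) scalars M" using M by blast
      from subgroup.subset[OF submodule.axioms(1)[OF this]] show ?thesis by simp
    qed
    have "\<exists>!f. ?P G f" using M x by blast
    then obtain f where f: "?P G f" and uniq: "\<And>g. ?P G g \<Longrightarrow> g = f" by (elim ex1E) blast
    show ?thesis
    proof (rule ex1I)
      show "(\<forall>i. (f \<circ> prod.swap) i \<in> G (prod.swap i)) \<and> finite {i. (f \<circ> prod.swap) i \<noteq> \<zero>\<^bsub>M\<^esub>} \<and>
          x = (\<Oplus>\<^bsub>M\<^esub>i\<in>{i. (f \<circ> prod.swap) i \<noteq> \<zero>\<^bsub>M\<^esub>}. (f \<circ> prod.swap) i)"
        using swap[OF f Gc] by simp
      fix g assume "(\<forall>i. g i \<in> G (prod.swap i)) \<and> finite {i. g i \<noteq> \<zero>\<^bsub>M\<^esub>} \<and> x = (\<Oplus>\<^bsub>M\<^esub>i\<in>{i. g i \<noteq> \<zero>\<^bsub>M\<^esub>}. g i)"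
      then have "?P G (g \<circ> prod.swap)" using swap[of g "G \<circ> prod.swap"] Gc by (simp add: comp_def)
      then show "g = f \<circ> prod.swap" using uniq[of "g \<circ> prod.swap"] by (auto simp: fun_eq_iff)
    qed
  qed
  then show ?thesis
    unfolding bigraded_algebra_def using M by (simp add: case_prod_unfold prod.swap_def)
qed

section \<open>Koszul cohomology as a bigraded algebra\<close>

lemma additive_weight_fst: "additive_weight fst" and additive_weight_snd: "additive_weight snd"
  by (simp_all add: additive_weight_def)

lemma letter_in: "letter_matrix \<in> carrier (matrix_ring wt)"
  by (auto simp: carrier_matrix_ring letter_matrix_def intro!: exI[of _ 1])

lemma twist_in: "F \<in> carrier (matrix_ring wt) \<Longrightarrow> twist wt' F \<in> carrier (matrix_ring wt)"
  by (erule matrix_ring_pointwise[where c = "\<lambda>u v. (- 1) ^ wt' (length v, length u)"]) (rule twist_def)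

lemma matrix_part_in: "F \<in> carrier (matrix_ring wt) \<Longrightarrow> matrix_part i F \<in> carrier (matrix_ring wt)"
  by (erule matrix_ring_pointwise[where c = "\<lambda>u v. if (length v, length u) = i then 1 else 0"])
     (simp add: matrix_part_def)

text \<open>A nonzero block forces the pieces to have the prescribed lengths, and lengths add under
  concatenation.\<close>

lemma matrix_part_sgn_mult:
  "matrix_part (p + q, m + n) (sgn_mult wt (matrix_part (p, m) F) (matrix_part (q, n) G)) =
    sgn_mult wt (matrix_part (p, m) F) (matrix_part (q, n) G)"
proof (intro ext)
  fix u v
  have "block p' m' (matrix_part (p, m) F) (matrix_part (q, n) G) u v = 0"
    if "p' \<le> length v" "m' \<le> length u" "(length v, length u) \<noteq> (p + q, m + n)" for p' m'
    using that by (auto simp: block_def matrix_part_def)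
  then show "matrix_part (p + q, m + n) (sgn_mult wt (matrix_part (p, m) F) (matrix_part (q, n) G)) u v =
    sgn_mult wt (matrix_part (p, m) F) (matrix_part (q, n) G) u v"
    unfolding matrix_part_def[of "(p + q, m + n)"]
    by (cases "(length v, length u) = (p + q, m + n)") (auto simp: sgn_mult_def case_prod_unfold intro!: sum.neutral)
qed

lemma matrix_part_diff:
  "matrix_part i (\<lambda>u v. F u v - G u v) = (\<lambda>u v. matrix_part i F u v - matrix_part i G u v)"
  by (auto simp: fun_eq_iff matrix_part_def)

lemma matrix_part_letter:
  assumes "additive_weight wt"
  shows "matrix_part (Suc p, Suc m) (sgn_mult wt F letter_matrix) = sgn_mult wt (matrix_part (p, m) F) letter_matrix"
    and "matrix_part (Suc p, Suc m) (sgn_mult wt letter_matrix F) = sgn_mult wt letter_matrix (matrix_part (p, m) F)"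
    and "p = 0 \<or> m = 0 \<Longrightarrow> matrix_part (p, m) (sgn_mult wt F letter_matrix) = (\<lambda>u v. 0)"
    and "p = 0 \<or> m = 0 \<Longrightarrow> matrix_part (p, m) (sgn_mult wt letter_matrix F) = (\<lambda>u v. 0)"
  by (auto simp: fun_eq_iff matrix_part_def sgn_mult_letter[OF assms] block_def Suc_diff_le neq_Nil_conv)

lemma matrix_part_twist: "matrix_part i (twist wt F) = twist wt (matrix_part i F)"
  by (auto simp: fun_eq_iff matrix_part_def twist_def)

context based_quadratic begin

lemma cochain_minus:
  assumes "F \<in> carrier (K wt)" "G \<in> carrier (K wt)" "additive_weight wt"
  shows "cochain F \<ominus>\<^bsub>C wt\<^esub> cochain G = cochain (\<lambda>u v. F u v - G u v)"
proof -
  interpret C: ring "C wt" by (rule ring_C[OF assms(3)])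
  note [simp del] = C_simps
  have G': "(\<lambda>u v. - G u v) \<in> carrier (K wt)"
    by (rule matrix_ring_pointwise[OF assms(2), where c = "\<lambda>u v. - 1"]) simp
  have "\<ominus>\<^bsub>C wt\<^esub> cochain G = cochain (\<lambda>u v. - G u v)"
    using assms(2) G' by (intro C.minus_equality) (simp_all add: cochain_in cochain_add cochain_zero)
  then show ?thesis by (simp add: a_minus_def cochain_add)
qed

lemma k_algebra_C:
  assumes "additive_weight wt"
  shows "k_algebra (C wt)"
proof (intro k_algebra.intro ring_C[OF assms] k_algebra_axioms.intro)
  note [simp del] = C_simps
  note simps = cochain_add cochain_mult cochain_scale
  fix X assume "X \<in> carrier (C wt)"
  then obtain F where F: "F \<in> carrier (K wt)" "X = cochain F" by (rule cochain_surj)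
  have "(\<lambda>u v. c * F u v) \<in> carrier (K wt)" for c
    by (rule matrix_ring_pointwise[OF F(1), where c = "\<lambda>u v. c"]) simp
  then show "c \<odot>\<^bsub>C wt\<^esub> X \<in> carrier (C wt)" for c
    unfolding F(2) simps by (rule cochain_in)
  show "(a + b) \<odot>\<^bsub>C wt\<^esub> X = a \<odot>\<^bsub>C wt\<^esub> X \<oplus>\<^bsub>C wt\<^esub> b \<odot>\<^bsub>C wt\<^esub> X"
    "(a * b) \<odot>\<^bsub>C wt\<^esub> X = a \<odot>\<^bsub>C wt\<^esub> (b \<odot>\<^bsub>C wt\<^esub> X)" "1 \<odot>\<^bsub>C wt\<^esub> X = X" for a b
    by (simp_all add: F(2) simps algebra_simps)
  fix Y assume "Y \<in> carrier (C wt)"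
  then obtain G where G: "G \<in> carrier (K wt)" "Y = cochain G" by (rule cochain_surj)
  have "sgn_mult wt (\<lambda>u v. c * F u v) G = (\<lambda>u v. c * sgn_mult wt F G u v)"
    "sgn_mult wt F (\<lambda>u v. c * G u v) = (\<lambda>u v. c * sgn_mult wt F G u v)" for c
    by (auto simp: fun_eq_iff sgn_mult_def block_def sum_distrib_left intro!: sum.cong)
  then show "c \<odot>\<^bsub>C wt\<^esub> (X \<oplus>\<^bsub>C wt\<^esub> Y) = c \<odot>\<^bsub>C wt\<^esub> X \<oplus>\<^bsub>C wt\<^esub> c \<odot>\<^bsub>C wt\<^esub> Y"
    "(c \<odot>\<^bsub>C wt\<^esub> X) \<otimes>\<^bsub>C wt\<^esub> Y = c \<odot>\<^bsub>C wt\<^esub> (X \<otimes>\<^bsub>C wt\<^esub> Y)"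
    "X \<otimes>\<^bsub>C wt\<^esub> (c \<odot>\<^bsub>C wt\<^esub> Y) = c \<odot>\<^bsub>C wt\<^esub> (X \<otimes>\<^bsub>C wt\<^esub> Y)" for c
    by (simp_all add: F(2) G(2) simps distrib_left)
qed

lemma cochain_finsum:
  assumes "additive_weight wt" "finite N" "\<And>i. i \<in> N \<Longrightarrow> f i \<in> carrier (K wt)"
  shows "finsum (C wt) (\<lambda>i. cochain (f i)) N = cochain (\<lambda>u v. \<Sum>i\<in>N. f i u v)"
  using assms(2,3)
proof (induction N rule: finite_induct)
  interpret C: ring "C wt" by (rule ring_C[OF assms(1)])
  note [simp del] = C_simps
  {
    case empty
    show ?case using cochain_zero by simp
  next
    case (insert i N)
    then have "cochain (f i) \<in> carrier (C wt)" "(\<lambda>i. cochain (f i)) \<in> N \<rightarrow> carrier (C wt)"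
      using cochain_in by auto
    then show ?case using insert by (simp add: cochain_add)
  }
qed

lemma C_part_zero_iff: "C_part (p, m) X = \<zero>\<^bsub>C wt\<^esub> \<longleftrightarrow> X (p, m) = zero_map p"
  by (auto simp: C_part_def fun_eq_iff[of _ "\<lambda>(p, m). zero_map p"])

lemma C_part_eq_iff: "C_part i X = X \<longleftrightarrow> (\<forall>q n. (q, n) \<noteq> i \<longrightarrow> X (q, n) = zero_map q)"
  by (auto simp: C_part_def fun_eq_iff[of _ X])

text \<open>Most axioms reduce to entrywise identities of matrices inducing the cochains. That
  \<open>e\<close> squares to zero and that the nonzero parts sum to the whole hold only for the
  induced cochains.\<close>

lemma twisted_commutator_C:
  assumes wt: "additive_weight wt"
  shows "twisted_commutator (C wt) (differential wt) (C_twist wt) (cochain letter_matrix) C_part"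
proof -
  interpret C: k_algebra "C wt" by (rule k_algebra_C[OF wt])
  note [simp del] = C_simps
  have wt0: "wt (0, 0) = 0"
    using wt[unfolded additive_weight_def, THEN conjunct1, rule_format, of 0 0 0 0] by simp
  have wt1: "wt (Suc 0, Suc 0) = 1" using wt by (simp add: additive_weight_def)
  show ?thesis
  proof (intro twisted_commutator.intro twisted_commutator_axioms.intro C.k_algebra_axioms)
    show "cochain letter_matrix \<in> carrier (C wt)"
      using cochain_in letter_in .
    show "C_twist wt \<one>\<^bsub>C wt\<^esub> = \<one>\<^bsub>C wt\<^esub>"
      unfolding cochain_one[symmetric] cochain_twist
      by (rule cochain_cong) (simp add: twist_def unit_matrix_def wt0)
    show "cochain letter_matrix \<otimes>\<^bsub>C wt\<^esub> cochain letter_matrix = \<zero>\<^bsub>C wt\<^esub>"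
      by (rule cochain_letter_square[OF wt])
    have "C_twist wt (cochain letter_matrix) \<oplus>\<^bsub>C wt\<^esub> cochain letter_matrix = \<zero>\<^bsub>C wt\<^esub>"
      unfolding cochain_twist cochain_add cochain_zero[symmetric]
      by (rule cochain_cong) (auto simp: twist_def letter_matrix_def wt1)
    then show "C_twist wt (cochain letter_matrix) = \<ominus>\<^bsub>C wt\<^esub> cochain letter_matrix"
      by (intro C.minus_equality[symmetric]) (simp_all add: cochain_twist cochain_in[OF letter_in] cochain_in[OF twist_in[OF letter_in]])
    show "C_part (0, 0) \<one>\<^bsub>C wt\<^esub> = \<one>\<^bsub>C wt\<^esub>"
      unfolding cochain_one[symmetric] cochain_part
      by (rule cochain_cong) (simp add: matrix_part_def unit_matrix_def)
  next
    fix X assume X: "X \<in> carrier (C wt)"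
    then obtain F where F: "F \<in> carrier (K wt)" "X = cochain F" by (rule cochain_surj)
    show "C_twist wt X \<in> carrier (C wt)" "C_part i X \<in> carrier (C wt)" for i
      using F by (simp_all add: cochain_twist cochain_part cochain_in[OF twist_in] cochain_in[OF matrix_part_in])
    show "C_twist wt (c \<odot>\<^bsub>C wt\<^esub> X) = c \<odot>\<^bsub>C wt\<^esub> C_twist wt X"
      "C_part i (c \<odot>\<^bsub>C wt\<^esub> X) = c \<odot>\<^bsub>C wt\<^esub> C_part i X" for c i
      unfolding F(2) cochain_twist cochain_part cochain_scale
      by (rule cochain_cong; simp add: twist_def matrix_part_def)+
    show "C_twist wt (C_twist wt X) = X"
      unfolding F(2) cochain_twist
      by (rule cochain_cong) (simp add: twist_def flip: power_add mult.assoc mult_2)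
    show "differential wt X = C_twist wt X \<otimes>\<^bsub>C wt\<^esub> cochain letter_matrix \<ominus>\<^bsub>C wt\<^esub> cochain letter_matrix \<otimes>\<^bsub>C wt\<^esub> X"
      unfolding F(2) differential_cochain[OF wt] cochain_twist cochain_mult
      by (rule cochain_minus[symmetric]) (intro matrix_ring_closed twist_in letter_in F(1) wt)+
    show "C_part i (C_part j X) = (if i = j then C_part i X else \<zero>\<^bsub>C wt\<^esub>)" for i j
      unfolding F(2) cochain_part cochain_zero[symmetric] if_distrib[of cochain, symmetric]
      by (rule cochain_cong) (auto simp: matrix_part_def)
    have "{i. C_part i X \<noteq> \<zero>\<^bsub>C wt\<^esub>} = {(p, m). X (p, m) \<noteq> zero_map p}"
      by (auto simp: C_part_zero_iff)
    also have "finite \<dots>" using X by (simp add: cochain_algebra_def)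
    finally show fin: "finite {i. C_part i X \<noteq> \<zero>\<^bsub>C wt\<^esub>}" .
    show "(\<Oplus>\<^bsub>C wt\<^esub>i\<in>{i. C_part i X \<noteq> \<zero>\<^bsub>C wt\<^esub>}. C_part i X) = X"
    proof -
      let ?N = "{i. C_part i X \<noteq> \<zero>\<^bsub>C wt\<^esub>}"
      have "(\<Oplus>\<^bsub>C wt\<^esub>i\<in>?N. C_part i X) = cochain (\<lambda>u v. \<Sum>i\<in>?N. matrix_part i F u v)"
        unfolding F(2) cochain_part
        by (rule cochain_finsum[OF wt]) (use fin in \<open>simp_all add: F matrix_part_in cochain_part\<close>)
      also have "\<dots> = cochain F"
      proof -
        \<comment> \<open>A block outside \<open>?N\<close> may be nonzero as a matrix, but it
          induces the zero map.\<close>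
        have "matrix_map p m (\<lambda>u v. \<Sum>i\<in>?N. matrix_part i F u v) = matrix_map p m F" for p m
        proof (cases "(p, m) \<in> ?N")
          case True
          then show ?thesis
            using fin by (intro matrix_map_cong) (auto simp: matrix_part_def words_def sum.delta')
        next
          case False
          then have "matrix_map p m F = zero_map p"
            using C_part_zero_iff[of p m X wt] by (simp add: F(2) cochain_def)
          moreover have "matrix_map p m (\<lambda>u v. \<Sum>i\<in>?N. matrix_part i F u v) = matrix_map p m (\<lambda>u v. 0)"
            using False by (intro matrix_map_cong sum.neutral) (auto simp: matrix_part_def words_def)
          ultimately show ?thesis by (simp add: matrix_map_zero)
        qed
        then show ?thesis by (simp add: cochain_def)
      qed
      finally show ?thesis by (simp add: F(2))
    qed
    show "C_part (Suc p, Suc m) (differential wt X) = differential wt (C_part (p, m) X)" for p m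
      unfolding F(2) cochain_part differential_cochain[OF wt] matrix_part_twist[symmetric]
        matrix_part_letter(1,2)[OF wt, symmetric]
      by (rule cochain_cong) (simp add: matrix_part_def)
    show "C_part (p, m) (differential wt X) = \<zero>\<^bsub>C wt\<^esub>" if "p = 0 \<or> m = 0" for p m
      unfolding F(2) cochain_part differential_cochain[OF wt] cochain_zero[symmetric]
      by (simp add: matrix_part_diff matrix_part_letter(3,4)[OF wt that])
    fix Y assume "Y \<in> carrier (C wt)"
    then obtain G where G: "G \<in> carrier (K wt)" "Y = cochain G" by (rule cochain_surj)
    show "C_twist wt (X \<oplus>\<^bsub>C wt\<^esub> Y) = C_twist wt X \<oplus>\<^bsub>C wt\<^esub> C_twist wt Y"
      "C_part i (X \<oplus>\<^bsub>C wt\<^esub> Y) = C_part i X \<oplus>\<^bsub>C wt\<^esub> C_part i Y" for i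
      unfolding F(2) G(2) cochain_twist cochain_part cochain_add
      by (rule cochain_cong; simp add: twist_def matrix_part_def distrib_left)+
    show "C_twist wt (X \<otimes>\<^bsub>C wt\<^esub> Y) = C_twist wt X \<otimes>\<^bsub>C wt\<^esub> C_twist wt Y"
      unfolding F(2) G(2) cochain_twist cochain_mult twist_mult[OF wt] ..
    show "C_part (p + q, m + n) (X \<otimes>\<^bsub>C wt\<^esub> Y) = X \<otimes>\<^bsub>C wt\<^esub> Y"
      if XY: "C_part (p, m) X = X" "C_part (q, n) Y = Y" for p q m n
    proof -
      have X: "X = cochain (matrix_part (p, m) F)" and Y: "Y = cochain (matrix_part (q, n) G)"
        using XY by (simp_all add: F(2) G(2) cochain_part)
      show ?thesis by (simp only: X Y cochain_mult cochain_part matrix_part_sgn_mult)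
    qed
  qed
qed

lemma cohomology_bigraded:
  assumes "additive_weight wt"
  shows "k_ideal (coboundaries wt) (C wt\<lparr>carrier := cocycles wt\<rparr>)"
    and "bigraded_algebra (cohomology wt) (\<lambda>(p, m). cohomology_weight wt p m)"
proof -
  interpret C: twisted_commutator "C wt" "differential wt" "C_twist wt" "cochain letter_matrix" C_part
    by (rule twisted_commutator_C[OF assms])
  note [simp del] = C_simps
  have Z: "C.Z = cocycles wt" by (simp add: C.Z_def cocycles_def)
  have B: "C.B = coboundaries wt" by (simp add: C.B_def coboundaries_def)
  show "k_ideal (coboundaries wt) (C wt\<lparr>carrier := cocycles wt\<rparr>)"
    using C.H.k_ideal_axioms unfolding Z B .
  have "C.H.G (p, m) = cohomology_weight wt p m" for p m
    unfolding C.H.G_def unfolding Z B by (auto simp: cohomology_weight_def C_part_eq_iff coset_update_carrier)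
  then have "C.H.G = (\<lambda>(p, m). cohomology_weight wt p m)" by auto
  then show "bigraded_algebra (cohomology wt) (\<lambda>(p, m). cohomology_weight wt p m)"
    using C.H.bigraded_quotient unfolding Z B cohomology_def by simp
qed

end

section \<open>Duality\<close>

lemma bilinear_transpose: "bilinear J p m (\<lambda>u v. F v u) u c = bilinear J m p F c u"
  unfolding bilinear_def by (subst sum.swap) (simp add: mult_ac)

lemma transpose_in: "F \<in> carrier (matrix_ring wt) \<Longrightarrow> (\<lambda>u v. F v u) \<in> carrier (matrix_ring wt')"
  unfolding carrier_matrix_ring by blast

lemma sgn_mult_transpose:
  "sgn_mult snd (\<lambda>u v. F v u) (\<lambda>u v. G v u) = (\<lambda>u v. sgn_mult fst F G v u)"
proof (intro ext)
  fix u v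
  show "sgn_mult snd (\<lambda>u v. F v u) (\<lambda>u v. G v u) u v = sgn_mult fst F G v u"
    unfolding sgn_mult_def
    by (rule sum.reindex_bij_witness[of _ prod.swap prod.swap]) (auto simp: block_def)
qed

text \<open>The two algebras are related only through their relations in coordinates. The dual space
  and the pairing of tensors enter later, when \<open>S_dual\<close> is verified.\<close>

locale dual_pair =
  A: based_quadratic scale V J e x R + B: based_quadratic scale' V' J e' x' R'
  for scale :: "'k::field \<Rightarrow> 'v::ab_group_add \<Rightarrow> 'v" and V and J :: "'i set" and e x and R
    and scale' :: "'k \<Rightarrow> 'w::ab_group_add \<Rightarrow> 'w" and V' e' x' and R' +
  assumes S_dual: "B.S = annihilator J A.S"
begin

text \<open>Since annihilators are involutive here, the spaces \<open>Wc\<close> and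
  \<open>W'\<close> of the second algebra are \<open>W'\<close> and \<open>Wc\<close> of the first.
  The two criteria then differ only by exchanging the arguments of the bilinear form.\<close>

lemma transpose_eq_iff:
  "B.cochain (\<lambda>u v. F v u) = B.cochain (\<lambda>u v. G v u) \<longleftrightarrow> A.cochain F = A.cochain G"
proof -
  have "annihilator J B.S = A.S"
    unfolding S_dual by (rule annihilator_annihilator[OF A.finite_J A.subspace_S]) (rule A.S_supp)
  then show ?thesis
    unfolding A.cochain_eq_iff B.cochain_eq_iff bilinear_transpose[where F = F] bilinear_transpose[where F = G] S_dual
    by (simp only:) blast
qed

text \<open>The choice of a matrix is immaterial, since matrices that induce the same cochain have
  transposes that do so too.\<close>

definition dualize :: "('k, 'v) A.cochain \<Rightarrow> ('k, 'w) B.cochain" where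
  "dualize X = B.cochain (\<lambda>u v. (SOME F. A.cochain F = X) v u)"

lemma dualize_cochain: "dualize (A.cochain F) = B.cochain (\<lambda>u v. F v u)"
  unfolding dualize_def transpose_eq_iff by (rule someI[where P = "\<lambda>G. A.cochain G = A.cochain F"]) (rule refl)

abbreviation CA where "CA \<equiv> A.cochain_algebra fst"
abbreviation CB where "CB \<equiv> B.cochain_algebra snd"

lemma dualize_bij: "bij_betw dualize (carrier CA) (carrier CB)"
proof (rule bij_betwI')
  fix X assume "X \<in> carrier CA"
  then obtain F where F: "F \<in> carrier (A.K fst)" "X = A.cochain F" by (rule A.cochain_surj)
  then show "dualize X \<in> carrier CB"
    unfolding F(2) dualize_cochain by (intro B.cochain_in[OF transpose_in])
  fix Y assume "Y \<in> carrier CA"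
  then obtain G where G: "G \<in> carrier (A.K fst)" "Y = A.cochain G" by (rule A.cochain_surj)
  show "dualize X = dualize Y \<longleftrightarrow> X = Y"
    unfolding F(2) G(2) dualize_cochain by (rule transpose_eq_iff)
next
  fix Y assume "Y \<in> carrier CB"
  then obtain G where G: "G \<in> carrier (B.K snd)" "Y = B.cochain G" by (rule B.cochain_surj)
  then show "\<exists>X\<in>carrier CA. Y = dualize X"
    using A.cochain_in[OF transpose_in[OF G(1)]] by (intro bexI[of _ "A.cochain (\<lambda>u v. G v u)"]) (simp_all add: dualize_cochain)
qed

lemma dualize_simps:
  assumes X: "X \<in> carrier CA"
  shows "Y \<in> carrier CA \<Longrightarrow> dualize (X \<oplus>\<^bsub>CA\<^esub> Y) = dualize X \<oplus>\<^bsub>CB\<^esub> dualize Y"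
    and "Y \<in> carrier CA \<Longrightarrow> dualize (X \<otimes>\<^bsub>CA\<^esub> Y) = dualize X \<otimes>\<^bsub>CB\<^esub> dualize Y"
    and "dualize (c \<odot>\<^bsub>CA\<^esub> X) = c \<odot>\<^bsub>CB\<^esub> dualize X"
    and "dualize (A.differential fst X) = B.differential snd (dualize X)"
    and "dualize (A.C_part (p, m) X) = B.C_part (m, p) (dualize X)"
proof -
  note [simp del] = A.C_simps B.C_simps
  obtain F where F: "F \<in> carrier (A.K fst)" "X = A.cochain F" using X by (rule A.cochain_surj)
  show "dualize (c \<odot>\<^bsub>CA\<^esub> X) = c \<odot>\<^bsub>CB\<^esub> dualize X"
    by (simp add: F(2) A.cochain_scale B.cochain_scale dualize_cochain)
  have tw: "twist snd (\<lambda>u v. F v u) = (\<lambda>u v. twist fst F v u)"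
    by (simp add: fun_eq_iff twist_def)
  \<comment> \<open>The canonical maps of both algebras have the same symmetric matrix, so they
    correspond to each other under transposition.\<close>
  have letter: "letter_matrix = (\<lambda>u v. letter_matrix v u :: 'k)"
    by (auto simp: fun_eq_iff letter_matrix_def)
  have "sgn_mult snd (\<lambda>u v. twist fst F v u) letter_matrix = (\<lambda>u v. sgn_mult fst (twist fst F) letter_matrix v u)"
    "sgn_mult snd letter_matrix (\<lambda>u v. F v u) = (\<lambda>u v. sgn_mult fst letter_matrix F v u)"
    by (subst letter, rule sgn_mult_transpose)+
  then show "dualize (A.differential fst X) = B.differential snd (dualize X)"
    by (simp add: F(2) A.differential_cochain[OF additive_weight_fst] B.differential_cochain[OF additive_weight_snd]
        dualize_cochain tw)
  have "matrix_part (m, p) (\<lambda>u v. F v u) = (\<lambda>u v. matrix_part (p, m) F v u)"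
    by (auto simp: fun_eq_iff matrix_part_def)
  then show "dualize (A.C_part (p, m) X) = B.C_part (m, p) (dualize X)"
    by (simp add: F(2) A.cochain_part B.cochain_part dualize_cochain)
  assume "Y \<in> carrier CA"
  then obtain G where G: "G \<in> carrier (A.K fst)" "Y = A.cochain G" by (rule A.cochain_surj)
  show "dualize (X \<oplus>\<^bsub>CA\<^esub> Y) = dualize X \<oplus>\<^bsub>CB\<^esub> dualize Y"
    by (simp add: F(2) G(2) A.cochain_add B.cochain_add dualize_cochain)
  show "dualize (X \<otimes>\<^bsub>CA\<^esub> Y) = dualize X \<otimes>\<^bsub>CB\<^esub> dualize Y"
    by (simp add: F(2) G(2) A.cochain_mult B.cochain_mult dualize_cochain sgn_mult_transpose)
qed

lemma dualize_one: "dualize \<one>\<^bsub>CA\<^esub> = \<one>\<^bsub>CB\<^esub>" and dualize_zero: "dualize \<zero>\<^bsub>CA\<^esub> = \<zero>\<^bsub>CB\<^esub>"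
proof -
  have "(\<lambda>u v. unit_matrix v u) = (unit_matrix :: ('i, 'k) word_matrix)"
    by (auto simp: fun_eq_iff unit_matrix_def)
  then show "dualize \<one>\<^bsub>CA\<^esub> = \<one>\<^bsub>CB\<^esub>"
    unfolding A.cochain_one[symmetric] B.cochain_one[symmetric] dualize_cochain by simp
  show "dualize \<zero>\<^bsub>CA\<^esub> = \<zero>\<^bsub>CB\<^esub>"
    unfolding A.cochain_zero[symmetric] B.cochain_zero[symmetric] dualize_cochain ..
qed

lemma differential_closed: "X \<in> carrier CA \<Longrightarrow> A.differential fst X \<in> carrier CA"
proof -
  interpret C: twisted_commutator CA "A.differential fst" "A.C_twist fst" "A.cochain letter_matrix" A.C_part
    by (rule A.twisted_commutator_C[OF additive_weight_fst])
  show "X \<in> carrier CA \<Longrightarrow> A.differential fst X \<in> carrier CA" by (rule C.d_closed)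
qed

lemma zero_closed: "\<zero>\<^bsub>CA\<^esub> \<in> carrier CA"
proof -
  interpret C: ring CA by (rule A.ring_C[OF additive_weight_fst])
  show ?thesis by (rule C.zero_closed)
qed

lemma dualize_cocycles: "bij_betw dualize (A.cocycles fst) (B.cocycles snd)"
proof -
  note [simp del] = A.C_simps B.C_simps
  have inj: "inj_on dualize (carrier CA)" and im: "dualize ` carrier CA = carrier CB"
    using dualize_bij by (simp_all add: bij_betw_def)
  have *: "dualize X \<in> B.cocycles snd \<longleftrightarrow> X \<in> A.cocycles fst" if X: "X \<in> carrier CA" for X
  proof -
    have "B.differential snd (dualize X) = \<zero>\<^bsub>CB\<^esub> \<longleftrightarrow> dualize (A.differential fst X) = dualize \<zero>\<^bsub>CA\<^esub>"
      by (simp add: dualize_simps(4)[OF X] dualize_zero)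
    also have "\<dots> \<longleftrightarrow> A.differential fst X = \<zero>\<^bsub>CA\<^esub>"
      by (rule inj_on_eq_iff[OF inj differential_closed[OF X] zero_closed])
    finally show ?thesis using X im by (auto simp: A.cocycles_def B.cocycles_def)
  qed
  have sub: "A.cocycles fst \<subseteq> carrier CA" "B.cocycles snd \<subseteq> carrier CB"
    by (auto simp: A.cocycles_def B.cocycles_def)
  have "dualize ` A.cocycles fst = B.cocycles snd"
  proof
    show "dualize ` A.cocycles fst \<subseteq> B.cocycles snd" using * sub(1) by auto
    show "B.cocycles snd \<subseteq> dualize ` A.cocycles fst"
    proof
      fix Y assume Y: "Y \<in> B.cocycles snd"
      then have "Y \<in> dualize ` carrier CA" using sub(2) im by blast
      then obtain X where "X \<in> carrier CA" "Y = dualize X" by blast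
      then show "Y \<in> dualize ` A.cocycles fst" using * Y by blast
    qed
  qed
  then show ?thesis
    using inj_on_subset[OF inj sub(1)] by (simp add: bij_betw_def)
qed

lemma dualize_coboundaries: "dualize ` A.coboundaries fst = B.coboundaries snd"
proof -
  have "dualize ` A.coboundaries fst = B.differential snd ` dualize ` carrier CA"
    unfolding A.coboundaries_def image_image by (rule image_cong[OF refl dualize_simps(4)])
  then show ?thesis using dualize_bij by (simp add: bij_betw_def B.coboundaries_def)
qed

theorem cohomology_duality:
  "bigraded_algebra_iso ((`) dualize) A.HK (\<lambda>(p, m). A.HK_weight p m)
    B.modified_HK (\<lambda>(m, p). B.modified_HK_weight p m)"
proof -
  note [simp del] = A.C_simps B.C_simps quotient_algebra_simps
  let ?ZA = "CA\<lparr>carrier := A.cocycles fst\<rparr>" and ?ZB = "CB\<lparr>carrier := B.cocycles snd\<rparr>"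
  have sub: "X \<in> carrier CA" if "X \<in> A.cocycles fst" for X
    using that by (auto simp: A.cocycles_def)
  have iso: "(`) dualize \<in> ring_iso (quotient_algebra ?ZA (A.coboundaries fst)) (quotient_algebra ?ZB (B.coboundaries snd))"
    and coset: "\<And>X. X \<in> carrier ?ZA \<Longrightarrow>
      dualize ` (A.coboundaries fst +>\<^bsub>?ZA\<^esub> X) = B.coboundaries snd +>\<^bsub>?ZB\<^esub> dualize X"
    and smult: "\<And>c X. X \<in> carrier (quotient_algebra ?ZA (A.coboundaries fst)) \<Longrightarrow>
      dualize ` (c \<odot>\<^bsub>quotient_algebra ?ZA (A.coboundaries fst)\<^esub> X) =
      c \<odot>\<^bsub>quotient_algebra ?ZB (B.coboundaries snd)\<^esub> (dualize ` X)"
    by (rule quotient_algebra_iso[OF A.cohomology_bigraded(1)[OF additive_weight_fst]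
          B.cohomology_bigraded(1)[OF additive_weight_snd], where \<phi> = dualize],
        simp_all add: dualize_cocycles dualize_coboundaries dualize_simps dualize_one sub)+
  have "(`) dualize ` A.HK_weight p m = B.modified_HK_weight m p" for p m
  proof -
    have coset': "dualize ` (A.coboundaries fst +>\<^bsub>CA\<^esub> X) = B.coboundaries snd +>\<^bsub>CB\<^esub> dualize X" if "X \<in> A.cocycles fst" for X
      using coset[of X] that by (simp add: coset_update_carrier)
    \<comment> \<open>Homogeneity is invariance under a projection, and the injective map
      \<open>dualize\<close> carries the projection of biweight (p, m) to that of (m, p).\<close>
    have part: "A.C_part (p, m) X = X \<longleftrightarrow> B.C_part (m, p) (dualize X) = dualize X" if X: "X \<in> A.cocycles fst" for X
    proof -
      interpret C: twisted_commutator CA "A.differential fst" "A.C_twist fst" "A.cochain letter_matrix" A.C_part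
        by (rule A.twisted_commutator_C[OF additive_weight_fst])
      have "A.C_part (p, m) X = X \<longleftrightarrow> dualize (A.C_part (p, m) X) = dualize X"
        using dualize_bij C.part_closed[OF sub[OF X]] sub[OF X] by (auto simp: bij_betw_def inj_on_eq_iff)
      then show ?thesis by (simp add: dualize_simps(5)[OF sub[OF X]])
    qed
    have A: "A.HK_weight p m = (+>\<^bsub>CA\<^esub>) (A.coboundaries fst) ` {X \<in> A.cocycles fst. A.C_part (p, m) X = X}"
      unfolding A.HK_weight_def A.cohomology_weight_def A.C_part_eq_iff by blast
    have B: "B.modified_HK_weight m p = (+>\<^bsub>CB\<^esub>) (B.coboundaries snd) ` {Y \<in> B.cocycles snd. B.C_part (m, p) Y = Y}"
      unfolding B.modified_HK_weight_def B.cohomology_weight_def B.C_part_eq_iff by blast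
    let ?S = "{X \<in> A.cocycles fst. A.C_part (p, m) X = X}"
    have im: "dualize ` A.cocycles fst = B.cocycles snd" using dualize_cocycles by (simp add: bij_betw_def)
    have S: "{Y \<in> B.cocycles snd. B.C_part (m, p) Y = Y} = dualize ` ?S"
      unfolding im[symmetric] by (auto simp: part)
    have "(`) dualize ` A.HK_weight p m = (\<lambda>X. dualize ` (A.coboundaries fst +>\<^bsub>CA\<^esub> X)) ` ?S"
      unfolding A by (rule image_image)
    also have "\<dots> = (\<lambda>X. B.coboundaries snd +>\<^bsub>CB\<^esub> dualize X) ` ?S"
      by (rule image_cong[OF refl coset']) simp
    also have "\<dots> = B.modified_HK_weight m p"
      unfolding B S by (rule image_image[symmetric])
    finally show ?thesis .
  qed
  then show ?thesis
    unfolding bigraded_algebra_iso_def A.HK_def B.modified_HK_def A.cohomology_def B.cohomology_def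
    using iso smult by auto
qed

end

lemma bigraded_algebra_iso_linear_iso:
  assumes "bigraded_algebra_iso h M G N H" "G i \<subseteq> carrier M"
  shows "linear_iso h M (G i) N (H i)"
proof -
  have h: "h \<in> ring_hom M N" "inj_on h (carrier M)" "h ` G i = H i"
    "\<And>c x. x \<in> carrier M \<Longrightarrow> h (c \<odot>\<^bsub>M\<^esub> x) = c \<odot>\<^bsub>N\<^esub> h x"
    using assms(1) unfolding bigraded_algebra_iso_def ring_iso_def bij_betw_def by blast+
  then show ?thesis
    using inj_on_subset[OF h(2) assms(2)] assms(2) ring_hom_add[OF h(1)]
    unfolding linear_iso_def bij_betw_def by blast
qed

lemma bigraded_algebra_component: "bigraded_algebra M G \<Longrightarrow> G i \<subseteq> carrier M"
proof -
  assume "bigraded_algebra M G"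
  then have "submodule (G i) scalars M" unfolding bigraded_algebra_def by blast
  from subgroup.subset[OF submodule.axioms(1)[OF this]] show ?thesis by simp
qed

section \<open>The dual basis, and the orthogonal relations as an annihilator\<close>

lemma subspace_dual_space: "fun_space.subspace (dual_space scale)"
  if "vector_space scale" for scale :: "'k::field \<Rightarrow> 'v::ab_group_add \<Rightarrow> 'v"
proof -
  interpret vector_space_pair scale "(*) :: 'k \<Rightarrow> 'k \<Rightarrow> 'k"
    by (intro vector_space_pair.intro that) (unfold_locales, auto simp: algebra_simps)
  show ?thesis
    unfolding fun_space.subspace_def dual_space_def
    using linear_compose_add linear_compose_scale_right linear_zero
    by (auto simp: plus_fun_def fscale_def zero_fun_def)
qed

lemma tensor_pairing_linear:
  "tensor_pairing (\<omega> + \<omega>') t = tensor_pairing \<omega> t + tensor_pairing \<omega>' t"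
  "tensor_pairing (fscale c \<omega>) t = c * tensor_pairing \<omega> t"
  "tensor_pairing 0 t = 0"
  by (simp_all add: tensor_pairing_def fscale_def plus_fun_apply zero_fun_apply)

lemma tensor_pairing_sum: "tensor_pairing (\<Sum>i\<in>I. f i) t = (\<Sum>i\<in>I. tensor_pairing (f i) t)"
  by (induction I rule: infinite_finite_induct) (simp_all add: tensor_pairing_linear)

lemma tensor_pairing_eval_prod: "tensor_pairing \<omega> t = \<omega> (\<lambda>fs. t (eval_prod fs))"
proof -
  have "(\<lambda>xs. if length xs = length fs then \<Prod>i<length fs. (fs ! i) (xs ! i) else 0) = eval_prod fs"
    for fs :: "('b \<Rightarrow> 'a) list"
    by (auto simp: fun_eq_iff eval_prod_def prod.list_conv_set_nth atLeast0LessThan intro!: prod.cong)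
  then show ?thesis by (simp add: tensor_pairing_def)
qed

locale finite_quadratic = finite_dimensional_vector_space scale Basis
  for scale :: "'k::field \<Rightarrow> 'v::ab_group_add \<Rightarrow> 'v" and Basis +
  fixes R :: "('k, 'v) tensor set"
  assumes R_sub: "fun_space.subspace R" and R_deg: "R \<subseteq> tensor_power scale UNIV 2"
begin

text \<open>With respect to the dual basis, the coordinates of a form are its values at the basis
  vectors; they are cut off outside \<open>Basis\<close> as \<open>based_space\<close>
  requires.\<close>

definition dual_coord :: "'v \<Rightarrow> ('v \<Rightarrow> 'k) \<Rightarrow> 'k" where
  "dual_coord b f = (if b \<in> Basis then f b else 0)"

definition basis_coord :: "'v \<Rightarrow> 'v \<Rightarrow> 'k" where
  "basis_coord b v = representation Basis v b"

sublocale A: based_quadratic scale UNIV Basis "\<lambda>b. b" basis_coord R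
proof
  show "basis_coord j (u + v) = basis_coord j u + basis_coord j v" for j u v
    using representation_add[OF independent_Basis] span_Basis by (simp add: basis_coord_def)
  show "basis_coord j (scale c u) = c * basis_coord j u" for j c u
    using representation_scale[OF independent_Basis] span_Basis by (simp add: basis_coord_def)
  show "basis_coord j u = 0" if "j \<notin> Basis" for j u
    using that representation_ne_zero unfolding basis_coord_def by blast
  show "basis_coord i j = (if i = j then 1 else 0)" if "i \<in> Basis" "j \<in> Basis" for i j
    using that representation_basis[OF independent_Basis] by (simp add: basis_coord_def)
  show "v = (\<Sum>j\<in>Basis. scale (basis_coord j v) j)" for v
    using sum_representation_eq[OF independent_Basis, of v Basis] span_Basis finite_Basis
    by (simp add: basis_coord_def)
qed (auto simp: finite_Basis R_sub R_deg subspace_UNIV)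

lemma basis_coord_dual: "basis_coord b \<in> dual_space scale"
proof -
  interpret vector_space_pair scale "(*) :: 'k \<Rightarrow> 'k \<Rightarrow> 'k"
    by unfold_locales (auto simp: algebra_simps)
  show ?thesis
    unfolding dual_space_def using A.x_add A.x_scale
    by (auto simp: linear_iff_module_hom module_hom_iff module_axioms vs2.module_axioms)
qed

lemma dual_linear:
  assumes "f \<in> dual_space scale"
  shows "f (u + v) = f u + f v" "f (scale c u) = c * f u"
proof -
  interpret f: Vector_Spaces.linear scale "(*)" f using assms by (simp add: dual_space_def)
  show "f (u + v) = f u + f v" "f (scale c u) = c * f u" by (rule f.add, rule f.scale)
qed

lemma subspace_orthogonal: "fun_space.subspace (orthogonal_relations scale R)"
  unfolding orthogonal_relations_def fun_space.subspace_def tensor_power_def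
  by (auto simp: tensor_pairing_linear fun_space.span_zero fun_space.span_add fun_space.span_scale)

sublocale B: based_quadratic fscale "dual_space scale" Basis basis_coord dual_coord "orthogonal_relations scale R"
proof
  show "fun_space.subspace (dual_space scale)"
    by (rule subspace_dual_space[OF vector_space_axioms])
  show "f = (\<Sum>j\<in>Basis. fscale (dual_coord j f) (basis_coord j))" if f: "f \<in> dual_space scale" for f
  proof
    fix v
    have "f v = f (\<Sum>j\<in>Basis. scale (basis_coord j v) j)" using A.expand[of v] by simp
    also have "\<dots> = (\<Sum>j\<in>Basis. basis_coord j v * f j)"
    proof -
      interpret f: Vector_Spaces.linear scale "(*)" f using f by (simp add: dual_space_def)
      show ?thesis by (simp add: f.sum f.scale)
    qed
    finally show "f v = (\<Sum>j\<in>Basis. fscale (dual_coord j f) (basis_coord j)) v"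
      by (simp add: sum_fun_apply fscale_def dual_coord_def mult.commute)
  qed
  show "orthogonal_relations scale R \<subseteq> tensor_power fscale (dual_space scale) 2"
    by (auto simp: orthogonal_relations_def)
qed (auto simp: finite_Basis basis_coord_dual subspace_orthogonal dual_coord_def plus_fun_apply fscale_def A.x_e)

text \<open>Both sides are linear in \<omega>, which is a combination of pure tensors of dual basis
  vectors. For such a tensor the pairing evaluates \<open>t\<close> at the coordinate form of the
  word.\<close>

lemma tensor_pairing_coord:
  assumes "\<omega> \<in> B.Tp n" "t \<in> A.Ts"
  shows "tensor_pairing \<omega> t = pairing Basis n (B.coord \<omega>) (A.coord t)"
proof -
  have ml: "multilinear_on scale UNIV (*) (eval_prod fs)" if "set fs \<subseteq> dual_space scale" for fs
    using that by (intro multilinear_eval_prod) (auto simp: dual_linear)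
  have middle: "eval_prod (fs @ f # gs) xs = eval_prod fs (take (length fs) xs) *
      (eval_prod [f] (take 1 (drop (length fs) xs)) * eval_prod gs (drop 1 (drop (length fs) xs)))"
    for fs gs :: "('v \<Rightarrow> 'k) list" and f xs
    using eval_prod_append_left[of "[f]" gs "drop (length fs) xs"] by (simp add: eval_prod_append_left)
  have single: "eval_prod [fscale c f] xs = c * eval_prod [f] xs"
    "eval_prod [f + g] xs = eval_prod [f] xs + eval_prod [g] xs" for c and f g :: "'v \<Rightarrow> 'k" and xs
    by (cases xs; simp add: eval_prod_def fscale_def plus_fun_apply)+
  \<comment> \<open>Without multilinearity a pure tensor over the dual space would return zero
    instead of the value at its list.\<close>
  have "multilinear_on fscale (dual_space scale) (*) (\<lambda>fs. t (eval_prod fs))"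
    unfolding multilinear_on_def
  proof (intro allI impI conjI ballI; elim conjE)
    fix fs gs f c assume V: "set fs \<subseteq> dual_space scale" "set gs \<subseteq> dual_space scale" "f \<in> dual_space scale"
    have "eval_prod (fs @ fscale c f # gs) = (\<lambda>xs. c * eval_prod (fs @ f # gs) xs)"
      by (simp add: fun_eq_iff middle single mult.left_commute)
    then show "t (eval_prod (fs @ fscale c f # gs)) = c * t (eval_prod (fs @ f # gs))"
      using A.tensor_linear'(2)[OF assms(2) ml[of "fs @ f # gs"]] V by simp
  next
    fix fs gs f g assume V: "set fs \<subseteq> dual_space scale" "set gs \<subseteq> dual_space scale"
      "f \<in> dual_space scale" "g \<in> dual_space scale"
    have "eval_prod (fs @ (f + g) # gs) = (\<lambda>xs. eval_prod (fs @ f # gs) xs + eval_prod (fs @ g # gs) xs)"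
      by (simp add: fun_eq_iff middle single algebra_simps)
    then show "t (eval_prod (fs @ (f + g) # gs)) = t (eval_prod (fs @ f # gs)) + t (eval_prod (fs @ g # gs))"
      using A.tensor_linear'(1)[OF assms(2) ml[of "fs @ f # gs"] ml[of "fs @ g # gs"]] V by simp
  qed
  then have pure: "tensor_pairing (B.pure (map basis_coord w)) t = A.coord t w" for w
    by (simp add: tensor_pairing_eval_prod pure_tensor_def A.coord_def A.form_eval_prod)
  have "tensor_pairing \<omega> t = tensor_pairing (B.tens n (B.coord \<omega>)) t"
    by (simp add: B.tens_coord[OF assms(1)])
  then show ?thesis
    by (simp add: B.tens_def tensor_pairing_sum tensor_pairing_linear pure pairing_def)
qed

sublocale dual_pair scale UNIV Basis "\<lambda>b. b" basis_coord R
  fscale "dual_space scale" basis_coord dual_coord "orthogonal_relations scale R"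
proof
  show "B.S = annihilator Basis A.S"
  proof
    show "B.S \<subseteq> annihilator Basis A.S"
    proof
      fix d assume "d \<in> B.S"
      then obtain \<omega> where \<omega>: "\<omega> \<in> orthogonal_relations scale R" "d = B.coord \<omega>" by (auto simp: B.S_def)
      then have "\<omega> \<in> B.Tp 2" by (simp add: orthogonal_relations_def)
      then have "pairing Basis 2 d (A.coord r) = 0" if "r \<in> R" for r
        using tensor_pairing_coord[of \<omega> 2 r] \<omega> that R_deg A.Tp_Ts by (auto simp: orthogonal_relations_def)
      then show "d \<in> annihilator Basis A.S"
        using B.S_supp[OF \<open>d \<in> B.S\<close>] by (auto simp: annihilator_def A.S_def)
    qed
    show "annihilator Basis A.S \<subseteq> B.S"
    proof
      fix d assume d: "d \<in> annihilator Basis A.S"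
      then have "d \<in> B.supp 2" by (simp add: annihilator_def B.supp_def)
      then have eq: "d = B.coord (B.tens 2 d)" by (simp add: B.coord_tens_supp)
      have "tensor_pairing (B.tens 2 d) r = 0" if "r \<in> R" for r
        using tensor_pairing_coord[OF B.tens_in, of r 2 d] that R_deg A.Tp_Ts d eq[symmetric]
        by (auto simp: annihilator_def A.S_def)
      then have "B.tens 2 d \<in> orthogonal_relations scale R"
        by (simp add: orthogonal_relations_def B.tens_in)
      then show "d \<in> B.S" using eq unfolding B.S_def by blast
    qed
  qed
qed

end

theorem theorem1p1:
  fixes scale :: "'k::field \<Rightarrow> 'v::ab_group_add \<Rightarrow> 'v"
    and Basis :: "'v set"
    and R :: "('k, 'v) tensor set"
  assumes "finite_dimensional_vector_space scale Basis"
    and "Modules.module.subspace fscale R"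
    and "R \<subseteq> tensor_power scale UNIV 2"
  shows
    "bigraded_algebra (quadratic_data.HK scale UNIV R)
       (\<lambda>(p, m). quadratic_data.HK_weight scale UNIV R p m) \<and>
     bigraded_algebra
       (quadratic_data.modified_HK fscale (dual_space scale) (orthogonal_relations scale R))
       (\<lambda>(m, p). quadratic_data.modified_HK_weight
          fscale (dual_space scale) (orthogonal_relations scale R) p m) \<and>
     (\<exists>h. bigraded_algebra_iso h
       (quadratic_data.HK scale UNIV R)
       (\<lambda>(p, m). quadratic_data.HK_weight scale UNIV R p m)
       (quadratic_data.modified_HK fscale (dual_space scale) (orthogonal_relations scale R))
       (\<lambda>(m, p). quadratic_data.modified_HK_weight
          fscale (dual_space scale) (orthogonal_relations scale R) p m)) \<and>
     (\<forall>p m. \<exists>h. linear_iso h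
       (quadratic_data.HK scale UNIV R)
       (quadratic_data.HK_weight scale UNIV R p m)
       (quadratic_data.modified_HK fscale (dual_space scale) (orthogonal_relations scale R))
       (quadratic_data.modified_HK_weight
          fscale (dual_space scale) (orthogonal_relations scale R) m p))"
proof -
  interpret finite_quadratic scale Basis R
    using assms by (intro finite_quadratic.intro finite_quadratic_axioms.intro)
  have A: "bigraded_algebra A.HK (\<lambda>(p, m). A.HK_weight p m)"
    unfolding A.HK_def A.HK_weight_def by (rule A.cohomology_bigraded(2)[OF additive_weight_fst])
  have B: "bigraded_algebra B.modified_HK (\<lambda>(m, p). B.modified_HK_weight p m)"
    using bigraded_algebra_swap[OF B.cohomology_bigraded(2)[OF additive_weight_snd]]
    unfolding B.modified_HK_def B.modified_HK_weight_def by simp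
  have "linear_iso ((`) dualize) A.HK (A.HK_weight p m) B.modified_HK (B.modified_HK_weight m p)" for p m
    using bigraded_algebra_iso_linear_iso[OF cohomology_duality bigraded_algebra_component[OF A], of "(p, m)"] by simp
  then show ?thesis using A B cohomology_duality by blast
qed

end
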